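(* Let $X$ be a complete computable metric space, let $T:X\to X$, and let $\mu$ be a computable Borel probability measure on $X$ which is $T$-invariant and ergodic, with $T$ almost everywhere computable on $(X,\mu)$. Then there exist computable points $x\in X$ for which $$\lim_{n\to\infty}\frac{f(x)+f(T(x))+\cdots+f(T^{n-1}(x))}{n}=\int f\,\mathrm{d}\mu$$ holds for every continuous function $f:X\to\mathbb{R}$ with compact support.
   Context: "Algorithm" means recursive function, with the elements of countable sets (such as $\mathbb{Q}$) coded by natural numbers through fixed effective numberings. Computable metric space (CMS): a triple $(X,d,S)$ where $(X,d)$ is a separable metric space, $S=\{s_i\}_{i\in\mathbb{N}}$ is a dense numbered subset (ideal points), and the distances $d(s_i,s_j)$ are computable uniformly in $i,j$, i.e. there is an algorithm $\mathcal{A}:\mathbb{N}^3\to\mathbb{Q}$ with $|\mathcal{A}(i,j,n)-d(s_i,s_j)|<2^{-n}$. A point $x\in X$ is computable if there is an algorithm $\mathcal{A}:\mathbb{N}\to S$ with $d(\mathcal{A}(n),x)\le 2^{-n}$ for all $n$. Ideal balls are the open balls $B(s,q)$ with $s\in S$, $0<q\in\mathbb{Q}$, effectively numbered $B_0,B_1,\dots$. An open set $U$ is effective if it is the union of an algorithmically enumerated (possibly empty) family of ideal balls; a sequence of open sets is uniformly effective if a single algorithm, given the index, enumerates such balls. An effective $G_\delta$-set is the intersection of a sequence of uniformly effective open sets. A function $T:X\to Y$ between CMS's is computable on $D\subseteq X$ if there are uniformly effective open sets $U_i\subseteq X$ with $T^{-1}(B_i^Y)\cap D=U_i\cap D$ for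 all $i$. Computable measure: $X$ is bounded and the set $PM(X)$ of Borel probability measures on $X$ has the metric $W_1(\mu_1,\mu_2)=\sup_{f\in 1\text{-Lip}(X)}|\int f\,\mathrm{d}\mu_1-\int f\,\mathrm{d}\mu_2|$ ($f$ ranging over functions with Lipschitz constant at most one); the ideal points of $PM(X)$ are the finite rational convex combinations of Dirac measures $\delta_s$, $s\in S$. A measure $\mu$ is computable if it is a computable point of this CMS. For such $\mu$, a (measurable) function from $(X,\mu)$ to a CMS $Y$ is almost everywhere (a.e.) computable if it is computable on some effective $G_\delta$-set of $\mu$-measure one. *)

theory Defs
  imports "HOL-Probability.Probability" "HOL-Library.Nat_Bijection"
begin

(* Kleene's general recursive (total) functions of k arguments; the arguments of a k-ary function
   are the entries of a list of length k.  Minimisation is restricted to functions that have a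
   zero for every choice of the parameters, so only total functions are generated; these are
   exactly the total mu-recursive functions.  Values on lists of another length are irrelevant. *)
inductive recursive :: "nat \<Rightarrow> (nat list \<Rightarrow> nat) \<Rightarrow> bool" where
  zero: "recursive k (\<lambda>_. 0)"
| succ: "recursive 1 (\<lambda>xs. Suc (xs ! 0))"
| proj: "i < k \<Longrightarrow> recursive k (\<lambda>xs. xs ! i)"
| comp: "recursive m f \<Longrightarrow> length gs = m \<Longrightarrow> (\<And>g. g \<in> set gs \<Longrightarrow> recursive k g) \<Longrightarrow>
    recursive k (\<lambda>xs. f (map (\<lambda>g. g xs) gs))"
| prec: "recursive k f \<Longrightarrow> recursive (Suc (Suc k)) g \<Longrightarrow>
    recursive (Suc k) (\<lambda>xs. rec_nat (f (tl xs)) (\<lambda>n r. g (n # r # tl xs)) (hd xs))"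
| minim: "recursive (Suc k) f \<Longrightarrow> (\<And>xs. length xs = k \<Longrightarrow> \<exists>n. f (n # xs) = 0) \<Longrightarrow>
    recursive k (\<lambda>xs. LEAST n. f (n # xs) = 0)"

(* s numbers the ideal points; the rational output of an algorithm is coded via nat_to_rat_surj. *)
definition computable_metric_space ::
  "(nat \<Rightarrow> 'a::{metric_space,second_countable_topology}) \<Rightarrow> bool" where
  "computable_metric_space s \<longleftrightarrow>
     closure (range s) = UNIV \<and>
     (\<exists>A. recursive 3 A \<and>
        (\<forall>i j n. \<bar>of_rat (nat_to_rat_surj (A [i, j, n])) - dist (s i) (s j)\<bar> < 1 / 2 ^ n))"

(* The metric is a parameter because the notion is used both for points of a type of class
   metric_space and for measures under the distance W1. *)
definition computable_point :: "('a \<Rightarrow> 'a \<Rightarrow> real) \<Rightarrow> (nat \<Rightarrow> 'a) \<Rightarrow> 'a \<Rightarrow> bool" where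
  "computable_point d s x \<longleftrightarrow>
     (\<exists>A. recursive 1 A \<and> (\<forall>n. d (s (A [n])) x \<le> 1 / 2 ^ n))"

definition pos_rat :: "nat \<Rightarrow> real" where
  "pos_rat k = (case prod_decode k of (a, b) \<Rightarrow> real (Suc a) / real (Suc b))"

definition ideal_ball :: "(nat \<Rightarrow> 'a::metric_space) \<Rightarrow> nat \<Rightarrow> 'a set" where
  "ideal_ball s n = (case prod_decode n of (i, k) \<Rightarrow> ball (s i) (pos_rat k))"

(* The output 0 of the enumerating algorithm enumerates nothing and Suc m enumerates the ball m,
   so that the enumerated family may be empty. *)
definition enum_ball :: "(nat \<Rightarrow> 'a::metric_space) \<Rightarrow> nat \<Rightarrow> 'a set" where
  "enum_ball s c = (case c of 0 \<Rightarrow> {} | Suc m \<Rightarrow> ideal_ball s m)"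

definition uniformly_effective_open ::
  "(nat \<Rightarrow> 'a::metric_space) \<Rightarrow> (nat \<Rightarrow> 'a set) \<Rightarrow> bool" where
  "uniformly_effective_open s U \<longleftrightarrow>
     (\<exists>A. recursive 2 A \<and> (\<forall>i. U i = (\<Union>n. enum_ball s (A [i, n]))))"

definition effective_G_delta :: "(nat \<Rightarrow> 'a::metric_space) \<Rightarrow> 'a set \<Rightarrow> bool" where
  "effective_G_delta s D \<longleftrightarrow> (\<exists>U. uniformly_effective_open s U \<and> D = (\<Inter>i. U i))"

definition computable_fun_on ::
  "(nat \<Rightarrow> 'a::metric_space) \<Rightarrow> (nat \<Rightarrow> 'b::metric_space) \<Rightarrow> 'a set \<Rightarrow> ('a \<Rightarrow> 'b) \<Rightarrow> bool" where
  "computable_fun_on s t D T \<longleftrightarrow>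
     (\<exists>U. uniformly_effective_open s U \<and> (\<forall>i. T -` ideal_ball t i \<inter> D = U i \<inter> D))"

definition ae_computable ::
  "(nat \<Rightarrow> 'a::metric_space) \<Rightarrow> 'a measure \<Rightarrow> (nat \<Rightarrow> 'b::metric_space) \<Rightarrow> ('a \<Rightarrow> 'b) \<Rightarrow> bool" where
  "ae_computable s \<mu> t T \<longleftrightarrow>
     T \<in> borel_measurable \<mu> \<and>
     (\<exists>D. effective_G_delta s D \<and> emeasure \<mu> D = 1 \<and> computable_fun_on s t D T)"

(* Meaningful on a bounded space, where Lipschitz functions are bounded and the supremum is finite. *)
definition W1 :: "'a::metric_space measure \<Rightarrow> 'a measure \<Rightarrow> real" where
  "W1 \<mu> \<nu> = (SUP f \<in> {f :: 'a \<Rightarrow> real. 1-lipschitz_on UNIV f}.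
     \<bar>(\<integral>x. f x \<partial>\<mu>) - (\<integral>x. f x \<partial>\<nu>)\<bar>)"

(* A finite rational convex combination of Dirac measures is given by a nonempty list of pairs
   (i, v): the point s i gets the weight Suc v divided by the total of the list.
   The code n stands for the nonempty list list_decode (Suc n) of codes of pairs. *)
definition ideal_weights :: "nat \<Rightarrow> (nat \<times> real) list" where
  "ideal_weights n =
     (let ps = map prod_decode (list_decode (Suc n));
          total = (\<Sum>(i, v)\<leftarrow>ps. Suc v)
      in map (\<lambda>(i, v). (i, real (Suc v) / real total)) ps)"

definition ideal_measure :: "(nat \<Rightarrow> 'a::topological_space) \<Rightarrow> nat \<Rightarrow> 'a measure" where
  "ideal_measure s n = distr (measure_pmf (pmf_of_list (ideal_weights n))) borel s"

definition computable_measure :: "(nat \<Rightarrow> 'a::metric_space) \<Rightarrow> 'a measure \<Rightarrow> bool" where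
  "computable_measure s \<mu> \<longleftrightarrow> computable_point W1 (ideal_measure s) \<mu>"

definition invariant_measure :: "('a \<Rightarrow> 'a) \<Rightarrow> 'a measure \<Rightarrow> bool" where
  "invariant_measure T \<mu> \<longleftrightarrow> T \<in> measurable \<mu> \<mu> \<and> distr \<mu> \<mu> T = \<mu>"

definition ergodic_measure :: "('a \<Rightarrow> 'a) \<Rightarrow> 'a measure \<Rightarrow> bool" where
  "ergodic_measure T \<mu> \<longleftrightarrow>
     (\<forall>A\<in>sets \<mu>. T -` A \<inter> space \<mu> = A \<longrightarrow> emeasure \<mu> A = 0 \<or> emeasure \<mu> A = 1)"

(* The codes cover exactly the positive rational radii and the rational convex combinations of
   Dirac measures (with positive weights). *)

lemma range_pos_rat: "range pos_rat = {r \<in> \<rat>. 0 < r}"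
proof (intro equalityI subsetI)
  fix r :: real assume "r \<in> range pos_rat"
  then show "r \<in> {r \<in> \<rat>. 0 < r}"
    by (auto simp: pos_rat_def split: prod.splits intro!: Rats_divide)
next
  fix r :: real assume "r \<in> {r \<in> \<rat>. 0 < r}"
  then obtain m n :: nat where mn: "n \<noteq> 0" "\<bar>r\<bar> = m / n" and "0 < r"
    by (auto elim!: Rats_abs_nat_div_natE)
  then have r: "r = m / n" by auto
  with \<open>0 < r\<close> have "m \<noteq> 0" by (metis div_0 less_irrefl of_nat_0)
  then have "r = pos_rat (prod_encode (m - 1, n - 1))"
    unfolding r using mn(1) by (simp add: pos_rat_def of_nat_diff Suc_le_eq)
  then show "r \<in> range pos_rat" by blast
qed

lemma ideal_weights_wf: "pmf_of_list_wf (ideal_weights n)"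
proof (rule pmf_of_list_wfI)
  define ps where "ps = map prod_decode (list_decode (Suc n))"
  define W where "W = (\<Sum>(i, v)\<leftarrow>ps. Suc v)"
  have eq: "ideal_weights n = map (\<lambda>(i, v). (i, real (Suc v) / real W)) ps"
    by (simp add: ideal_weights_def ps_def W_def Let_def)
  show "\<And>x. x \<in> set (map snd (ideal_weights n)) \<Longrightarrow> x \<ge> 0"
    unfolding eq by auto
  have "ps \<noteq> []" by (simp add: ps_def split: prod.splits)
  then have "W > 0" unfolding W_def by (cases ps) (auto split: prod.splits)
  have "sum_list (map snd (map (\<lambda>(i, v). (i, real (Suc v) / real W)) qs)) =
      real (\<Sum>(i, v)\<leftarrow>qs. Suc v) / real W" for qs :: "(nat \<times> nat) list"
    by (induction qs) (auto simp: add_divide_distrib)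
  from this[of ps] have "sum_list (map snd (ideal_weights n)) = real W / real W"
    unfolding eq W_def .
  with \<open>W > 0\<close> show "sum_list (map snd (ideal_weights n)) = 1"
    by simp
qed

lemma emeasure_ideal_measure:
  assumes "A \<in> sets borel"
  shows "emeasure (ideal_measure s n) A =
    (\<Sum>(i, q)\<leftarrow>ideal_weights n. ennreal q * emeasure (return borel (s i)) A)"
proof -
  have nn: "\<And>x. x \<in> set (ideal_weights n) \<Longrightarrow> snd x \<ge> 0"
    using ideal_weights_wf[of n] by (auto simp: pmf_of_list_wf_def)
  have "ennreal (sum_list (map snd (filter (\<lambda>x. fst x \<in> s -` A) qs))) =
      (\<Sum>(i, q)\<leftarrow>qs. ennreal q * emeasure (return borel (s i)) A)"
    if "\<And>x. x \<in> set qs \<Longrightarrow> snd x \<ge> 0" for qs :: "(nat \<times> real) list"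
    using that
  proof (induction qs)
    case (Cons a qs)
    have "sum_list (map snd (filter (\<lambda>x. fst x \<in> s -` A) qs)) \<ge> 0"
      using Cons.prems by (intro sum_list_nonneg) auto
    then show ?case
      using Cons assms by (auto simp: indicator_def split: prod.splits)
  qed simp
  with nn assms show ?thesis
    unfolding ideal_measure_def
    by (simp add: emeasure_distr emeasure_pmf_of_list[OF ideal_weights_wf])
qed

lemma ideal_weights_surj:
  assumes "ws \<noteq> []" "\<And>i q. (i, q) \<in> set ws \<Longrightarrow> q \<in> \<rat> \<and> q > 0" "sum_list (map snd ws) = 1"
  shows "\<exists>n. ideal_weights n = ws"
proof -
  have "\<exists>N>0. \<forall>(i, q)\<in>set ws. \<exists>m>0::nat. q * real (N::nat) = real m"
    using assms(2)
  proof (induction ws)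
    case (Cons a ws)
    obtain i q where a: "a = (i, q)" by force
    obtain N where N: "N > 0" "\<forall>(i, q)\<in>set ws. \<exists>m>0::nat. q * real (N::nat) = real m"
      using Cons by force
    obtain m k :: nat where mk: "k \<noteq> 0" "\<bar>q\<bar> = m / k"
      using Cons.prems[of i q] a by (auto elim!: Rats_abs_nat_div_natE)
    then have "q = m / k" "q > 0" using Cons.prems[of i q] a by auto
    have "m > 0"
    proof (rule ccontr)
      assume "\<not> m > 0"
      with \<open>q = m / k\<close> have "q = 0" by simp
      with \<open>q > 0\<close> show False by simp
    qed
    note q = \<open>q = m / k\<close> this
    have "\<exists>m>0::nat. q' * real (N * k) = real m" if mem: "(i', q') \<in> set ws" for i' q'
    proof -
      obtain m' :: nat where m': "m' > 0" "q' * real N = real m'"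
        using bspec[OF N(2) mem] by auto
      have "q' * real (N * k) = (q' * real N) * real k" by simp
      also have "\<dots> = real (m' * k)" using m'(2) by simp
      finally show ?thesis using m'(1) mk(1) by (intro exI[of _ "m' * k"]) simp
    qed
    moreover have "q * real (N * k) = real (m * N)" using q mk by simp
    then have "\<exists>m>0::nat. q * real (N * k) = real m"
      using q(2) N(1) by (intro exI[of _ "m * N"]) simp
    ultimately have "\<forall>(i, q)\<in>set (a # ws). \<exists>m>0::nat. q * real (N * k) = real m"
      unfolding a by fastforce
    then show ?case using N(1) mk(1) by (intro exI[of _ "N * k"]) simp
  qed (simp add: exI[of _ 1])
  then obtain N where N0: "N > 0" "\<forall>(i, q)\<in>set ws. \<exists>m>0::nat. q * real (N::nat) = real m"
    by blast
  have N: "N > 0" "\<And>i q. (i, q) \<in> set ws \<Longrightarrow> \<exists>m>0::nat. q * real (N::nat) = real m"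
    using N0 by auto
  define ps where "ps = map (\<lambda>(i, q). (i, nat \<lfloor>q * real N\<rfloor> - 1)) ws"
  have v: "real (Suc (nat \<lfloor>q * real N\<rfloor> - 1)) = q * real N" if "(i, q) \<in> set ws" for i q
    using N(2)[OF that] by (auto simp: of_nat_diff)
  have "real (\<Sum>(i, v)\<leftarrow>map (\<lambda>(i, q). (i, nat \<lfloor>q * real N\<rfloor> - 1)) us. Suc v) =
      sum_list (map snd us) * real N" if "set us \<subseteq> set ws" for us
    using that
  proof (induction us)
    case (Cons a us)
    obtain i q where a: "a = (i, q)" by force
    then have "real (Suc (nat \<lfloor>q * real N\<rfloor> - 1)) = q * real N" using Cons.prems v by auto
    with Cons show ?case
      by (simp only: a list.map prod.case sum_list.Cons of_nat_add)
         (simp add: algebra_simps)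
  qed simp
  from this[of ws] have W: "real (\<Sum>(i, v)\<leftarrow>ps. Suc v) = real N"
    using assms(3) by (simp add: ps_def)
  have ps: "map (\<lambda>(i, v). (i, real (Suc v) / real N)) ps = ws"
    unfolding ps_def map_map using N(1) v by (intro map_idI) (auto simp del: of_nat_Suc)
  have "list_encode (map prod_encode ps) \<noteq> 0"
    using assms(1) by (cases ws) (auto simp: ps_def)
  then obtain n where "list_encode (map prod_encode ps) = Suc n" by (meson not0_implies_Suc)
  then have "list_decode (Suc n) = map prod_encode ps" by (metis list_encode_inverse)
  then have "ideal_weights n = ws"
    unfolding ideal_weights_def Let_def using W ps by (simp only: map_map comp_def prod_encode_inverse map_ident)
  then show ?thesis ..
qed

end

theory Submission
  imports Defs
begin

text \<open>
  Convergence of the averages of all continuous functions with compact support follows from a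
  one-sided statement about sets: the orbit of \<open>x\<close> visits every finite union \<open>G\<close> of balls with
  lower frequency at least \<open>\<mu>(G)\<close> (\<open>finite_union_approximates_open\<close>, \<open>average_tendsto_integral\<close>).
  The gain is that only lower bounds have to be certified, and these are found by search:
  \<open>q < \<mu>(U)\<close> is semidecidable for an effective open set \<open>U\<close> and a rational number \<open>q\<close>
  (\<open>semidecidable_less_measure\<close>). No integral has to be computed.

  Fix \<open>G\<close> and a rational \<open>q < \<mu>(G)\<close>, and let \<open>A p\<close> be the set of points whose orbit visits \<open>G\<close> more
  than \<open>q p\<close> times before time \<open>p\<close>. By ergodicity \<open>\<mu>(A p)\<close> is close to 1 for a suitable \<open>p\<close>
  (\<open>visit_frequency_in_measure\<close>), so that for given \<open>m\<close> a time \<open>p\<close> with \<open>\<mu>(A p) > 1 - 4^-m\<close> can be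
  computed. By the maximal inequality, all points outside a set of measure less than \<open>2^-m\<close> spend a
  fraction of at least \<open>1 - 2^-m\<close> of every time interval \<open>[0, t)\<close> in \<open>A p\<close>
  (\<open>frequent_visits_uniformly\<close>), and such a point visits \<open>G\<close> with frequency nearly \<open>q\<close> up to each
  time \<open>t \<ge> 2^m p\<close> (\<open>visit_count_lower_bound\<close>). This controls infinitely many times \<open>t\<close>, whereas only
  finitely many conditions cut out an effective open set. The search therefore produces a sequence
  of stages with growing \<open>m\<close>, and the stage \<open>m\<close> is responsible only for the times \<open>t\<close> up to the
  start of the next one. In this way every stage becomes an effective open set whose
  complement has measure less than \<open>2^-m\<close>.

  All pairs \<open>(G, q)\<close> and all their stages are merged into one sequence, together with the open sets
  which force the orbit of \<open>x\<close> to stay in the set where \<open>T\<close> is computable. A sequence of effective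
  open sets whose complements are this small has a computable common point
  (\<open>computable_point_in_Inter\<close>): one chooses balls of shrinking radius which meet the first \<open>N\<close> sets
  of the sequence in a set of measure greater than the total measure of the complements of all the
  later ones. This condition is again semidecidable, and it guarantees that the choice can go on.
\<close>

section \<open>Recursive functions\<close>

text \<open>The predicate \<open>recursive k\<close> concerns functions on lists of every length, although only the values
  on lists of length \<open>k\<close> have a meaning. Functions that agree on these lists are identified, so that
  the values of \<open>hd\<close>, \<open>tl\<close> and \<open>!\<close> on other lists do not matter.\<close>

definition rec_ext :: "nat \<Rightarrow> (nat list \<Rightarrow> nat) \<Rightarrow> bool" where
  "rec_ext k F \<longleftrightarrow> (\<exists>F'. recursive k F' \<and> (\<forall>xs. length xs = k \<longrightarrow> F' xs = F xs))"

lemma rec_extI: "recursive k F \<Longrightarrow> rec_ext k F"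
  by (auto simp: rec_ext_def)

lemma rec_ext_cong: "rec_ext k F \<Longrightarrow> (\<And>xs. length xs = k \<Longrightarrow> F xs = G xs) \<Longrightarrow> rec_ext k G"
  by (auto simp: rec_ext_def)

lemma rec_ext_comp:
  assumes "rec_ext (length Gs) F" "\<And>G. G \<in> set Gs \<Longrightarrow> rec_ext k G"
  shows "rec_ext k (\<lambda>xs. F (map (\<lambda>G. G xs) Gs))"
proof -
  obtain F' where F': "recursive (length Gs) F'" "\<And>xs. length xs = length Gs \<Longrightarrow> F' xs = F xs"
    using assms(1) by (auto simp: rec_ext_def)
  have "\<forall>G\<in>set Gs. \<exists>G'. recursive k G' \<and> (\<forall>xs. length xs = k \<longrightarrow> G' xs = G xs)"
    using assms(2) by (auto simp: rec_ext_def)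
  then obtain h where h: "\<And>G. G \<in> set Gs \<Longrightarrow> recursive k (h G)"
    "\<And>G xs. G \<in> set Gs \<Longrightarrow> length xs = k \<Longrightarrow> h G xs = G xs"
    by metis
  have "recursive k (\<lambda>xs. F' (map (\<lambda>G. G xs) (map h Gs)))"
    by (rule recursive.comp[OF F'(1)]) (auto intro: h)
  moreover have "F' (map (\<lambda>G. G xs) (map h Gs)) = F (map (\<lambda>G. G xs) Gs)" if "length xs = k" for xs
  proof -
    have "map (\<lambda>G. G xs) (map h Gs) = map (\<lambda>G. G xs) Gs"
      using h(2) that by simp
    then show ?thesis using F'(2)[of "map (\<lambda>G. G xs) Gs"] by (simp del: map_map)
  qed
  ultimately show ?thesis unfolding rec_ext_def by blast
qed

lemma rec_ext_proj: "i < k \<Longrightarrow> rec_ext k (\<lambda>xs. xs ! i)"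
  by (intro rec_extI recursive.proj)

lemma rec_ext_prec:
  assumes "rec_ext k f" "rec_ext (Suc (Suc k)) g"
  shows "rec_ext (Suc k) (\<lambda>xs. rec_nat (f (tl xs)) (\<lambda>n r. g (n # r # tl xs)) (hd xs))"
proof -
  obtain f' where f': "recursive k f'" "\<And>xs. length xs = k \<Longrightarrow> f' xs = f xs"
    using assms(1) by (auto simp: rec_ext_def)
  obtain g' where g': "recursive (Suc (Suc k)) g'"
      "\<And>xs. length xs = Suc (Suc k) \<Longrightarrow> g' xs = g xs"
    using assms(2) unfolding rec_ext_def by blast
  have "rec_nat (f' (tl xs)) (\<lambda>n r. g' (n # r # tl xs)) m =
      rec_nat (f (tl xs)) (\<lambda>n r. g (n # r # tl xs)) m" if "length xs = Suc k" for xs m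
    using that f'(2) g'(2) by (induction m) auto
  then show ?thesis
    using recursive.prec[OF f'(1) g'(1)] unfolding rec_ext_def by blast
qed

lemma rec_ext_minim:
  assumes "rec_ext (Suc k) f" "\<And>xs. length xs = k \<Longrightarrow> \<exists>n. f (n # xs) = 0"
  shows "rec_ext k (\<lambda>xs. LEAST n. f (n # xs) = 0)"
proof -
  obtain f' where f': "recursive (Suc k) f'" "\<And>xs. length xs = Suc k \<Longrightarrow> f' xs = f xs"
    using assms(1) by (auto simp: rec_ext_def)
  have "recursive k (\<lambda>xs. LEAST n. f' (n # xs) = 0)"
    using assms(2) f'(2) by (intro recursive.minim f'(1)) auto
  with f'(2) show ?thesis unfolding rec_ext_def by (intro exI conjI) auto
qed

lemma rec_ext_comp1:
  assumes "rec_ext 1 (\<lambda>xs. f (xs ! 0))" "rec_ext k F"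
  shows "rec_ext k (\<lambda>xs. f (F xs))"
  using rec_ext_comp[of "[F]" "\<lambda>xs. f (xs ! 0)" k] assms by simp

lemma rec_ext_comp2:
  assumes "rec_ext 2 (\<lambda>xs. f (xs ! 0) (xs ! 1))" "rec_ext k F" "rec_ext k G"
  shows "rec_ext k (\<lambda>xs. f (F xs) (G xs))"
  using rec_ext_comp[of "[F, G]" "\<lambda>xs. f (xs ! 0) (xs ! 1)" k] assms by (auto simp: numeral_2_eq_2)

lemma rec_ext_Suc: "rec_ext k F \<Longrightarrow> rec_ext k (\<lambda>xs. Suc (F xs))"
  by (rule rec_ext_comp1[where f = Suc]) (simp_all add: rec_extI recursive.succ del: One_nat_def)

lemma rec_ext_const: "rec_ext k (\<lambda>_. c)"
  by (induction c) (auto intro: rec_extI recursive.zero rec_ext_Suc)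

lemma rec_ext_prec1:
  assumes "rec_ext 2 (\<lambda>xs. g (xs ! 0) (xs ! 1))" "rec_ext k F"
  shows "rec_ext k (\<lambda>xs. rec_nat c g (F xs))"
proof (rule rec_ext_comp1[OF _ assms(2), where f = "rec_nat c g"])
  have "rec_ext (Suc 0) (\<lambda>xs. rec_nat ((\<lambda>_. c) (tl xs))
      (\<lambda>n r. (\<lambda>xs. g (xs ! 0) (xs ! 1)) (n # r # tl xs)) (hd xs))"
    by (rule rec_ext_prec) (use assms in \<open>auto intro: rec_ext_const simp: numeral_2_eq_2\<close>)
  then show "rec_ext 1 (\<lambda>xs. rec_nat c g (xs ! 0))"
    by (auto elim!: rec_ext_cong simp: length_Suc_conv)
qed

lemma rec_ext_prec2:
  assumes "rec_ext 1 (\<lambda>xs. f (xs ! 0))" "rec_ext 3 (\<lambda>xs. g (xs ! 0) (xs ! 1) (xs ! 2))"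
    "rec_ext k F" "rec_ext k G"
  shows "rec_ext k (\<lambda>xs. rec_nat (f (G xs)) (\<lambda>n r. g n r (G xs)) (F xs))"
proof (rule rec_ext_comp2[OF _ assms(3,4), where f = "\<lambda>m x. rec_nat (f x) (\<lambda>n r. g n r x) m"])
  have "rec_ext (Suc 1) (\<lambda>xs. rec_nat ((\<lambda>xs. f (xs ! 0)) (tl xs))
      (\<lambda>n r. (\<lambda>xs. g (xs ! 0) (xs ! 1) (xs ! 2)) (n # r # tl xs)) (hd xs))"
    by (rule rec_ext_prec) (use assms in \<open>auto simp: numeral_3_eq_3\<close>)
  then show "rec_ext 2 (\<lambda>xs. rec_nat (f (xs ! 1)) (\<lambda>n r. g n r (xs ! 1)) (xs ! 0))"
    by (auto elim!: rec_ext_cong simp: length_Suc_conv numeral_2_eq_2)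
qed

lemma rec_ext_pred: assumes "rec_ext k F" shows "rec_ext k (\<lambda>xs. F xs - 1)"
proof -
  have "rec_nat 0 (\<lambda>n r. n) m = m - 1" for m by (cases m) auto
  moreover have "rec_ext k (\<lambda>xs. rec_nat 0 (\<lambda>n r. n) (F xs))"
    by (intro rec_ext_prec1 assms rec_ext_proj) simp
  ultimately show ?thesis by simp
qed

lemma rec_ext_add:
  assumes "rec_ext k F" "rec_ext k G" shows "rec_ext k (\<lambda>xs. F xs + G xs)"
proof -
  have "rec_nat x (\<lambda>n r. Suc r) m = m + x" for m x :: nat by (induction m) auto
  moreover have "rec_ext k (\<lambda>xs. rec_nat (G xs) (\<lambda>n r. Suc r) (F xs))"
    by (intro rec_ext_prec2[where f = "\<lambda>x. x" and g = "\<lambda>n r x. Suc r"] assms rec_ext_proj rec_ext_Suc) auto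
  ultimately show ?thesis by simp
qed

lemma rec_ext_diff:
  assumes "rec_ext k F" "rec_ext k G" shows "rec_ext k (\<lambda>xs. F xs - G xs)"
proof -
  have "rec_nat x (\<lambda>n r. r - 1) m = x - m" for m x :: nat by (induction m) auto
  moreover have "rec_ext k (\<lambda>xs. rec_nat (F xs) (\<lambda>n r. r - 1) (G xs))"
    by (intro rec_ext_prec2[where f = "\<lambda>x. x" and g = "\<lambda>n r x. r - 1"] assms rec_ext_proj rec_ext_pred) auto
  ultimately show ?thesis by simp
qed

lemma rec_ext_mult:
  assumes "rec_ext k F" "rec_ext k G" shows "rec_ext k (\<lambda>xs. F xs * G xs)"
proof -
  have "rec_nat 0 (\<lambda>n r. r + x) m = m * x" for m x :: nat by (induction m) auto
  moreover have "rec_ext k (\<lambda>xs. rec_nat 0 (\<lambda>n r. r + G xs) (F xs))"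
    by (intro rec_ext_prec2[where f = "\<lambda>x. 0" and g = "\<lambda>n r x. r + x"] assms rec_ext_proj
        rec_ext_add rec_ext_const) auto
  ultimately show ?thesis by simp
qed

lemma rec_ext_triangle:
  assumes "rec_ext k F" shows "rec_ext k (\<lambda>xs. triangle (F xs))"
proof -
  have "rec_nat 0 (\<lambda>n r. r + Suc n) m = triangle m" for m :: nat by (induction m) auto
  moreover have "rec_ext k (\<lambda>xs. rec_nat 0 (\<lambda>n r. r + Suc n) (F xs))"
    by (intro rec_ext_prec1[where g = "\<lambda>n r. r + Suc n"] assms rec_ext_proj
        rec_ext_add rec_ext_Suc) auto
  ultimately show ?thesis by simp
qed

definition pair :: "nat \<Rightarrow> nat \<Rightarrow> nat" where "pair x y = prod_encode (x, y)"
definition pfst :: "nat \<Rightarrow> nat" where "pfst z = fst (prod_decode z)"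
definition psnd :: "nat \<Rightarrow> nat" where "psnd z = snd (prod_decode z)"

lemma pfst_pair [simp]: "pfst (pair x y) = x" and psnd_pair [simp]: "psnd (pair x y) = y"
  by (simp_all add: pair_def pfst_def psnd_def)

lemma pair_pfst_psnd [simp]: "pair (pfst z) (psnd z) = z"
  by (simp add: pair_def pfst_def psnd_def)

text \<open>A direct recursion for both components would need pairs as states. Instead, minimisation finds the
  number \<open>t z\<close> of the diagonal that contains \<open>z\<close>, and the components follow by subtraction.\<close>

lemma pfst_psnd_eq:
  defines "t \<equiv> \<lambda>z. LEAST n. Suc z - triangle (Suc n) = 0"
  shows "pfst z = z - triangle (t z)" "psnd z = t z - pfst z"
proof -
  define x where "x = pfst z"
  define y where "y = psnd z"
  have "z = pair x y" by (simp add: x_def y_def)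
  then have z: "z = triangle (x + y) + x" by (simp add: pair_def prod_encode_def)
  have xy: "pfst z = x" "psnd z = y" by (simp_all add: x_def y_def)
  have mono: "triangle m \<le> triangle n" if "m \<le> n" for m n
    using that by (induction rule: dec_induct) auto
  have "t z = x + y"
    unfolding t_def
  proof (rule Least_equality)
    fix n assume "Suc z - triangle (Suc n) = 0"
    then have "triangle (x + y) < triangle (Suc n)" by (simp add: z)
    then have "\<not> Suc n \<le> x + y" using mono[of "Suc n" "x + y"] by linarith
    then show "x + y \<le> n" by simp
  qed (simp add: z)
  with xy z show "pfst z = z - triangle (t z)" "psnd z = t z - pfst z"
    by simp_all
qed

lemma rec_ext_pair:
  assumes "rec_ext k F" "rec_ext k G" shows "rec_ext k (\<lambda>xs. pair (F xs) (G xs))"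
  unfolding pair_def prod_encode_def prod.case
  by (intro rec_ext_add rec_ext_triangle assms)

lemma rec_ext_pfst_psnd:
  assumes F: "rec_ext k F"
  shows "rec_ext k (\<lambda>xs. pfst (F xs))" "rec_ext k (\<lambda>xs. psnd (F xs))"
proof -
  define t where "t z = (LEAST n. Suc z - triangle (Suc n) = 0)" for z
  have "rec_ext 1 (\<lambda>xs. LEAST n. (\<lambda>ys. Suc (ys ! 1) - triangle (Suc (ys ! 0))) (n # xs) = 0)"
  proof (rule rec_ext_minim)
    show "\<exists>n. Suc ((n # xs) ! 1) - triangle (Suc ((n # xs) ! 0)) = 0" for xs
      by (rule exI[of _ "xs ! 0"]) simp
  qed (auto intro!: rec_ext_diff rec_ext_Suc rec_ext_triangle rec_ext_proj simp del: triangle_Suc)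
  then have "rec_ext 1 (\<lambda>xs. t (xs ! 0))" by (simp add: t_def)
  from rec_ext_comp1[OF this F] have t: "rec_ext k (\<lambda>xs. t (F xs))" .
  show 1: "rec_ext k (\<lambda>xs. pfst (F xs))"
    by (simp only: pfst_psnd_eq(1) t_def[symmetric]) (intro rec_ext_diff rec_ext_triangle t F)
  show "rec_ext k (\<lambda>xs. psnd (F xs))"
    by (simp only: pfst_psnd_eq(2) t_def[symmetric]) (intro rec_ext_diff t 1)
qed

section \<open>Computable functions\<close>

text \<open>Several arguments are packed into one number by pairing. In the closure properties below, a variable
  bound by a recursion or a quantifier extends the environment \<open>x\<close> to a pair \<open>p\<close> with \<open>pfst p = x\<close>;
  thus all rules concern functions of a single variable and apply along the syntax of a term.\<close>

definition computable :: "(nat \<Rightarrow> nat) \<Rightarrow> bool" where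
  "computable f \<longleftrightarrow> rec_ext 1 (\<lambda>xs. f (xs ! 0))"

named_theorems comp_intros

lemma computable_comp: "computable f \<Longrightarrow> computable g \<Longrightarrow> computable (\<lambda>x. f (g x))"
  unfolding computable_def by (rule rec_ext_comp1)

lemma computable_comp2:
  assumes "computable (\<lambda>p. f (pfst p) (psnd p))" "computable g" "computable h"
  shows "computable (\<lambda>x. f (g x) (h x))"
  using assms unfolding computable_def
  using rec_ext_comp1[of "\<lambda>p. f (pfst p) (psnd p)" 1 "\<lambda>xs. pair (g (xs ! 0)) (h (xs ! 0))"]
  by (simp add: rec_ext_pair)

lemma computable_id [comp_intros]: "computable (\<lambda>x. x)"
  and computable_const [comp_intros]: "computable (\<lambda>_. c)"
  and computable_Suc [comp_intros]: "computable f \<Longrightarrow> computable (\<lambda>x. Suc (f x))"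
  and computable_add [comp_intros]: "computable f \<Longrightarrow> computable g \<Longrightarrow> computable (\<lambda>x. f x + g x)"
  and computable_diff [comp_intros]: "computable f \<Longrightarrow> computable g \<Longrightarrow> computable (\<lambda>x. f x - g x)"
  and computable_mult [comp_intros]: "computable f \<Longrightarrow> computable g \<Longrightarrow> computable (\<lambda>x. f x * g x)"
  and computable_pair [comp_intros]: "computable f \<Longrightarrow> computable g \<Longrightarrow> computable (\<lambda>x. pair (f x) (g x))"
  and computable_pfst [comp_intros]: "computable f \<Longrightarrow> computable (\<lambda>x. pfst (f x))"
  and computable_psnd [comp_intros]: "computable f \<Longrightarrow> computable (\<lambda>x. psnd (f x))"
  unfolding computable_def
  by (simp_all add: rec_ext_proj rec_ext_const rec_ext_Suc rec_ext_add rec_ext_diff rec_ext_mult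
      rec_ext_pair rec_ext_pfst_psnd)

lemma computable_recursive1: "recursive 1 A \<Longrightarrow> computable f \<Longrightarrow> computable (\<lambda>x. A [f x])"
  unfolding computable_def using rec_ext_comp[of "[\<lambda>xs. f (xs ! 0)]" A 1] by (simp add: rec_extI)

lemma computable_recursive2:
  "recursive 2 A \<Longrightarrow> computable f \<Longrightarrow> computable g \<Longrightarrow> computable (\<lambda>x. A [f x, g x])"
  unfolding computable_def using rec_ext_comp[of "[\<lambda>xs. f (xs ! 0), \<lambda>xs. g (xs ! 0)]" A 1]
  by (auto simp: rec_extI numeral_2_eq_2)

lemma computable_recursive3:
  "recursive 3 A \<Longrightarrow> computable f \<Longrightarrow> computable g \<Longrightarrow> computable h \<Longrightarrow>
    computable (\<lambda>x. A [f x, g x, h x])"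
  unfolding computable_def
  using rec_ext_comp[of "[\<lambda>xs. f (xs ! 0), \<lambda>xs. g (xs ! 0), \<lambda>xs. h (xs ! 0)]" A 1]
  by (auto simp: rec_extI numeral_3_eq_3)

lemma computable_rec_nat [comp_intros]:
  assumes "computable f" "computable (\<lambda>p. g (pfst p) (pfst (psnd p)) (psnd (psnd p)))" "computable h"
  shows "computable (\<lambda>x. rec_nat (f x) (\<lambda>n r. g x n r) (h x))"
proof -
  have "rec_ext 3 (\<lambda>xs. (\<lambda>p. g (pfst p) (pfst (psnd p)) (psnd (psnd p)))
      (pair (xs ! 2) (pair (xs ! 0) (xs ! 1))))"
    using assms(2) unfolding computable_def
    by (rule rec_ext_comp1[where f = "\<lambda>p. g (pfst p) (pfst (psnd p)) (psnd (psnd p))"])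
      (auto intro!: rec_ext_pair rec_ext_proj)
  then have "rec_ext 3 (\<lambda>xs. g (xs ! 2) (xs ! 0) (xs ! 1))" by simp
  from rec_ext_prec2[OF _ this, of f 1 "\<lambda>xs. h (xs ! 0)" "\<lambda>xs. xs ! 0"] assms(1,3) show ?thesis
    unfolding computable_def by (simp add: rec_ext_proj)
qed

lemma computable_Least:
  assumes "computable (\<lambda>p. f (pfst p) (psnd p))" "\<And>x. \<exists>n. f x n = 0"
  shows "computable (\<lambda>x. LEAST n. f x n = (0::nat))"
proof -
  have "rec_ext (Suc 1) (\<lambda>xs. (\<lambda>p. f (pfst p) (psnd p)) (pair (xs ! 1) (xs ! 0)))"
    using assms(1) unfolding computable_def
    by (rule rec_ext_comp1[where f = "\<lambda>p. f (pfst p) (psnd p)"])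
      (auto intro!: rec_ext_pair rec_ext_proj)
  from rec_ext_minim[OF this] assms(2) show ?thesis
    unfolding computable_def by simp
qed

lemma computable_power [comp_intros]:
  assumes "computable f" "computable g"
  shows "computable (\<lambda>x. f x ^ g x)"
proof -
  have "rec_nat 1 (\<lambda>n r. r * x) m = x ^ m" for x m :: nat by (induction m) auto
  moreover have "computable (\<lambda>x. rec_nat 1 (\<lambda>n r. r * f x) (g x))"
    by (intro comp_intros computable_comp[OF assms(1)] assms)
  ultimately show ?thesis by simp
qed

lemma computable_sum [comp_intros]:
  assumes "computable (\<lambda>p. f (pfst p) (psnd p))" "computable h"
  shows "computable (\<lambda>x. \<Sum>k<h x. f x k)"
proof -
  have "rec_nat 0 (\<lambda>n r. r + f x n) m = (\<Sum>k<m. f x k)" for x m :: nat by (induction m) auto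
  moreover have "computable (\<lambda>x. rec_nat 0 (\<lambda>n r. r + f x n) (h x))"
    by (intro comp_intros computable_comp2[OF assms(1)] assms)
  ultimately show ?thesis by simp
qed

section \<open>Decidable and semidecidable predicates\<close>

definition decidable :: "(nat \<Rightarrow> bool) \<Rightarrow> bool" where
  "decidable P \<longleftrightarrow> computable (\<lambda>x. of_bool (P x))"

lemma decidable_comp: "decidable P \<Longrightarrow> computable f \<Longrightarrow> decidable (\<lambda>x. P (f x))"
  unfolding decidable_def using computable_comp[of "\<lambda>x. of_bool (P x)" f] by simp

lemma decidable_eq_0 [comp_intros]: assumes "computable f" shows "decidable (\<lambda>x. f x = 0)"
proof -
  have "computable (\<lambda>x. 1 - f x)" by (intro comp_intros assms)
  moreover have "1 - f x = of_bool (f x = 0)" for x by simp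
  ultimately show ?thesis unfolding decidable_def by simp
qed

lemma decidable_le [comp_intros]:
  assumes "computable f" "computable g" shows "decidable (\<lambda>x. f x \<le> g x)"
proof -
  have "decidable (\<lambda>x. f x - g x = 0)" by (intro comp_intros assms)
  then show ?thesis by (simp add: diff_is_0_eq)
qed

lemma decidable_not [comp_intros]:
  assumes "decidable P" shows "decidable (\<lambda>x. \<not> P x)"
proof -
  have "decidable (\<lambda>x. of_bool (P x) = (0::nat))" 
    by (intro decidable_eq_0) (use assms in \<open>simp add: decidable_def\<close>)
  then show ?thesis by simp
qed

lemma decidable_conj [comp_intros]:
  assumes "decidable P" "decidable Q" shows "decidable (\<lambda>x. P x \<and> Q x)"
proof -
  have "computable (\<lambda>x. of_bool (P x) * of_bool (Q x))"
    using assms unfolding decidable_def by (rule computable_mult)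
  then show ?thesis by (simp add: decidable_def of_bool_conj)
qed

lemma decidable_disj [comp_intros]:
  assumes "decidable P" "decidable Q" shows "decidable (\<lambda>x. P x \<or> Q x)"
proof -
  have "decidable (\<lambda>x. \<not> (\<not> P x \<and> \<not> Q x))" by (intro comp_intros assms)
  then show ?thesis by simp
qed

lemma decidable_less [comp_intros]:
  assumes "computable f" "computable g" shows "decidable (\<lambda>x. f x < g x)"
proof -
  have "decidable (\<lambda>x. Suc (f x) \<le> g x)" by (intro comp_intros assms)
  then show ?thesis by (simp add: Suc_le_eq)
qed

lemma decidable_eq [comp_intros]:
  assumes "computable f" "computable g" shows "decidable (\<lambda>x. f x = g x)"
proof -
  have "decidable (\<lambda>x. f x \<le> g x \<and> g x \<le> f x)" by (intro comp_intros assms)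
  then show ?thesis by (simp add: eq_iff)
qed

lemma computable_of_bool [comp_intros]: "decidable P \<Longrightarrow> computable (\<lambda>x. of_bool (P x))"
  by (simp add: decidable_def)

lemma computable_if [comp_intros]:
  assumes "decidable P" "computable f" "computable g"
  shows "computable (\<lambda>x. if P x then f x else g x)"
proof -
  have "computable (\<lambda>x. of_bool (P x) * f x + (1 - of_bool (P x)) * g x)"
    by (intro comp_intros assms)
  moreover have "of_bool (P x) * f x + (1 - of_bool (P x)) * g x = (if P x then f x else g x)" for x
    by simp
  ultimately show ?thesis by simp
qed

lemma decidable_ball_less [comp_intros]:
  assumes "decidable (\<lambda>p. P (pfst p) (psnd p))" "computable h"
  shows "decidable (\<lambda>x. \<forall>k<h x. P x k)"
proof -
  have "decidable (\<lambda>x. (\<Sum>k<h x. of_bool (\<not> P x k)) = (0::nat))"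
    using assms by (intro comp_intros)
  then show ?thesis by (simp add: Ball_def del: sum_of_bool_eq)
qed

lemma decidable_bex_less [comp_intros]:
  assumes "decidable (\<lambda>p. P (pfst p) (psnd p))" "computable h"
  shows "decidable (\<lambda>x. \<exists>k<h x. P x k)"
proof -
  have "decidable (\<lambda>x. \<not> (\<forall>k<h x. \<not> P x k))"
    using assms by (intro comp_intros)
  then show ?thesis by simp
qed

lemma computable_div [comp_intros]:
  assumes "computable f" "computable g" shows "computable (\<lambda>x. f x div g x)"
proof -
  have "computable (\<lambda>x. \<Sum>k<f x. of_bool (0 < g x \<and> Suc k * g x \<le> f x))"
    by (intro comp_intros computable_comp[OF assms(1)] computable_comp[OF assms(2)] assms)
  moreover have "(\<Sum>k<m. of_bool (0 < n \<and> Suc k * n \<le> m)) = m div n" for m n :: nat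
  proof (cases "n = 0")
    case False
    have "{..<m} \<inter> {k. 0 < n \<and> Suc k * n \<le> m} = {..<m div n}"
    proof (intro equalityI subsetI)
      fix k assume "k \<in> {..<m} \<inter> {k. 0 < n \<and> Suc k * n \<le> m}"
      with False have "Suc k \<le> m div n" using less_eq_div_iff_mult_less_eq[of n "Suc k" m] by auto
      then show "k \<in> {..<m div n}" by simp
    next
      fix k assume "k \<in> {..<m div n}"
      then have *: "Suc k \<le> m div n" by simp
      with False have "Suc k * n \<le> m" using less_eq_div_iff_mult_less_eq[of n "Suc k" m] by auto
      moreover have "k < m" using * div_le_dividend[of m n] by linarith
      ultimately show "k \<in> {..<m} \<inter> {k. 0 < n \<and> Suc k * n \<le> m}" using False by auto
    qed
    then show ?thesis by (simp add: sum_of_bool_eq)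
  qed auto
  ultimately show ?thesis by simp
qed

lemma computable_mod [comp_intros]:
  assumes "computable f" "computable g" shows "computable (\<lambda>x. f x mod g x)"
  unfolding modulo_nat_def by (intro comp_intros assms)

text \<open>These are the recursively enumerable sets, in the form of an unbounded search for a witness.\<close>

definition semidecidable :: "(nat \<Rightarrow> bool) \<Rightarrow> bool" where
  "semidecidable P \<longleftrightarrow> (\<exists>Q. decidable (\<lambda>p. Q (pfst p) (psnd p)) \<and> (\<forall>x. P x \<longleftrightarrow> (\<exists>n. Q x n)))"

lemma decidable_comp2:
  assumes "decidable (\<lambda>p. P (pfst p) (psnd p))" "computable g" "computable h"
  shows "decidable (\<lambda>x. P (g x) (h x))"
  using decidable_comp[OF assms(1), of "\<lambda>x. pair (g x) (h x)"] assms(2,3) by (simp add: comp_intros)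

lemma semidecidable_comp:
  assumes "semidecidable P" "computable f"
  shows "semidecidable (\<lambda>x. P (f x))"
proof -
  obtain Q where Q: "decidable (\<lambda>p. Q (pfst p) (psnd p))" "\<And>x. P x \<longleftrightarrow> (\<exists>n. Q x n)"
    using assms(1) unfolding semidecidable_def by blast
  show ?thesis unfolding semidecidable_def
    by (rule exI[of _ "\<lambda>x n. Q (f x) n"])
      (auto simp: Q(2) intro!: decidable_comp2[OF Q(1)] computable_comp[OF assms(2)] comp_intros)
qed

lemma semidecidable_comp2:
  assumes "semidecidable (\<lambda>p. P (pfst p) (psnd p))" "computable g" "computable h"
  shows "semidecidable (\<lambda>x. P (g x) (h x))"
  using semidecidable_comp[OF assms(1), of "\<lambda>x. pair (g x) (h x)"] assms(2,3)
  by (simp add: comp_intros)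

lemma semidecidable_decidable: "decidable P \<Longrightarrow> semidecidable P"
  unfolding semidecidable_def
  using decidable_comp[OF _ computable_pfst[OF computable_id], of P]
  by (intro exI[of _ "\<lambda>x n. P x"]) auto

lemmas semidecidable_le [comp_intros] = semidecidable_decidable[OF decidable_le]
  and semidecidable_less [comp_intros] = semidecidable_decidable[OF decidable_less]
  and semidecidable_eq [comp_intros] = semidecidable_decidable[OF decidable_eq]

lemma semidecidable_Ex [comp_intros]:
  assumes "semidecidable (\<lambda>p. P (pfst p) (psnd p))"
  shows "semidecidable (\<lambda>x. \<exists>y. P x y)"
proof -
  obtain Q where Q: "decidable (\<lambda>p. Q (pfst p) (psnd p))"
      "\<And>p. P (pfst p) (psnd p) \<longleftrightarrow> (\<exists>n. Q p n)"
    using assms unfolding semidecidable_def by blast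
  have "(\<exists>y. P x y) \<longleftrightarrow> (\<exists>n. Q (pair x (pfst n)) (psnd n))" for x
    using Q(2)[of "pair x y" for y] by (metis pfst_pair psnd_pair)
  then show ?thesis unfolding semidecidable_def
    by (intro exI[of _ "\<lambda>x n. Q (pair x (pfst n)) (psnd n)"] conjI)
      (auto intro!: decidable_comp2[OF Q(1)] comp_intros)
qed

lemma semidecidable_conj [comp_intros]:
  assumes "semidecidable P" "semidecidable Q"
  shows "semidecidable (\<lambda>x. P x \<and> Q x)"
proof -
  obtain P' where P: "decidable (\<lambda>p. P' (pfst p) (psnd p))" "\<And>x. P x \<longleftrightarrow> (\<exists>n. P' x n)"
    using assms(1) unfolding semidecidable_def by blast
  obtain Q' where Q: "decidable (\<lambda>p. Q' (pfst p) (psnd p))" "\<And>x. Q x \<longleftrightarrow> (\<exists>n. Q' x n)"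
    using assms(2) unfolding semidecidable_def by blast
  have "semidecidable (\<lambda>x. \<exists>m. \<exists>n. P' x m \<and> Q' x n)"
    by ((rule semidecidable_Ex)+, rule semidecidable_decidable)
      (intro comp_intros decidable_comp2[OF P(1)] decidable_comp2[OF Q(1)])
  then show ?thesis by (simp add: P(2) Q(2))
qed

lemma semidecidable_disj [comp_intros]:
  assumes "semidecidable P" "semidecidable Q"
  shows "semidecidable (\<lambda>x. P x \<or> Q x)"
proof -
  obtain P' where P: "decidable (\<lambda>p. P' (pfst p) (psnd p))" "\<And>x. P x \<longleftrightarrow> (\<exists>n. P' x n)"
    using assms(1) unfolding semidecidable_def by blast
  obtain Q' where Q: "decidable (\<lambda>p. Q' (pfst p) (psnd p))" "\<And>x. Q x \<longleftrightarrow> (\<exists>n. Q' x n)"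
    using assms(2) unfolding semidecidable_def by blast
  have "semidecidable (\<lambda>x. \<exists>m. P' x m \<or> Q' x m)"
    by ((rule semidecidable_Ex)+, rule semidecidable_decidable)
      (intro comp_intros decidable_comp2[OF P(1)] decidable_comp2[OF Q(1)])
  then show ?thesis by (simp add: P(2) Q(2) ex_disj_distrib)
qed

lemma semidecidable_imp [comp_intros]:
  assumes "decidable P" "semidecidable Q"
  shows "semidecidable (\<lambda>x. P x \<longrightarrow> Q x)"
  unfolding imp_conv_disj
  by (intro semidecidable_disj semidecidable_decidable[OF decidable_not] assms)

text \<open>A bounded universal quantifier is harmless because finitely many searches
  have a common time bound.\<close>

lemma semidecidable_ball_less [comp_intros]:
  assumes "semidecidable (\<lambda>p. P (pfst p) (psnd p))" "computable h"
  shows "semidecidable (\<lambda>x. \<forall>k<h x. P x k)"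
proof -
  obtain Q where Q: "decidable (\<lambda>p. Q (pfst p) (psnd p))"
      "\<And>p. P (pfst p) (psnd p) \<longleftrightarrow> (\<exists>n. Q p n)"
    using assms unfolding semidecidable_def by blast
  have P: "P x k \<longleftrightarrow> (\<exists>n. Q (pair x k) n)" for x k using Q(2)[of "pair x k"] by simp
  have "(\<forall>k<m. P x k) \<longleftrightarrow> (\<exists>t. \<forall>k<m. \<exists>n<t. Q (pair x k) n)" for x m
  proof
    assume "\<forall>k<m. P x k"
    then obtain g where g: "\<And>k. k < m \<Longrightarrow> Q (pair x k) (g k)" unfolding P by metis
    show "\<exists>t. \<forall>k<m. \<exists>n<t. Q (pair x k) n"
    proof (rule exI[of _ "Suc (\<Sum>j<m. g j)"], intro allI impI)
      fix k assume "k < m"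
      then have "g k < Suc (\<Sum>j<m. g j)" using member_le_sum[of k "{..<m}" g] by simp
      with g[OF \<open>k < m\<close>] show "\<exists>n<Suc (\<Sum>j<m. g j). Q (pair x k) n" by blast
    qed
  qed (auto simp: P)
  moreover have "semidecidable (\<lambda>x. \<exists>t. \<forall>k<h x. \<exists>n<t. Q (pair x k) n)"
    by (rule semidecidable_Ex, rule semidecidable_decidable)
      (intro comp_intros decidable_comp2[OF Q(1)] computable_comp[OF assms(2)])
  ultimately show ?thesis by simp
qed

text \<open>A single search runs through the pairs of a candidate and a witness for it; it is total because for
  every argument some candidate has a witness.\<close>

lemma semidecidable_choice:
  assumes "semidecidable (\<lambda>p. P (pfst p) (psnd p))" "\<And>x. \<exists>y. P x y"
  shows "\<exists>h. computable h \<and> (\<forall>x. P x (h x))"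
proof -
  obtain Q where Q: "decidable (\<lambda>p. Q (pfst p) (psnd p))"
      "\<And>p. P (pfst p) (psnd p) \<longleftrightarrow> (\<exists>n. Q p n)"
    using assms(1) unfolding semidecidable_def by blast
  have P: "P x y \<longleftrightarrow> (\<exists>n. Q (pair x y) n)" for x y using Q(2)[of "pair x y"] by simp
  define f where "f = (\<lambda>x n. of_bool (\<not> Q (pair x (pfst n)) (psnd n)) :: nat)"
  define h where "h = (\<lambda>x. LEAST n. f x n = 0)"
  have ex: "\<exists>n. f x n = 0" for x
    using assms(2)[of x] unfolding P f_def by (metis of_bool_eq(1) pfst_pair psnd_pair)
  have "computable h" unfolding h_def
  proof (rule computable_Least[OF _ ex])
    show "computable (\<lambda>p. f (pfst p) (psnd p))"
      unfolding f_def by (intro comp_intros decidable_comp2[OF Q(1)])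
  qed
  moreover have "P x (pfst (h x))" for x
  proof -
    have "f x (h x) = 0" using LeastI_ex[OF ex[of x]] by (simp only: h_def)
    then show ?thesis unfolding P f_def by (intro exI[of _ "psnd (h x)"]) (simp split: if_splits)
  qed
  ultimately show ?thesis
    by (intro exI[of _ "\<lambda>x. pfst (h x)"]) (auto intro: comp_intros)
qed

lemma semidecidable_enumeration:
  assumes "semidecidable P" "P y0"
  shows "\<exists>g. computable g \<and> range g = {y. P y}"
proof -
  obtain Q where Q: "decidable (\<lambda>p. Q (pfst p) (psnd p))" "\<And>x. P x \<longleftrightarrow> (\<exists>n. Q x n)"
    using assms(1) unfolding semidecidable_def by blast
  define g where "g = (\<lambda>n. if Q (pfst n) (psnd n) then pfst n else y0)"
  have "computable g" unfolding g_def by (intro comp_intros Q(1))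
  moreover have "range g = {y. P y}"
  proof (intro equalityI subsetI)
    fix y assume "y \<in> {y. P y}"
    then obtain n where "Q y n" using Q(2) by auto
    then have "g (pair y n) = y" by (simp add: g_def)
    then show "y \<in> range g" by (metis rangeI)
  qed (auto simp: g_def Q(2) assms(2)[unfolded Q(2)])
  ultimately show ?thesis by blast
qed

text \<open>A recursive function must return a value also on arguments which do not satisfy \<open>Q\<close>, where the
  search for a successor may fail. Therefore the search works with indices in an enumeration of \<open>Q\<close>.\<close>

lemma semidecidable_dependent_choice:
  assumes "semidecidable Q" "semidecidable (\<lambda>p. P (pfst p) (psnd p))"
    and "Q z0" "\<And>z. Q z \<Longrightarrow> \<exists>z'. Q z' \<and> P z z'"
  shows "\<exists>f. computable f \<and> (\<forall>n. Q (f n) \<and> P (f n) (f (Suc n)))"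
proof -
  obtain g where g: "computable g" "range g = {y. Q y}"
    using semidecidable_enumeration[OF assms(1,3)] by blast
  have "\<exists>h. computable h \<and> (\<forall>u. P (g u) (g (h u)))"
  proof (rule semidecidable_choice)
    show "semidecidable (\<lambda>p. P (g (pfst p)) (g (psnd p)))"
      by (intro semidecidable_comp2[OF assms(2)] comp_intros computable_comp[OF g(1)])
    show "\<exists>v. P (g u) (g v)" for u
    proof -
      have "Q (g u)" using g(2) by blast
      then obtain z where z: "Q z" "P (g u) z" using assms(4) by blast
      then have "z \<in> range g" using g(2) by simp
      with z(2) show ?thesis by blast
    qed
  qed
  then obtain h where h: "computable h" "\<And>u. P (g u) (g (h u))" by blast
  define f where "f = (\<lambda>n. g (rec_nat 0 (\<lambda>_. h) n))"
  have "computable f" unfolding f_def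
    by (intro comp_intros computable_comp[OF g(1)] computable_comp[OF h(1)])
  then show ?thesis
    using g(2) h(2) by (intro exI[of _ f]) (auto simp: f_def)
qed

text \<open>The image of \<open>Q\<close> under the \<open>k\<close>-th power of the relation \<open>R\<close>.\<close>

primrec iter_image :: "(nat \<Rightarrow> nat \<Rightarrow> bool) \<Rightarrow> nat \<Rightarrow> (nat \<Rightarrow> bool) \<Rightarrow> nat \<Rightarrow> bool" where
  "iter_image R 0 Q = Q"
| "iter_image R (Suc k) Q = (\<lambda>c. \<exists>b. iter_image R k Q b \<and> R b c)"

text \<open>Membership in the iterated image is witnessed by a chain of \<open>k\<close> steps. The chain is coded as a nested
  pair, which makes the number of steps an ordinary argument of the decision procedure.\<close>

lemma semidecidable_iter_image:
  assumes "semidecidable (\<lambda>p. Q (pfst p) (psnd p))" "semidecidable (\<lambda>p. R (pfst p) (psnd p))"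
    and "computable k" "computable e" "computable c"
  shows "semidecidable (\<lambda>x. iter_image R (k x) (Q (e x)) (c x))"
proof -
  define nth where "nth = (\<lambda>l i. pfst (rec_nat l (\<lambda>_. psnd) i))"
  have nth: "computable f \<Longrightarrow> computable g \<Longrightarrow> computable (\<lambda>x. nth (f x) (g x))" for f g
    unfolding nth_def by (intro comp_intros)
  have nth_0: "nth (pair b l) 0 = b" for b l by (simp add: nth_def)
  have nth_Suc: "nth (pair b l) (Suc i) = nth l i" for b l i
  proof -
    have "rec_nat (pair b l) (\<lambda>_. psnd) (Suc i) = rec_nat l (\<lambda>_. psnd) i"
      by (induction i) auto
    then show ?thesis by (simp add: nth_def)
  qed
  \<comment> \<open>The chain runs backwards, so that a new last element is put in front.\<close>
  have chain: "iter_image R k Q c \<longleftrightarrow>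
      (\<exists>l. nth l 0 = c \<and> Q (nth l k) \<and> (\<forall>i<k. R (nth l (Suc i)) (nth l i)))" for k Q c
  proof (induction k arbitrary: c)
    case 0
    show ?case using nth_0 by (auto intro: exI[of _ "pair c 0"])
  next
    case (Suc k)
    show ?case
    proof
      assume "iter_image R (Suc k) Q c"
      then obtain l where l: "R (nth l 0) c" "Q (nth l k)" "\<forall>i<k. R (nth l (Suc i)) (nth l i)"
        using Suc by auto
      have "R (nth (pair c l) (Suc i)) (nth (pair c l) i)" if "i < Suc k" for i
        using l that by (cases i) (auto simp: nth_0 nth_Suc)
      with l show "\<exists>l. nth l 0 = c \<and> Q (nth l (Suc k)) \<and> (\<forall>i<Suc k. R (nth l (Suc i)) (nth l i))"
        by (intro exI[of _ "pair c l"]) (auto simp: nth_0 nth_Suc)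
    next
      assume "\<exists>l. nth l 0 = c \<and> Q (nth l (Suc k)) \<and> (\<forall>i<Suc k. R (nth l (Suc i)) (nth l i))"
      then obtain l where l: "nth l 0 = c" "Q (nth l (Suc k))"
        "\<forall>i<Suc k. R (nth l (Suc i)) (nth l i)" by blast
      have shift: "nth l (Suc i) = nth (psnd l) i" for i using nth_Suc[of "pfst l" "psnd l" i] by simp
      have "iter_image R k Q (nth l 1)"
        unfolding Suc using l(2,3) by (intro exI[of _ "psnd l"]) (auto simp: shift)
      moreover have "R (nth l 1) c" using l by auto
      ultimately show "iter_image R (Suc k) Q c" by auto
    qed
  qed
  show ?thesis unfolding chain
    by (intro comp_intros semidecidable_comp2[OF assms(1)] semidecidable_comp2[OF assms(2)]
        computable_comp[OF assms(3)] computable_comp[OF assms(4)] computable_comp[OF assms(5)]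
        assms nth)
qed

text \<open>The sum over a coded list is an iteration that consumes one entry in each step; since the code of
  the tail is smaller than the code of the list, the code itself bounds the number of steps.\<close>

lemma computable_sum_list:
  assumes "computable (\<lambda>p. G (pfst p) (psnd p))" "computable l"
  shows "computable (\<lambda>x. \<Sum>z\<leftarrow>list_decode (l x). G x z)"
proof -
  \<comment> \<open>A state pairs the partial sum with the code of the remaining list.\<close>
  define step where "step = (\<lambda>x st. if psnd st = 0 then st
    else pair (pfst st + G x (pfst (psnd st - 1))) (psnd (psnd st - 1)))"
  have step: "computable (\<lambda>p. step (pfst p) (psnd (psnd p)))"
    unfolding step_def by (intro comp_intros computable_comp2[OF assms(1)])
  have psnd_le: "psnd r \<le> r" for r
    using le_prod_encode_2[of "psnd r" "pfst r"] by (metis pair_def pair_pfst_psnd)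
  have 0: "pfst (rec_nat (pair a 0) (\<lambda>_. step x) k) = a" for a x k
  proof -
    have "rec_nat (pair a 0) (\<lambda>_. step x) k = pair a 0" by (induction k) (auto simp: step_def)
    then show ?thesis by simp
  qed
  have unroll: "rec_nat st (\<lambda>_. step x) (Suc k) = rec_nat (step x st) (\<lambda>_. step x) k" for st x k
    by (induction k) auto
  have "pfst (rec_nat (pair a m) (\<lambda>_. step x) k) = a + (\<Sum>z\<leftarrow>list_decode m. G x z)"
    if "m \<le> k" for a m x k
    using that
  proof (induction k arbitrary: a m)
    case (Suc k)
    show ?case
    proof (cases m)
      case (Suc r)
      have "step x (pair a m) = pair (a + G x (pfst r)) (psnd r)"
        unfolding step_def Suc by simp
      moreover have "psnd r \<le> k" using Suc.prems Suc psnd_le[of r] by simp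
      moreover have "list_decode m = pfst r # list_decode (psnd r)"
        unfolding Suc by (simp add: pfst_def psnd_def split: prod.splits)
      ultimately show ?thesis unfolding unroll by (simp add: Suc.IH)
    qed (simp only: 0, simp)
  qed simp
  then have "(\<Sum>z\<leftarrow>list_decode (l x). G x z) = pfst (rec_nat (pair 0 (l x)) (\<lambda>_. step x) (l x))" for x
    by simp
  moreover have "computable (\<lambda>x. pfst (rec_nat (pair 0 (l x)) (\<lambda>_. step x) (l x)))"
    by (intro computable_pfst computable_rec_nat step computable_pair assms computable_const)
  ultimately show ?thesis by simp
qed

section \<open>Effective open sets\<close>

lemma half_power_small:
  assumes "0 < (\<delta>::real)"
  shows "\<exists>M. \<forall>n\<ge>M. C / 2 ^ n < \<delta>"
proof -
  have "(\<lambda>n. C * (1 / 2) ^ n) \<longlonglongrightarrow> C * 0"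
    by (intro tendsto_mult tendsto_const LIMSEQ_power_zero) auto
  then have "\<forall>\<^sub>F n in sequentially. C * (1 / 2) ^ n < \<delta>"
    using assms by (intro order_tendstoD(2)) auto
  then show ?thesis by (simp add: eventually_sequentially power_one_over)
qed

locale computable_metric =
  fixes s :: "nat \<Rightarrow> 'a::{metric_space,second_countable_topology}"
  assumes cms: "computable_metric_space s"
begin

text \<open>Natural numerators over \<open>2^n\<close> replace the coded rational approximations, so that all later
  comparisons take place in the natural numbers. Rounding costs a second error of \<open>1 / 2^n\<close>; a
  negative approximation is replaced by 0, which is closer to the distance.\<close>

lemma dist_approximation:
  "\<exists>N. computable (\<lambda>p. N (pfst p) (pfst (psnd p)) (psnd (psnd p))) \<and>
    (\<forall>i j n. \<bar>real (N i j n) / 2 ^ n - dist (s i) (s j)\<bar> \<le> 2 / 2 ^ n)"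
proof -
  obtain A where A: "recursive 3 A"
    "\<And>i j n. \<bar>of_rat (nat_to_rat_surj (A [i, j, n])) - dist (s i) (s j)\<bar> < 1 / 2 ^ n"
    using cms unfolding computable_metric_space_def by blast
  \<comment> \<open>the absolute value of \<open>int_decode k\<close>; the parity of \<open>k\<close> gives the sign\<close>
  define mag where "mag = (\<lambda>k::nat. k div 2 + k mod 2)"
  have abs_decode: "real_of_int (int_decode k) = (if k mod 2 = 0 then real (mag k) else - real (mag k))" for k
    unfolding int_decode_def sum_decode_def mag_def by (auto simp: mod_2_eq_odd)
  define N where "N = (\<lambda>i j n. let z = A [i, j, n] in
    if pfst z mod 2 = psnd z mod 2 then (mag (pfst z) * 2 ^ n) div mag (psnd z) else 0)"
  have "computable (\<lambda>p. N (pfst p) (pfst (psnd p)) (psnd (psnd p)))"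
    unfolding N_def mag_def Let_def by (intro comp_intros computable_recursive3[OF A(1)])
  moreover have "\<bar>real (N i j n) / 2 ^ n - dist (s i) (s j)\<bar> \<le> 2 / 2 ^ n" for i j n
  proof -
    define a where "a = pfst (A [i, j, n])"
    define b where "b = psnd (A [i, j, n])"
    define r :: real where "r = of_rat (nat_to_rat_surj (A [i, j, n]))"
    have "r = real_of_int (int_decode a) / real_of_int (int_decode b)"
      unfolding r_def nat_to_rat_surj_def a_def b_def pfst_def psnd_def
      by (cases "int_decode (snd (prod_decode (A [i, j, n]))) = 0")
        (auto simp: of_rat_rat rat_number_collapse Let_def split: prod.splits)
    then have r: "r = (if a mod 2 = b mod 2 then real (mag a) / real (mag b)
        else - (real (mag a) / real (mag b)))"
      unfolding abs_decode by auto
    have close: "\<bar>r - dist (s i) (s j)\<bar> < 1 / 2 ^ n" using A(2)[of i j n] by (simp add: r_def)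
    show ?thesis
    proof (cases "a mod 2 = b mod 2")
      case True
      define x where "x = mag a * 2 ^ n"
      have N: "N i j n = x div mag b" unfolding N_def Let_def using True by (simp add: a_def b_def x_def)
      have "real (x div mag b) \<le> real x / real (mag b)" by (rule of_nat_div_le_of_nat)
      moreover have "real x / real (mag b) - real (x div mag b) \<le> 1" using real_of_int_div3[of "int x" "int (mag b)"] by (simp flip: of_nat_div)
      moreover have "real x / real (mag b) = r * 2 ^ n" unfolding r x_def using True by simp
      ultimately have "\<bar>real (N i j n) - r * 2 ^ n\<bar> \<le> 1" unfolding N by linarith
      then have "\<bar>real (N i j n) / 2 ^ n - r\<bar> \<le> 1 / 2 ^ n"
        by (simp add: field_simps abs_le_iff)
      with close show ?thesis by (simp add: abs_le_iff abs_less_iff)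
    next
      case False
      then have "N i j n = 0" unfolding N_def Let_def by (simp add: a_def b_def)
      moreover have "r \<le> 0" unfolding r using False by simp
      moreover have "(1::real) / 2 ^ n \<le> 2 / 2 ^ n" by (simp add: divide_right_mono)
      ultimately show ?thesis using close zero_le_dist[of "s i" "s j"] unfolding abs_less_iff
        by simp
    qed
  qed
  ultimately show ?thesis by blast
qed

text \<open>Clearing denominators brings every comparison of a distance with differences of rational
  numbers into this form.\<close>

lemma semidecidable_dist_less:
  assumes "computable i" "computable j" "computable a" "computable b" "computable c"
  shows "semidecidable (\<lambda>x. dist (s (i x)) (s (j x)) * real (b x) + real (c x) < real (a x))"
proof -
  obtain N where N: "computable (\<lambda>p. N (pfst p) (pfst (psnd p)) (psnd (psnd p)))"
    "\<And>i j n. \<bar>real (N i j n) / 2 ^ n - dist (s i) (s j)\<bar> \<le> 2 / 2 ^ n"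
    using dist_approximation by blast
  have compN: "computable (\<lambda>x. N (f x) (g x) (h x))" if "computable f" "computable g" "computable h" for f g h
    using computable_comp[OF N(1), of "\<lambda>x. pair (f x) (pair (g x) (h x))"] that
    by (simp add: comp_intros)
  have "dist (s i) (s j) * real b + real c < real a \<longleftrightarrow>
      (\<exists>n. (N i j n + 2) * b + c * 2 ^ n < a * 2 ^ n)" for i j a b c
  proof -
    have scale: "real ((N i j n + 2) * b + c * 2 ^ n) < real (a * 2 ^ n) \<longleftrightarrow>
        (real (N i j n) + 2) / 2 ^ n * real b + real c < real a" for i j n
    proof -
      have "real ((N i j n + 2) * b + c * 2 ^ n) =
          ((real (N i j n) + 2) / 2 ^ n * real b + real c) * 2 ^ n"
        by (simp add: field_simps)
      then show ?thesis by (simp del: of_nat_add of_nat_mult add: of_nat_mult[of a])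
    qed
    show ?thesis
    proof
      assume *: "dist (s i) (s j) * real b + real c < real a"
      then obtain n where n: "4 * real b / 2 ^ n < real a - real c - dist (s i) (s j) * real b"
        using half_power_small[of "real a - real c - dist (s i) (s j) * real b" "4 * real b"] by auto
      have "(real (N i j n) + 2) / 2 ^ n = real (N i j n) / 2 ^ n + 2 / 2 ^ n"
        by (rule add_divide_distrib)
      moreover have "(4::real) / 2 ^ n = 2 / 2 ^ n + 2 / 2 ^ n" by simp
      ultimately have "(real (N i j n) + 2) / 2 ^ n \<le> dist (s i) (s j) + 4 / 2 ^ n"
        using N(2)[of i j n] unfolding abs_le_iff by linarith
      then have "(real (N i j n) + 2) / 2 ^ n * real b \<le> (dist (s i) (s j) + 4 / 2 ^ n) * real b"
        by (rule mult_right_mono) simp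
      also have "\<dots> = dist (s i) (s j) * real b + 4 * real b / 2 ^ n" by (simp add: distrib_right)
      finally have "(real (N i j n) + 2) / 2 ^ n * real b + real c < real a" using n by linarith
      then have "real ((N i j n + 2) * b + c * 2 ^ n) < real (a * 2 ^ n)" using scale[of i j n] by simp
      then have "(N i j n + 2) * b + c * 2 ^ n < a * 2 ^ n" by (simp only: of_nat_less_iff)
      then show "\<exists>n. (N i j n + 2) * b + c * 2 ^ n < a * 2 ^ n" by blast
    next
      assume "\<exists>n. (N i j n + 2) * b + c * 2 ^ n < a * 2 ^ n"
      then obtain n where "(N i j n + 2) * b + c * 2 ^ n < a * 2 ^ n" by blast
      then have "real ((N i j n + 2) * b + c * 2 ^ n) < real (a * 2 ^ n)" by (simp only: of_nat_less_iff)
      then have "(real (N i j n) + 2) / 2 ^ n * real b + real c < real a" using scale[of i j n] by simp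
      moreover have "dist (s i) (s j) \<le> (real (N i j n) + 2) / 2 ^ n"
        using N(2)[of i j n] by (simp add: abs_le_iff add_divide_distrib)
      ultimately show "dist (s i) (s j) * real b + real c < real a"
        using mult_right_mono[of "dist (s i) (s j)" "(real (N i j n) + 2) / 2 ^ n" "real b"] by fastforce
    qed
  qed
  moreover have "semidecidable (\<lambda>x. \<exists>n. (N (i x) (j x) n + 2) * b x + c x * 2 ^ n < a x * 2 ^ n)"
    by (intro comp_intros compN computable_comp[OF assms(1)] computable_comp[OF assms(2)]
      computable_comp[OF assms(3)] computable_comp[OF assms(4)] computable_comp[OF assms(5)])
  ultimately show ?thesis by simp
qed

text \<open>Dyadic radii suffice, and they make inclusion up to a margin easy to express.\<close>

definition dball :: "nat \<Rightarrow> 'a set" where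
  "dball c = ball (s (pfst c)) (1 / 2 ^ psnd c)"

lemma dball_exists: "\<exists>c. psnd c = l \<and> y \<in> dball c"
proof -
  have "y \<in> closure (range s)" using cms unfolding computable_metric_space_def by auto
  then obtain i where "dist (s i) y < 1 / 2 ^ l"
    unfolding closure_approachable by (metis imageE zero_less_divide_1_iff zero_less_numeral zero_less_power)
  then show ?thesis by (intro exI[of _ "pair i l"]) (simp add: dball_def)
qed

lemma dball_small:
  assumes "dist y z < r"
  shows "\<exists>M. \<forall>c. y \<in> dball c \<and> M \<le> psnd c \<longrightarrow> dist (s (pfst c)) z + 1 / 2 ^ psnd c < r"
proof -
  obtain M where M: "\<And>n. M \<le> n \<Longrightarrow> 2 / 2 ^ n < r - dist y z"
    using half_power_small[of "r - dist y z" 2] assms by auto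
  show ?thesis
  proof (intro exI allI impI)
    fix c assume c: "y \<in> dball c \<and> M \<le> psnd c"
    then have "dist (s (pfst c)) y < 1 / 2 ^ psnd c" by (simp add: dball_def)
    moreover have "dist (s (pfst c)) z \<le> dist (s (pfst c)) y + dist y z" by (rule dist_triangle)
    moreover have "2 * (1 / 2 ^ psnd c) < r - dist y z" using M[of "psnd c"] c by simp
    ultimately show "dist (s (pfst c)) z + 1 / 2 ^ psnd c < r" by linarith
  qed
qed

text \<open>\<open>R e c\<close> certifies that the ball \<open>c\<close> lies in \<open>U e\<close>. All sufficiently small balls around a
  point of \<open>U e\<close> have to be certified; because of this second requirement, an intersection of two
  sets is certified by the conjunction of their relations, without a search for smaller balls.\<close>

definition eff_open :: "(nat \<Rightarrow> 'a set) \<Rightarrow> bool" where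
  "eff_open U \<longleftrightarrow> (\<exists>R. semidecidable (\<lambda>p. R (pfst p) (psnd p)) \<and>
     (\<forall>e c. R e c \<longrightarrow> dball c \<subseteq> U e) \<and>
     (\<forall>e. \<forall>y\<in>U e. \<exists>M. \<forall>c. y \<in> dball c \<and> M \<le> psnd c \<longrightarrow> R e c))"

lemma eff_openI:
  assumes "semidecidable (\<lambda>p. R (pfst p) (psnd p))"
    and "\<And>e c y. R e c \<Longrightarrow> y \<in> dball c \<Longrightarrow> y \<in> U e"
    and "\<And>e y. y \<in> U e \<Longrightarrow> \<exists>M. \<forall>c. y \<in> dball c \<and> M \<le> psnd c \<longrightarrow> R e c"
  shows "eff_open U"
  using assms unfolding eff_open_def by blast

text \<open>The certified balls cover \<open>U e\<close>, since every point lies in dyadic balls of any given radius.\<close>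

lemma eff_openE:
  assumes "eff_open U"
  obtains R where "semidecidable (\<lambda>p. R (pfst p) (psnd p))"
    "\<And>e c y. R e c \<Longrightarrow> y \<in> dball c \<Longrightarrow> y \<in> U e"
    "\<And>e y. y \<in> U e \<Longrightarrow> \<exists>M. \<forall>c. y \<in> dball c \<and> M \<le> psnd c \<longrightarrow> R e c"
    "\<And>e y. y \<in> U e \<longleftrightarrow> (\<exists>c. R e c \<and> y \<in> dball c)"
proof -
  obtain R where R: "semidecidable (\<lambda>p. R (pfst p) (psnd p))"
    "\<And>e c y. R e c \<Longrightarrow> y \<in> dball c \<Longrightarrow> y \<in> U e"
    "\<And>e y. y \<in> U e \<Longrightarrow> \<exists>M. \<forall>c. y \<in> dball c \<and> M \<le> psnd c \<longrightarrow> R e c"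
    using assms unfolding eff_open_def by blast
  moreover have "y \<in> U e \<longleftrightarrow> (\<exists>c. R e c \<and> y \<in> dball c)" for e y
  proof
    assume "y \<in> U e"
    then obtain M where "\<And>c. y \<in> dball c \<Longrightarrow> M \<le> psnd c \<Longrightarrow> R e c" using R(3) by blast
    moreover obtain c where "psnd c = M" "y \<in> dball c" using dball_exists by blast
    ultimately show "\<exists>c. R e c \<and> y \<in> dball c" by blast
  qed (use R(2) in blast)
  ultimately show thesis by (rule that)
qed

lemma open_eff_open: assumes "eff_open U" shows "open (U e)"
proof -
  obtain R where R: "\<And>e c y. R e c \<Longrightarrow> y \<in> dball c \<Longrightarrow> y \<in> U e"
    "\<And>e y. y \<in> U e \<longleftrightarrow> (\<exists>c. R e c \<and> y \<in> dball c)" using assms by (rule eff_openE) blast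
  have "U e = (\<Union>c\<in>{c. R e c}. dball c)" using R by blast
  then show ?thesis by (auto simp: dball_def)
qed

lemma eff_open_comp:
  assumes "eff_open U" "computable f"
  shows "eff_open (\<lambda>x. U (f x))"
proof -
  obtain R where R: "semidecidable (\<lambda>p. R (pfst p) (psnd p))"
    "\<And>e c y. R e c \<Longrightarrow> y \<in> dball c \<Longrightarrow> y \<in> U e"
    "\<And>e y. y \<in> U e \<Longrightarrow> \<exists>M. \<forall>c. y \<in> dball c \<and> M \<le> psnd c \<longrightarrow> R e c"
    using assms(1) by (rule eff_openE) blast
  show ?thesis
  proof (rule eff_openI)
    show "semidecidable (\<lambda>p. R (f (pfst p)) (psnd p))"
      by (intro semidecidable_comp2[OF R(1)] computable_comp[OF assms(2)] comp_intros)
  qed (use R(2,3) in blast)+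
qed

lemma eff_open_comp2:
  assumes "eff_open (\<lambda>p. U (pfst p) (psnd p))" "computable f" "computable g"
  shows "eff_open (\<lambda>x. U (f x) (g x))"
  using eff_open_comp[OF assms(1) computable_pair[OF assms(2,3)]] by simp

lemma eff_open_dball: "eff_open dball"
proof (rule eff_openI)
  let ?R = "\<lambda>b c. dist (s (pfst c)) (s (pfst b)) * real (2 ^ (psnd b + psnd c)) + real (2 ^ psnd b) <
    real (2 ^ psnd c)"
  have R: "?R b c \<longleftrightarrow> dist (s (pfst c)) (s (pfst b)) + 1 / 2 ^ psnd c < 1 / 2 ^ psnd b" for b c
    by (simp add: field_simps power_add)
  show "semidecidable (\<lambda>p. ?R (pfst p) (psnd p))"
    by (intro semidecidable_dist_less comp_intros)
  show "y \<in> dball b" if "?R b c" "y \<in> dball c" for b c y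
    using that dist_triangle[of "s (pfst b)" y "s (pfst c)"] unfolding R by (simp add: dball_def dist_commute)
  show "\<exists>M. \<forall>c. y \<in> dball c \<and> M \<le> psnd c \<longrightarrow> ?R b c" if "y \<in> dball b" for b y
    unfolding R by (rule dball_small) (use that in \<open>simp add: dball_def dist_commute\<close>)
qed

lemma eff_open_union:
  assumes "eff_open U" "semidecidable (\<lambda>p. P (pfst p) (psnd p))"
  shows "eff_open (\<lambda>e. \<Union>b\<in>{b. P e b}. U b)"
proof -
  obtain R where R: "semidecidable (\<lambda>p. R (pfst p) (psnd p))"
    "\<And>e c y. R e c \<Longrightarrow> y \<in> dball c \<Longrightarrow> y \<in> U e"
    "\<And>e y. y \<in> U e \<Longrightarrow> \<exists>M. \<forall>c. y \<in> dball c \<and> M \<le> psnd c \<longrightarrow> R e c"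
    using assms(1) by (rule eff_openE) blast
  show ?thesis
  proof (rule eff_openI)
    show "semidecidable (\<lambda>p. \<exists>b. P (pfst p) b \<and> R b (psnd p))"
      by (intro comp_intros semidecidable_comp2[OF assms(2)] semidecidable_comp2[OF R(1)])
  qed (use R(2,3) in blast)+
qed

lemma eff_open_inter:
  assumes "eff_open U" "eff_open V"
  shows "eff_open (\<lambda>e. U e \<inter> V e)"
proof -
  obtain R where R: "semidecidable (\<lambda>p. R (pfst p) (psnd p))"
    "\<And>e c y. R e c \<Longrightarrow> y \<in> dball c \<Longrightarrow> y \<in> U e"
    "\<And>e y. y \<in> U e \<Longrightarrow> \<exists>M. \<forall>c. y \<in> dball c \<and> M \<le> psnd c \<longrightarrow> R e c"
    using assms(1) by (rule eff_openE) blast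
  obtain Q where Q: "semidecidable (\<lambda>p. Q (pfst p) (psnd p))"
    "\<And>e c y. Q e c \<Longrightarrow> y \<in> dball c \<Longrightarrow> y \<in> V e"
    "\<And>e y. y \<in> V e \<Longrightarrow> \<exists>M. \<forall>c. y \<in> dball c \<and> M \<le> psnd c \<longrightarrow> Q e c"
    using assms(2) by (rule eff_openE) blast
  show ?thesis
  proof (rule eff_openI)
    show "semidecidable (\<lambda>p. R (pfst p) (psnd p) \<and> Q (pfst p) (psnd p))"
      by (intro comp_intros R Q)
    fix e y assume "y \<in> U e \<inter> V e"
    then obtain M M' where "\<forall>c. y \<in> dball c \<and> M \<le> psnd c \<longrightarrow> R e c"
      "\<forall>c. y \<in> dball c \<and> M' \<le> psnd c \<longrightarrow> Q e c" using R(3) Q(3) by (metis IntE)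
    then show "\<exists>M. \<forall>c. y \<in> dball c \<and> M \<le> psnd c \<longrightarrow> R e c \<and> Q e c"
      by (intro exI[of _ "max M M'"]) auto
  qed (use R(2) Q(2) in blast)
qed

text \<open>Finitely many thresholds for the radius have a common refinement.\<close>

lemma common_precision:
  assumes "\<And>k. k < (m::nat) \<Longrightarrow> \<exists>M. \<forall>c. y \<in> dball c \<and> M \<le> psnd c \<longrightarrow> R k c"
  shows "\<exists>M. \<forall>c. y \<in> dball c \<and> M \<le> psnd c \<longrightarrow> (\<forall>k<m. R k c)"
  using assms
proof (induction m)
  case (Suc m)
  obtain M where "\<forall>c. y \<in> dball c \<and> M \<le> psnd c \<longrightarrow> (\<forall>k<m. R k c)"
    using Suc by (metis less_SucI)
  moreover obtain M' where "\<forall>c. y \<in> dball c \<and> M' \<le> psnd c \<longrightarrow> R m c" using Suc.prems by blast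
  ultimately show ?case by (intro exI[of _ "max M M'"]) (auto simp: less_Suc_eq)
qed simp

lemma eff_open_INT_less:
  assumes "eff_open (\<lambda>p. U (pfst p) (psnd p))" "computable h"
  shows "eff_open (\<lambda>x. \<Inter>k<h x. U x k)"
proof -
  obtain R where R: "semidecidable (\<lambda>p. R (pfst p) (psnd p))"
    "\<And>p c y. R p c \<Longrightarrow> y \<in> dball c \<Longrightarrow> y \<in> U (pfst p) (psnd p)"
    "\<And>p y. y \<in> U (pfst p) (psnd p) \<Longrightarrow> \<exists>M. \<forall>c. y \<in> dball c \<and> M \<le> psnd c \<longrightarrow> R p c"
    using assms(1) by (rule eff_openE) blast
  show ?thesis
  proof (rule eff_openI)
    show "semidecidable (\<lambda>p. \<forall>k<h (pfst p). R (pair (pfst p) k) (psnd p))"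
      by (intro comp_intros semidecidable_comp2[OF R(1)] computable_comp[OF assms(2)])
    show "y \<in> (\<Inter>k<h x. U x k)" if "\<forall>k<h x. R (pair x k) c" "y \<in> dball c" for x c y
      using that R(2)[of "pair x k" c y for k] by auto
    show "\<exists>M. \<forall>c. y \<in> dball c \<and> M \<le> psnd c \<longrightarrow> (\<forall>k<h x. R (pair x k) c)"
      if "y \<in> (\<Inter>k<h x. U x k)" for x y
      using that R(3)[of y "pair x k" for k] by (intro common_precision) auto
  qed
qed

text \<open>A finite set of indices is coded by the binary digits of a number.\<close>

definition bit_of :: "nat \<Rightarrow> nat \<Rightarrow> bool" where
  "bit_of w k \<longleftrightarrow> (w div 2 ^ k) mod 2 = 1"

lemma decidable_bit_of [comp_intros]:
  "computable f \<Longrightarrow> computable g \<Longrightarrow> decidable (\<lambda>x. bit_of (f x) (g x))"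
  unfolding bit_of_def by (intro comp_intros)

lemma bit_of_finite: assumes "finite S" shows "\<exists>w. \<forall>k. bit_of w k \<longleftrightarrow> k \<in> S"
proof
  have "odd n \<longleftrightarrow> n mod 2 = 1" for n :: nat by presburger
  then show "\<forall>k. bit_of (set_encode S) k \<longleftrightarrow> k \<in> S"
    using set_encode_inverse[OF assms] by (auto simp: bit_of_def set_decode_def)
qed

text \<open>Counting visits is an open condition as long as only lower bounds are imposed: a finite set of
  indices \<open>k\<close> with \<open>y \<in> U x k\<close> that is large enough serves as the witness.\<close>

lemma eff_open_threshold:
  assumes "eff_open (\<lambda>p. U (pfst p) (psnd p))" "computable h"
    and "semidecidable (\<lambda>p. \<Phi> (pfst p) (psnd p))"
    and mono: "\<And>x m n. \<Phi> x m \<Longrightarrow> m \<le> n \<Longrightarrow> \<Phi> x n"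
  shows "eff_open (\<lambda>x. {y. \<Phi> x (\<Sum>k<h x. of_bool (y \<in> U x k))})"
proof -
  obtain R where R: "semidecidable (\<lambda>p. R (pfst p) (psnd p))"
    "\<And>p c y. R p c \<Longrightarrow> y \<in> dball c \<Longrightarrow> y \<in> U (pfst p) (psnd p)"
    "\<And>p y. y \<in> U (pfst p) (psnd p) \<Longrightarrow> \<exists>M. \<forall>c. y \<in> dball c \<and> M \<le> psnd c \<longrightarrow> R p c"
    using assms(1) by (rule eff_openE) blast
  let ?S = "\<lambda>x c. \<exists>w. \<Phi> x (\<Sum>k<h x. of_bool (bit_of w k)) \<and>
    (\<forall>k<h x. bit_of w k \<longrightarrow> R (pair x k) c)"
  show ?thesis
  proof (rule eff_openI)
    show "semidecidable (\<lambda>p. ?S (pfst p) (psnd p))"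
      by (intro semidecidable_Ex semidecidable_conj semidecidable_ball_less semidecidable_imp
          semidecidable_comp2[OF R(1)] semidecidable_comp2[OF assms(3)] computable_comp[OF assms(2)]
          comp_intros)
    show "y \<in> {y. \<Phi> x (\<Sum>k<h x. of_bool (y \<in> U x k))}" if S: "?S x c" and y: "y \<in> dball c" for x c y
    proof -
      obtain w where w: "\<Phi> x (\<Sum>k<h x. of_bool (bit_of w k))"
        "\<forall>k<h x. bit_of w k \<longrightarrow> R (pair x k) c" using S by blast
      have "(\<Sum>k<h x. of_bool (bit_of w k)) \<le> (\<Sum>k<h x. of_bool (y \<in> U x k) :: nat)"
        using w(2) y R(2)[of "pair x k" c y for k] by (intro sum_mono) auto
      then show ?thesis using mono[OF w(1)] by simp
    qed
    show "\<exists>M. \<forall>c. y \<in> dball c \<and> M \<le> psnd c \<longrightarrow> ?S x c"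
      if y: "y \<in> {y. \<Phi> x (\<Sum>k<h x. of_bool (y \<in> U x k))}" for x y
    proof -
      obtain w where w: "\<And>k. bit_of w k \<longleftrightarrow> k \<in> {k. k < h x \<and> y \<in> U x k}"
        using bit_of_finite[of "{k. k < h x \<and> y \<in> U x k}"] by auto
      have "\<exists>M. \<forall>c. y \<in> dball c \<and> M \<le> psnd c \<longrightarrow> (\<forall>k<h x. bit_of w k \<longrightarrow> R (pair x k) c)"
      proof (rule common_precision)
        fix k assume "k < h x"
        show "\<exists>M. \<forall>c. y \<in> dball c \<and> M \<le> psnd c \<longrightarrow> bit_of w k \<longrightarrow> R (pair x k) c"
          using R(3)[of y "pair x k"] w by (cases "bit_of w k") auto
      qed
      moreover have "(\<Sum>k<h x. of_bool (bit_of w k)) = (\<Sum>k<h x. of_bool (y \<in> U x k) :: nat)"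
        by (intro sum.cong) (auto simp: w)
      ultimately show ?thesis using y by (metis (no_types, lifting) mem_Collect_eq)
    qed
  qed
qed

lemma semidecidable_mem:
  assumes "eff_open U" "computable i" "computable e"
  shows "semidecidable (\<lambda>x. s (i x) \<in> U (e x))"
proof -
  obtain R where R: "semidecidable (\<lambda>p. R (pfst p) (psnd p))"
    "\<And>e y. y \<in> U e \<longleftrightarrow> (\<exists>c. R e c \<and> y \<in> dball c)"
    using assms(1) by (rule eff_openE) blast
  have mem: "s i \<in> dball c \<longleftrightarrow>
      dist (s i) (s (pfst c)) * real (2 ^ psnd c) + real 0 < real 1" for i c
    by (simp add: dball_def dist_commute field_simps)
  show ?thesis unfolding R(2) mem
    by (intro semidecidable_Ex semidecidable_conj semidecidable_comp2[OF R(1)] semidecidable_dist_less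
        comp_intros computable_comp[OF assms(2)] computable_comp[OF assms(3)])
qed

text \<open>The set \<open>K e m\<close> consists of the points that lie in a certified ball with margin \<open>1 / 2^m\<close>.
  The margin has two uses: limits of points of \<open>K e m\<close> remain in \<open>U e\<close>, and a measure that is close
  to \<open>\<mu>\<close> in \<open>W1\<close> can be compared with \<open>\<mu>\<close> on sets that are separated by a margin.\<close>

lemma eff_open_shrink:
  assumes "eff_open U"
  obtains K where "eff_open (\<lambda>p. K (pfst p) (psnd p))"
    "\<And>e m. K e m \<subseteq> K e (Suc m)" "\<And>e. (\<Union>m. K e m) = U e"
    "\<And>e m y z. y \<in> K e m \<Longrightarrow> dist y z < 1 / 2 ^ m \<Longrightarrow> z \<in> U e"
    "\<And>e m y z. y \<in> K e m \<Longrightarrow> dist y z < 1 / 2 ^ Suc m \<Longrightarrow> z \<in> K e (Suc m)"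
proof -
  obtain R where R: "semidecidable (\<lambda>p. R (pfst p) (psnd p))"
    "\<And>e c y. R e c \<Longrightarrow> y \<in> dball c \<Longrightarrow> y \<in> U e"
    "\<And>e y. y \<in> U e \<longleftrightarrow> (\<exists>c. R e c \<and> y \<in> dball c)"
    using assms(1) by (rule eff_openE) blast
  define K where "K e m = {y. \<exists>b. R e b \<and> dist y (s (pfst b)) + 1 / 2 ^ m < 1 / 2 ^ psnd b}" for e m
  let ?Q = "\<lambda>m b c. dist (s (pfst c)) (s (pfst b)) * real (2 ^ (psnd b + psnd c + m)) +
      real (2 ^ (psnd b + m) + 2 ^ (psnd b + psnd c)) < real (2 ^ (psnd c + m))"
  have Q: "?Q m b c \<longleftrightarrow> dist (s (pfst c)) (s (pfst b)) + 1 / 2 ^ psnd c < 1 / 2 ^ psnd b - 1 / 2 ^ m" for m b c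
    by (simp add: field_simps power_add)
  have 1: "eff_open (\<lambda>p. K (pfst p) (psnd p))"
  proof (rule eff_openI)
    show "semidecidable (\<lambda>q. \<exists>b. R (pfst (pfst q)) b \<and> ?Q (psnd (pfst q)) b (psnd q))"
      by (intro semidecidable_Ex semidecidable_conj semidecidable_comp2[OF R(1)] semidecidable_dist_less
        comp_intros)
    fix p y
    show "y \<in> K (pfst p) (psnd p)" if ex: "\<exists>b. R (pfst p) b \<and> ?Q (psnd p) b c" and y: "y \<in> dball c" for c
    proof -
      obtain b where b: "R (pfst p) b" "?Q (psnd p) b c" using ex by blast
      then have "dist y (s (pfst b)) + 1 / 2 ^ psnd p < 1 / 2 ^ psnd b"
        using y dist_triangle[of y "s (pfst b)" "s (pfst c)"] unfolding Q
        by (simp add: dball_def dist_commute)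
      with b(1) show ?thesis unfolding K_def by blast
    qed
    show "\<exists>M. \<forall>c. y \<in> dball c \<and> M \<le> psnd c \<longrightarrow> (\<exists>b. R (pfst p) b \<and> ?Q (psnd p) b c)"
      if y: "y \<in> K (pfst p) (psnd p)"
    proof -
      obtain b where b: "R (pfst p) b" "dist y (s (pfst b)) + 1 / 2 ^ psnd p < 1 / 2 ^ psnd b"
        using y unfolding K_def by blast
      then have "dist y (s (pfst b)) < 1 / 2 ^ psnd b - 1 / 2 ^ psnd p" by simp
      from dball_small[OF this] b(1) show ?thesis unfolding Q by blast
    qed
  qed
  have 5: "z \<in> K e (Suc m)" if y: "y \<in> K e m" and z: "dist y z < 1 / 2 ^ Suc m" for e m y z
  proof -
    obtain b where b: "R e b" "dist y (s (pfst b)) + 1 / 2 ^ m < 1 / 2 ^ psnd b"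
      using y unfolding K_def by blast
    have "dist z (s (pfst b)) \<le> dist y z + dist y (s (pfst b))"
      using dist_triangle[of z "s (pfst b)" y] by (simp add: dist_commute)
    moreover have "(1::real) / 2 ^ m = 2 * (1 / 2 ^ Suc m)" by simp
    ultimately have "dist z (s (pfst b)) + 1 / 2 ^ Suc m < 1 / 2 ^ psnd b"
      using b(2) z by linarith
    with b(1) show ?thesis unfolding K_def by blast
  qed
  have 4: "z \<in> U e" if y: "y \<in> K e m" and z: "dist y z < 1 / 2 ^ m" for e m y z
  proof -
    obtain b where b: "R e b" "dist y (s (pfst b)) + 1 / 2 ^ m < 1 / 2 ^ psnd b"
      using y unfolding K_def by blast
    then have "z \<in> dball b"
      using b(2) z dist_triangle[of z "s (pfst b)" y] by (simp add: dball_def dist_commute)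
    with R(2) b(1) show ?thesis by blast
  qed
  have 2: "K e m \<subseteq> K e (Suc m)" for e m using 5[of _ e m] by (metis dist_self subsetI zero_less_divide_1_iff zero_less_numeral zero_less_power)
  have 3: "(\<Union>m. K e m) = U e" for e
  proof (intro equalityI subsetI)
    fix y assume "y \<in> (\<Union>m. K e m)"
    then show "y \<in> U e" using 4[of y e _ y] by auto
  next
    fix y assume "y \<in> U e"
    then obtain b where b: "R e b" "y \<in> dball b" using R(3) by blast
    have "0 < 1 / 2 ^ psnd b - dist y (s (pfst b))"
      using b(2) by (simp add: dball_def dist_commute)
    then obtain m where "1 / 2 ^ m < 1 / 2 ^ psnd b - dist y (s (pfst b))"
      using half_power_small by blast
    then have "y \<in> K e m" using b(1) unfolding K_def by (auto intro!: exI[of _ b])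
    then show "y \<in> (\<Union>m. K e m)" by blast
  qed
  show thesis using that 1 2 3 4 5 by blast
qed

text \<open>A dyadic ball is certified by an enumerated ideal ball that contains it because of its centre and
  radius; this covers all small balls around a point of the union.\<close>

lemma eff_open_uniformly_effective:
  assumes "uniformly_effective_open s U"
  shows "eff_open U"
proof -
  obtain A where A: "recursive 2 A" "\<And>i. U i = (\<Union>n. enum_ball s (A [i, n]))"
    using assms unfolding uniformly_effective_open_def by blast
  have ball: "ideal_ball s k = ball (s (pfst k)) (real (Suc (pfst (psnd k))) / real (Suc (psnd (psnd k))))" for k
    unfolding ideal_ball_def pos_rat_def pfst_def psnd_def by (simp split: prod.splits)
  have U: "y \<in> U e \<longleftrightarrow> (\<exists>n k. A [e, n] = Suc k \<and> y \<in> ideal_ball s k)" for e y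
  proof -
    have "y \<in> enum_ball s m \<longleftrightarrow> (\<exists>k. m = Suc k \<and> y \<in> ideal_ball s k)" for m
      unfolding enum_ball_def by (cases m) auto
    then show ?thesis unfolding A(2) by auto
  qed
  let ?Q = "\<lambda>k c. dist (s (pfst c)) (s (pfst k)) * real (2 ^ psnd c * Suc (psnd (psnd k))) +
      real (Suc (psnd (psnd k))) < real (2 ^ psnd c * Suc (pfst (psnd k)))"
  have Q: "?Q k c \<longleftrightarrow> dist (s (pfst c)) (s (pfst k)) + 1 / 2 ^ psnd c <
      real (Suc (pfst (psnd k))) / real (Suc (psnd (psnd k)))" for k c
  proof -
    have "d * (2 ^ l * b) + b < 2 ^ l * a \<longleftrightarrow> d + 1 / 2 ^ l < a / b" if "0 < b" for d a b :: real and l :: nat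
      using that by (simp add: field_simps)
    from this[of "real (Suc (psnd (psnd k)))"] show ?thesis
      by (simp only: of_nat_mult of_nat_power of_nat_numeral of_nat_0_less_iff zero_less_Suc)
  qed
  show ?thesis
  proof (rule eff_openI)
    show "semidecidable (\<lambda>p. \<exists>n. \<exists>k. A [pfst p, n] = Suc k \<and> ?Q k (psnd p))"
      by (intro semidecidable_Ex semidecidable_conj semidecidable_dist_less
        comp_intros computable_recursive2[OF A(1)])
    fix e y
    show "y \<in> U e" if ex: "\<exists>n. \<exists>k. A [e, n] = Suc k \<and> ?Q k c" and y: "y \<in> dball c" for c
    proof -
      obtain n k where k: "A [e, n] = Suc k" "?Q k c" using ex by blast
      then have "y \<in> ideal_ball s k"
        using y dist_triangle[of y "s (pfst k)" "s (pfst c)"] unfolding Q ball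
        by (simp add: dball_def dist_commute)
      with k(1) show ?thesis unfolding U by blast
    qed
    show "\<exists>M. \<forall>c. y \<in> dball c \<and> M \<le> psnd c \<longrightarrow> (\<exists>n. \<exists>k. A [e, n] = Suc k \<and> ?Q k c)"
      if y: "y \<in> U e"
    proof -
      obtain n k where k: "A [e, n] = Suc k" "y \<in> ideal_ball s k" using y unfolding U by blast
      then have "dist y (s (pfst k)) < real (Suc (pfst (psnd k))) / real (Suc (psnd (psnd k)))"
        unfolding ball by (simp add: dist_commute)
      from dball_small[OF this] k(1) show ?thesis unfolding Q by blast
    qed
  qed
qed

text \<open>The rational number \<open>1 / 2^l\<close> has the code \<open>pair 0 (2^l - 1)\<close>, because \<open>pos_rat\<close> adds 1 to both
  components.\<close>

definition ideal_code :: "nat \<Rightarrow> nat" where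
  "ideal_code c = pair (pfst c) (pair 0 (2 ^ psnd c - 1))"

lemma ideal_ball_ideal_code: "ideal_ball s (ideal_code c) = dball c"
  unfolding ideal_ball_def dball_def ideal_code_def pos_rat_def pair_def
  by (simp add: of_nat_diff)

lemma computable_ideal_code: "computable f \<Longrightarrow> computable (\<lambda>x. ideal_code (f x))"
  unfolding ideal_code_def by (intro comp_intros)

end

section \<open>The measure of an effective open set\<close>

lemma lipschitz_integral_near_value:
  fixes f :: "'a::metric_space \<Rightarrow> real"
  assumes f: "1-lipschitz_on UNIV f" and D: "\<And>x y :: 'a. dist x y \<le> D"
    and "prob_space \<nu>" and sets: "sets \<nu> = sets borel"
  shows "integrable \<nu> f" "\<bar>(\<integral>x. f x \<partial>\<nu>) - f x0\<bar> \<le> D"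
proof -
  interpret prob_space \<nu> by fact
  have near: "\<bar>f x - f x0\<bar> \<le> D" for x
    using lipschitz_onD[OF f, of x x0] D[of x x0] by (simp add: dist_real_def)
  have "continuous_on UNIV f" using f by (rule lipschitz_on_continuous_on)
  then have "f \<in> borel_measurable borel" by (rule borel_measurable_continuous_onI)
  then have [measurable]: "f \<in> borel_measurable \<nu>"
    unfolding measurable_cong_sets[OF sets refl] .
  show int: "integrable \<nu> f"
  proof (rule integrable_const_bound)
    show "AE x in \<nu>. norm (f x) \<le> \<bar>f x0\<bar> + D" using near by (intro AE_I2) (smt (verit) real_norm_def)
  qed simp
  have "(\<integral>x. f x - f x0 \<partial>\<nu>) = (\<integral>x. f x \<partial>\<nu>) - f x0"
    using int by (simp add: prob_space)
  moreover have "\<bar>\<integral>x. f x - f x0 \<partial>\<nu>\<bar> \<le> (\<integral>x. \<bar>f x - f x0\<bar> \<partial>\<nu>)"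
    by (rule integral_abs_bound)
  moreover have "(\<integral>x. \<bar>f x - f x0\<bar> \<partial>\<nu>) \<le> (\<integral>x. D \<partial>\<nu>)"
    using int near by (intro integral_mono) auto
  ultimately show "\<bar>(\<integral>x. f x \<partial>\<nu>) - f x0\<bar> \<le> D" by (simp add: prob_space)
qed

lemma lipschitz_integral_le_W1:
  fixes f :: "'a::metric_space \<Rightarrow> real"
  assumes f: "1-lipschitz_on UNIV f" and bounded: "bounded (UNIV :: 'a set)"
    and \<nu>: "prob_space \<nu>" "sets \<nu> = sets borel" and \<nu>': "prob_space \<nu>'" "sets \<nu>' = sets borel"
  shows "\<bar>(\<integral>x. f x \<partial>\<nu>) - (\<integral>x. f x \<partial>\<nu>')\<bar> \<le> W1 \<nu> \<nu>'"
proof -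
  obtain D where D: "\<And>x y :: 'a. dist x y \<le> D" using bounded unfolding bounded_two_points by blast
  have "\<bar>(\<integral>x. g x \<partial>\<nu>) - (\<integral>x. g x \<partial>\<nu>')\<bar> \<le> 2 * D" if "1-lipschitz_on UNIV g" for g :: "'a \<Rightarrow> real"
    using lipschitz_integral_near_value(2)[OF that D \<nu>, of undefined]
      lipschitz_integral_near_value(2)[OF that D \<nu>', of undefined] by linarith
  then have "bdd_above ((\<lambda>f. \<bar>(\<integral>x. f x \<partial>\<nu>) - (\<integral>x. f x \<partial>\<nu>')\<bar>) ` {f :: 'a \<Rightarrow> real. 1-lipschitz_on UNIV f})"
    by (intro bdd_aboveI2) auto
  then show ?thesis unfolding W1_def using f by (intro cSUP_upper) auto
qed

text \<open>The function \<open>z \<mapsto> max 0 (\<delta> - infdist z A)\<close> is 1-Lipschitz and lies between \<open>\<delta>\<close> times the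
  indicators of \<open>A\<close> and of \<open>B\<close>.\<close>

lemma W1_measure_comparison:
  fixes A B :: "'a::metric_space set"
  assumes bounded: "bounded (UNIV :: 'a set)"
    and \<nu>: "prob_space \<nu>" "sets \<nu> = sets borel" and \<nu>': "prob_space \<nu>'" "sets \<nu>' = sets borel"
    and W: "W1 \<nu> \<nu>' \<le> w \<or> W1 \<nu>' \<nu> \<le> w" and A: "A \<in> sets borel" and B: "B \<in> sets borel"
    and \<delta>: "0 < \<delta>" and near: "\<And>y z. y \<in> A \<Longrightarrow> dist y z < \<delta> \<Longrightarrow> z \<in> B"
  shows "measure \<nu> A \<le> measure \<nu>' B + w / \<delta>"
proof (cases "A = {}")
  case False
  interpret \<nu>: prob_space \<nu> by (rule \<nu>(1))
  interpret \<nu>': prob_space \<nu>' by (rule \<nu>'(1))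
  define f where "f z = max 0 (\<delta> - infdist z A)" for z
  have f: "1-lipschitz_on UNIV f"
  proof (rule lipschitz_onI)
    fix x y
    show "dist (f x) (f y) \<le> 1 * dist x y"
      using infdist_triangle_abs[of x A y] by (auto simp: f_def dist_real_def max_def abs_le_iff)
  qed simp
  obtain D where D: "\<And>x y :: 'a. dist x y \<le> D" using bounded unfolding bounded_two_points by blast
  note int = lipschitz_integral_near_value(1)[OF f D]
  have f_le: "f z \<le> \<delta> * indicator B z" for z
  proof (cases "z \<in> B")
    case True
    then show ?thesis using \<delta> infdist_nonneg[of z A] by (simp add: f_def)
  next
    case F: False
    have "\<delta> \<le> dist z a" if "a \<in> A" for a
      using near[OF that, of z] F by (metis dist_commute not_le)
    then have "\<delta> \<le> infdist z A" unfolding infdist_notempty[OF False] using False by (intro cINF_greatest) auto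
    then show ?thesis using F by (simp add: f_def)
  qed
  have le_f: "\<delta> * indicator A z \<le> f z" for z
    by (auto simp: f_def indicator_def)
  have "\<delta> * measure \<nu> A = (\<integral>x. \<delta> * indicator A x \<partial>\<nu>)" using A \<nu>(2) by simp
  also have "\<dots> \<le> (\<integral>x. f x \<partial>\<nu>)"
    using int[OF \<nu>] le_f A \<nu>(2) by (intro integral_mono) (auto simp: \<nu>.emeasure_eq_measure)
  also have "\<dots> \<le> (\<integral>x. f x \<partial>\<nu>') + w"
    using lipschitz_integral_le_W1[OF f bounded \<nu> \<nu>'] lipschitz_integral_le_W1[OF f bounded \<nu>' \<nu>] W
    by linarith
  also have "(\<integral>x. f x \<partial>\<nu>') \<le> (\<integral>x. \<delta> * indicator B x \<partial>\<nu>')"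
    using int[OF \<nu>'] f_le B \<nu>'(2) by (intro integral_mono) (auto simp: \<nu>'.emeasure_eq_measure)
  also have "\<dots> = \<delta> * measure \<nu>' B" using B \<nu>'(2) by simp
  finally show ?thesis using \<delta> by (simp add: field_simps)
next
  case True
  have "1-lipschitz_on UNIV (\<lambda>_ :: 'a. 0 :: real)" by (rule lipschitz_onI) auto
  from lipschitz_integral_le_W1[OF this bounded \<nu> \<nu>'] lipschitz_integral_le_W1[OF this bounded \<nu>' \<nu>]
  have "0 \<le> W1 \<nu> \<nu>'" "0 \<le> W1 \<nu>' \<nu>" by auto
  with W have "0 \<le> w" by linarith
  then show ?thesis using True \<delta> by simp
qed

lemma prob_space_ideal_measure: "prob_space (ideal_measure s n)"
  unfolding ideal_measure_def by (rule measure_pmf.prob_space_distr) simp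

lemma sets_ideal_measure: "sets (ideal_measure s n) = sets borel"
  by (simp add: ideal_measure_def)

text \<open>Multiplication with the total weight turns the measure of a set into a sum of natural numbers.\<close>

lemma measure_ideal_measure:
  assumes A: "A \<in> sets borel"
  shows "real (\<Sum>z\<leftarrow>list_decode (Suc n). Suc (psnd z)) * measure (ideal_measure s n) A =
      real (\<Sum>z\<leftarrow>list_decode (Suc n). of_bool (s (pfst z) \<in> A) * Suc (psnd z))"
    and "0 < (\<Sum>z\<leftarrow>list_decode (Suc n). Suc (psnd z))"
proof -
  define zs where "zs = list_decode (Suc n)"
  define W where "W = (\<Sum>z\<leftarrow>zs. Suc (psnd z))"
  have total: "(\<Sum>(i, v)\<leftarrow>map prod_decode zs. Suc v) = W"
    unfolding W_def psnd_def by (simp add: comp_def case_prod_beta)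
  have eq: "ideal_weights n = map (\<lambda>z. (pfst z, real (Suc (psnd z)) / real W)) zs"
    unfolding ideal_weights_def Let_def zs_def[symmetric] total
    by (simp add: pfst_def psnd_def case_prod_beta)
  have "zs \<noteq> []" by (simp add: zs_def split: prod.splits)
  then show W: "0 < (\<Sum>z\<leftarrow>list_decode (Suc n). Suc (psnd z))"
    unfolding zs_def[symmetric] by (cases zs) auto
  have *: "real W * sum_list (map snd (filter (\<lambda>x. fst x \<in> s -` A)
      (map (\<lambda>z. (pfst z, real (Suc (psnd z)) / real W)) us))) =
      real (\<Sum>z\<leftarrow>us. of_bool (s (pfst z) \<in> A) * Suc (psnd z))" for us
    using W unfolding zs_def[symmetric] W_def[symmetric] by (induction us) (auto simp: field_simps)
  have "measure (ideal_measure s n) A = measure (pmf_of_list (ideal_weights n)) (s -` A)"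
    unfolding ideal_measure_def using A by (simp add: measure_distr)
  also have "\<dots> = sum_list (map snd (filter (\<lambda>x. fst x \<in> s -` A) (ideal_weights n)))"
    by (rule measure_pmf_of_list[OF ideal_weights_wf])
  finally show "real (\<Sum>z\<leftarrow>list_decode (Suc n). Suc (psnd z)) * measure (ideal_measure s n) A =
      real (\<Sum>z\<leftarrow>list_decode (Suc n). of_bool (s (pfst z) \<in> A) * Suc (psnd z))"
    unfolding eq using *[of zs] by (simp only: W_def zs_def)
qed

text \<open>Running the search for all entries of the list up to time \<open>t\<close> gives a sum that increases with \<open>t\<close>
  and reaches its final value after finitely many steps.\<close>

lemma semidecidable_less_weighted_sum:
  assumes "semidecidable (\<lambda>p. P (pfst p) (psnd p))" "computable l"
    "computable a" "computable b"
  shows "semidecidable (\<lambda>x. a x < b x * (\<Sum>z\<leftarrow>list_decode (l x). of_bool (P x z) * Suc (psnd z)))"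
proof -
  obtain Q where Q: "decidable (\<lambda>p. Q (pfst p) (psnd p))"
      "\<And>p. P (pfst p) (psnd p) \<longleftrightarrow> (\<exists>n. Q p n)"
    using assms(1) unfolding semidecidable_def by blast
  have P: "P x k \<longleftrightarrow> (\<exists>n. Q (pair x k) n)" for x k using Q(2)[of "pair x k"] by simp
  let ?w = "\<lambda>x t z. of_bool (\<exists>n<t. Q (pair x z) n) * Suc (psnd z)"
  have le: "(\<Sum>z\<leftarrow>zs. ?w x t z) \<le> (\<Sum>z\<leftarrow>zs. of_bool (P x z) * Suc (psnd z))" for zs x t
    by (intro sum_list_mono) (auto simp: P)
  have mono: "(\<Sum>z\<leftarrow>zs. ?w x t z) \<le> (\<Sum>z\<leftarrow>zs. ?w x t' z)" if "t \<le> t'" for zs x t t'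
    using that by (intro sum_list_mono) (auto intro: order_less_le_trans)
  have reach: "\<exists>t. (\<Sum>z\<leftarrow>zs. of_bool (P x z) * Suc (psnd z)) \<le> (\<Sum>z\<leftarrow>zs. ?w x t z)" for zs x
  proof (induction zs)
    case (Cons z zs)
    then obtain t where t: "(\<Sum>z\<leftarrow>zs. of_bool (P x z) * Suc (psnd z)) \<le> (\<Sum>z\<leftarrow>zs. ?w x t z)" by blast
    have "\<exists>t'. P x z \<longrightarrow> (\<exists>n<t'. Q (pair x z) n)" unfolding P by blast
    then obtain t' where t': "of_bool (P x z) * Suc (psnd z) \<le> ?w x t' z" by fastforce
    have "?w x t' z \<le> ?w x (max t t') z" by (auto simp: less_max_iff_disj)
    then show ?case
      using t t' mono[of t "max t t'" x zs] by (intro exI[of _ "max t t'"]) (simp only: list.map sum_list.Cons, linarith)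
  qed simp
  have "a < b * (\<Sum>z\<leftarrow>zs. of_bool (P x z) * Suc (psnd z)) \<longleftrightarrow> (\<exists>t. a < b * (\<Sum>z\<leftarrow>zs. ?w x t z))" for a b x zs
  proof
    assume "a < b * (\<Sum>z\<leftarrow>zs. of_bool (P x z) * Suc (psnd z))"
    then show "\<exists>t. a < b * (\<Sum>z\<leftarrow>zs. ?w x t z)"
      using reach[where x = x and zs = zs] by (meson mult_le_mono2 order_less_le_trans)
  next
    assume "\<exists>t. a < b * (\<Sum>z\<leftarrow>zs. ?w x t z)"
    then show "a < b * (\<Sum>z\<leftarrow>zs. of_bool (P x z) * Suc (psnd z))"
      using le[where x = x and zs = zs] by (meson mult_le_mono2 order_less_le_trans)
  qed
  moreover have "semidecidable (\<lambda>x. \<exists>t. a x < b x * (\<Sum>z\<leftarrow>list_decode (l x). ?w x t z))"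
    by (intro semidecidable_Ex semidecidable_less comp_intros computable_sum_list decidable_comp2[OF Q(1)]
      computable_comp[OF assms(2)] computable_comp[OF assms(3)] computable_comp[OF assms(4)])
  ultimately show ?thesis by simp
qed

locale computable_prob = computable_metric s + prob_space \<mu>
  for s :: "nat \<Rightarrow> 'a::{metric_space,second_countable_topology}" and \<mu> :: "'a measure" +
  assumes bounded: "bounded (UNIV :: 'a set)" and sets_\<mu> [simp]: "sets \<mu> = sets borel"
    and computable_\<mu>: "computable_measure s \<mu>"
begin

lemma space_\<mu> [simp]: "space \<mu> = UNIV"
  using sets_eq_imp_space_eq[OF sets_\<mu>] by simp

lemma sets_eff_open: "eff_open U \<Longrightarrow> U e \<in> sets borel"
  by (simp add: open_eff_open)

lemma semidecidable_less_measure_ideal: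
  assumes U: "eff_open U" and "computable e" "computable n" "computable a" "computable b"
  shows "semidecidable (\<lambda>x. real (a x) < real (b x) * measure (ideal_measure s (n x)) (U (e x)))"
proof -
  have "real a < real b * measure (ideal_measure s n) (U e) \<longleftrightarrow>
     a * (\<Sum>z\<leftarrow>list_decode (Suc n). Suc (psnd z)) <
     b * (\<Sum>z\<leftarrow>list_decode (Suc n). of_bool (s (pfst z) \<in> U e) * Suc (psnd z))" for a b n e
  proof -
    define W where "W = (\<Sum>z\<leftarrow>list_decode (Suc n). Suc (psnd z))"
    define V where "V = (\<Sum>z\<leftarrow>list_decode (Suc n). of_bool (s (pfst z) \<in> U e) * Suc (psnd z))"
    have W: "0 < W" "real W * measure (ideal_measure s n) (U e) = real V"
      unfolding W_def V_def by (rule measure_ideal_measure sets_eff_open U)+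
    have "real a < real b * measure (ideal_measure s n) (U e) \<longleftrightarrow>
        real W * real a < real W * (real b * measure (ideal_measure s n) (U e))"
      using W(1) by simp
    also have "real W * (real b * measure (ideal_measure s n) (U e)) = real b * real V"
      unfolding W(2)[symmetric] by simp
    also have "real W * real a < real b * real V \<longleftrightarrow> real (a * W) < real (b * V)"
      by (simp add: mult.commute)
    finally show ?thesis unfolding W_def V_def by (simp only: of_nat_less_iff)
  qed
  moreover have "semidecidable (\<lambda>x. a x * (\<Sum>z\<leftarrow>list_decode (Suc (n x)). Suc (psnd z)) <
     b x * (\<Sum>z\<leftarrow>list_decode (Suc (n x)). of_bool (s (pfst z) \<in> U (e x)) * Suc (psnd z)))"
    by (intro semidecidable_less_weighted_sum semidecidable_mem[OF U] comp_intros computable_sum_list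
      computable_comp[OF assms(2)] assms)
  ultimately show ?thesis by simp
qed

text \<open>With \<open>W1 (\<nu> m) \<mu> \<le> 1 / 4^m\<close> and the margin \<open>1 / 2^m\<close> of \<open>K e m\<close>, the comparison of measures
  has the error \<open>1 / 2^m\<close>. Hence \<open>\<nu> m (K e m) > a / b + 1 / 2^m\<close> is a sound certificate for
  \<open>\<mu> (U e) > a / b\<close>, and some \<open>m\<close> provides it because \<open>\<mu> (K e m)\<close> increases to \<open>\<mu> (U e)\<close>.\<close>

lemma semidecidable_less_measure:
  assumes U: "eff_open U" and "computable e" "computable a" "computable b"
  shows "semidecidable (\<lambda>x. real (a x) < real (b x) * measure \<mu> (U (e x)))"
proof -
  obtain A where A: "recursive 1 A" "\<And>n. W1 (ideal_measure s (A [n])) \<mu> \<le> 1 / 2 ^ n"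
    using computable_\<mu> unfolding computable_measure_def computable_point_def by blast
  obtain K where K: "eff_open (\<lambda>p. K (pfst p) (psnd p))"
    "\<And>e m. K e m \<subseteq> K e (Suc m)" "\<And>e. (\<Union>m. K e m) = U e"
    "\<And>e m y z. y \<in> K e m \<Longrightarrow> dist y z < 1 / 2 ^ m \<Longrightarrow> z \<in> U e"
    "\<And>e m y z. y \<in> K e m \<Longrightarrow> dist y z < 1 / 2 ^ Suc m \<Longrightarrow> z \<in> K e (Suc m)"
    using eff_open_shrink[OF U] by blast
  define \<nu> where "\<nu> m = ideal_measure s (A [2 * m])" for m
  have \<nu>: "prob_space (\<nu> m)" "sets (\<nu> m) = sets borel" for m
    unfolding \<nu>_def by (rule prob_space_ideal_measure sets_ideal_measure)+
  have K_sets: "K e m \<in> sets borel" for e m using sets_eff_open[OF K(1), of "pair e m"] by simp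
  have W: "W1 (\<nu> m) \<mu> \<le> 1 / 2 ^ (2 * m)" for m unfolding \<nu>_def by (rule A(2))
  have scale: "(1::real) / 2 ^ (2 * m) / (1 / 2 ^ m) = 1 / 2 ^ m" for m
    by (simp add: mult_2 power_add)
  have upper: "measure (\<nu> m) (K e m) \<le> measure \<mu> (U e) + 1 / 2 ^ m" for m e
  proof -
    have "measure (\<nu> m) (K e m) \<le> measure \<mu> (U e) + 1 / 2 ^ (2 * m) / (1 / 2 ^ m)"
      by (rule W1_measure_comparison[OF bounded \<nu> prob_space_axioms sets_\<mu> disjI1[OF W] K_sets
            sets_eff_open[OF U]]) (simp, rule K(4))
    then show ?thesis unfolding scale .
  qed
  have lower: "measure \<mu> (K e m) \<le> measure (\<nu> (Suc m)) (K e (Suc m)) + 1 / 2 ^ Suc m" for m e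
  proof -
    have "measure \<mu> (K e m) \<le> measure (\<nu> (Suc m)) (K e (Suc m)) + 1 / 2 ^ (2 * Suc m) / (1 / 2 ^ Suc m)"
      by (rule W1_measure_comparison[OF bounded prob_space_axioms sets_\<mu> \<nu> disjI2[OF W] K_sets
            K_sets]) (simp, rule K(5))
    then show ?thesis unfolding scale .
  qed
  have "real a < real b * measure \<mu> (U e) \<longleftrightarrow>
      (\<exists>m. real (a * 2 ^ m + b) < real (b * 2 ^ m) * measure (\<nu> m) (K e m))" for a b e
  proof
    assume ab: "real a < real b * measure \<mu> (U e)"
    then have b: "0 < real b" by (cases "b = 0") auto
    have "(\<lambda>m. measure \<mu> (K e m)) \<longlonglongrightarrow> measure \<mu> (\<Union>m. K e m)"
      by (rule finite_Lim_measure_incseq) (auto simp: K_sets incseq_Suc_iff K(2))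
    then have "(\<lambda>m. measure \<mu> (K e m)) \<longlonglongrightarrow> measure \<mu> (U e)" unfolding K(3) .
    moreover have "(\<lambda>m. 1 / 2 ^ m) \<longlonglongrightarrow> (0::real)"
      using LIMSEQ_power_zero[of "1/2 :: real"] by (simp add: power_one_over)
    ultimately have "(\<lambda>m. measure \<mu> (K e m) - 1 / 2 ^ m) \<longlonglongrightarrow> measure \<mu> (U e) - 0"
      by (rule tendsto_diff)
    moreover have "real a / real b < measure \<mu> (U e) - 0" using ab b by (simp add: field_simps)
    ultimately have "\<forall>\<^sub>F m in sequentially. real a / real b < measure \<mu> (K e m) - 1 / 2 ^ m"
      by (rule order_tendstoD(1))
    then obtain m where "real a / real b < measure \<mu> (K e m) - 1 / 2 ^ m"
      by (auto simp: eventually_sequentially)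
    moreover have "(1::real) / 2 ^ m = 1 / 2 ^ Suc m + 1 / 2 ^ Suc m" by simp
    ultimately have "real a / real b + 1 / 2 ^ Suc m < measure (\<nu> (Suc m)) (K e (Suc m))"
      using lower[of e m] by linarith
    then have "(real a / real b + 1 / 2 ^ Suc m) * (real b * 2 ^ Suc m) <
        measure (\<nu> (Suc m)) (K e (Suc m)) * (real b * 2 ^ Suc m)"
      by (rule mult_strict_right_mono) (use b in simp)
    moreover have "(real a / real b + 1 / 2 ^ Suc m) * (real b * 2 ^ Suc m) = real a * 2 ^ Suc m + real b"
      using b by (simp add: field_simps)
    ultimately have "real a * 2 ^ Suc m + real b < measure (\<nu> (Suc m)) (K e (Suc m)) * (real b * 2 ^ Suc m)"
      by (simp only:)
    then have "real (a * 2 ^ Suc m + b) < real (b * 2 ^ Suc m) * measure (\<nu> (Suc m)) (K e (Suc m))"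
      by (simp only: of_nat_add of_nat_mult of_nat_power of_nat_numeral mult.commute)
    then show "\<exists>m. real (a * 2 ^ m + b) < real (b * 2 ^ m) * measure (\<nu> m) (K e m)" by blast
  next
    assume "\<exists>m. real (a * 2 ^ m + b) < real (b * 2 ^ m) * measure (\<nu> m) (K e m)"
    then obtain m where "real (a * 2 ^ m + b) < real (b * 2 ^ m) * measure (\<nu> m) (K e m)" by blast
    also have "\<dots> \<le> real (b * 2 ^ m) * (measure \<mu> (U e) + 1 / 2 ^ m)"
      by (intro mult_left_mono upper) simp
    also have "\<dots> = real b * measure \<mu> (U e) * 2 ^ m + real b" by (simp add: field_simps)
    finally have "real a * 2 ^ m < real b * measure \<mu> (U e) * 2 ^ m" by simp
    then show "real a < real b * measure \<mu> (U e)" by simp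
  qed
  moreover have "semidecidable (\<lambda>x. \<exists>m. real (a x * 2 ^ m + b x) <
      real (b x * 2 ^ m) * measure (\<nu> m) (K (e x) m))"
    unfolding \<nu>_def
    using semidecidable_less_measure_ideal[OF K(1), of "\<lambda>p. pair (e (pfst p)) (psnd p)"
      "\<lambda>p. A [2 * psnd p]" "\<lambda>p. a (pfst p) * 2 ^ psnd p + b (pfst p)" "\<lambda>p. b (pfst p) * 2 ^ psnd p"]
    by (intro semidecidable_Ex) (simp add: comp_intros computable_recursive1[OF A(1)] computable_comp[OF assms(2)]
        computable_comp[OF assms(3)] computable_comp[OF assms(4)])
  ultimately show ?thesis by simp
qed

end

section \<open>Ergodic averages\<close>

locale measure_preserving = prob_space M for M :: "'a measure" +
  fixes T :: "'a \<Rightarrow> 'a"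
  assumes T_meas [measurable]: "T \<in> measurable M M"
    and T_inv: "distr M M T = M"
begin

lemma funpow_measurable [measurable]: "(T ^^ k) \<in> measurable M M"
  by (induction k) (simp_all add: measurable_comp[OF _ T_meas])

lemma integral_T:
  fixes f :: "'a \<Rightarrow> real"
  assumes [measurable]: "f \<in> borel_measurable M"
  shows "(\<integral>x. f (T x) \<partial>M) = (\<integral>x. f x \<partial>M)"
  using integral_distr[OF T_meas assms] by (simp add: T_inv)

lemma measure_funpow_vimage:
  assumes "A \<in> sets M"
  shows "measure M ((T ^^ k) -` A \<inter> space M) = measure M A"
proof (induction k)
  case 0
  show ?case using sets.sets_into_space[OF assms] by (simp add: Int_absorb2)
next
  case (Suc k)
  let ?B = "(T ^^ k) -` A \<inter> space M"
  have "?B \<in> sets M" using assms by (rule measurable_sets[OF funpow_measurable])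
  moreover have "(T ^^ Suc k) -` A \<inter> space M = T -` ?B \<inter> space M"
    using measurable_space[OF T_meas] by (auto simp: funpow_swap1)
  ultimately show ?case using Suc measure_distr[OF T_meas] by (metis T_inv sets_distr)
qed

definition birkhoff_sum :: "('a \<Rightarrow> real) \<Rightarrow> nat \<Rightarrow> 'a \<Rightarrow> real" where
  "birkhoff_sum f n x = (\<Sum>k<n. f ((T ^^ k) x))"

lemma birkhoff_sum_measurable [measurable]:
  "f \<in> borel_measurable M \<Longrightarrow> birkhoff_sum f n \<in> borel_measurable M"
  unfolding birkhoff_sum_def
  using measurable_compose[OF funpow_measurable] by (intro borel_measurable_sum) blast

lemma birkhoff_sum_Suc: "birkhoff_sum f (Suc n) x = f x + birkhoff_sum f n (T x)"
  unfolding birkhoff_sum_def by (simp add: sum.lessThan_Suc_shift funpow_swap1 del: sum.lessThan_Suc)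

text \<open>The largest Birkhoff sum of length at most \<open>n\<close>. The recursion follows the orbit, and this is what the
  invariance of the measure acts on.\<close>

primrec max_sum :: "('a \<Rightarrow> real) \<Rightarrow> nat \<Rightarrow> 'a \<Rightarrow> real" where
  "max_sum f 0 x = 0"
| "max_sum f (Suc n) x = max 0 (f x + max_sum f n (T x))"

lemma max_sum_nonneg: "0 \<le> max_sum f n x"
  by (cases n) auto

lemma max_sum_measurable [measurable]:
  assumes [measurable]: "f \<in> borel_measurable M"
  shows "max_sum f n \<in> borel_measurable M"
proof (induction n)
  case 0
  have "max_sum f 0 = (\<lambda>x. 0)" by auto
  then show ?case by simp
next
  case (Suc n)
  note [measurable] = Suc
  have "max_sum f (Suc n) = (\<lambda>x. max 0 (f x + max_sum f n (T x)))" by auto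
  then show ?case by simp
qed

lemma max_sum_mono: "max_sum f n x \<le> max_sum f (Suc n) x"
proof (induction n arbitrary: x)
  case (Suc n)
  have "f x + max_sum f n (T x) \<le> f x + max_sum f (Suc n) (T x)"
    using Suc by (rule add_left_mono)
  then show ?case by (metis max.mono max_sum.simps(2) order_refl)
qed simp

lemma birkhoff_sum_le_max_sum: "k \<le> n \<Longrightarrow> birkhoff_sum f k x \<le> max_sum f n x"
proof (induction n arbitrary: k x)
  case 0
  then show ?case by (simp add: birkhoff_sum_def)
next
  case (Suc n)
  show ?case
  proof (cases k)
    case 0
    then show ?thesis by (simp add: birkhoff_sum_def)
  next
    case (Suc j)
    then have "birkhoff_sum f j (T x) \<le> max_sum f n (T x)" using Suc.IH Suc.prems by auto
    then show ?thesis unfolding Suc by (auto simp: birkhoff_sum_Suc)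
  qed
qed

lemma max_sum_attained: "\<exists>k\<le>n. max_sum f n x = birkhoff_sum f k x"
proof (induction n arbitrary: x)
  case (Suc n)
  obtain k where k: "k \<le> n" "max_sum f n (T x) = birkhoff_sum f k (T x)" using Suc by blast
  show ?case
  proof (cases "0 \<le> f x + max_sum f n (T x)")
    case True
    with k show ?thesis by (intro exI[of _ "Suc k"]) (simp add: birkhoff_sum_Suc)
  next
    case False
    then show ?thesis by (intro exI[of _ 0]) (simp add: birkhoff_sum_def)
  qed
qed (simp add: birkhoff_sum_def)

lemma max_sum_bound:
  assumes "\<And>x. \<bar>f x\<bar> \<le> C" shows "\<bar>max_sum f n x\<bar> \<le> C * n"
proof (induction n arbitrary: x)
  case (Suc n)
  have "0 \<le> C" using assms[of x] by linarith
  then have "0 \<le> C * real n" by simp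
  with Suc[of "T x"] assms[of x] show ?case by (auto simp: algebra_simps abs_le_iff)
qed simp

lemma max_sum_integrable:
  assumes "f \<in> borel_measurable M" "\<And>x. \<bar>f x\<bar> \<le> C"
  shows "integrable M (max_sum f n)"
  using assms max_sum_bound[OF assms(2)]
  by (intro integrable_const_bound[where B = "C * n"]) auto

text \<open>Garsia's argument: where the maximal sum is positive, it is at most \<open>f\<close> plus the maximal sum along the
  shifted orbit; elsewhere it is zero. Since both maximal sums have the same integral, the integral of
  \<open>f\<close> over the set of positivity cannot be negative.\<close>

lemma maximal_ergodic:
  assumes f [measurable]: "f \<in> borel_measurable M" and bound: "\<And>x. \<bar>f x\<bar> \<le> C"
  shows "0 \<le> (\<integral>x. f x * indicator {x \<in> space M. 0 < max_sum f n x} x \<partial>M)"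
proof -
  let ?P = "{x \<in> space M. 0 < max_sum f n x}"
  note int = max_sum_integrable[OF f bound]
  have intT: "integrable M (\<lambda>x. max_sum f n (T x))"
    using integrable_distr[OF T_meas, of "max_sum f n"] int by (simp add: T_inv)
  have intf: "integrable M (\<lambda>x. f x * indicator ?P x)"
    by (rule integrable_const_bound[where B = C])
      (use bound in \<open>auto simp: indicator_def abs_mult intro: order_trans[OF abs_ge_zero]\<close>)
  have "(\<integral>x. max_sum f n x - max_sum f n (T x) \<partial>M) = 0"
    using int intT integral_T[of "max_sum f n"] by simp
  moreover have "(\<integral>x. max_sum f n x - max_sum f n (T x) \<partial>M) \<le> (\<integral>x. f x * indicator ?P x \<partial>M)"
  proof (rule integral_mono)
    fix x assume "x \<in> space M"
    then show "max_sum f n x - max_sum f n (T x) \<le> f x * indicator ?P x"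
      using max_sum_mono[of f n x] max_sum_nonneg[of f n x] max_sum_nonneg[of f n "T x"]
      by (cases "0 < max_sum f n x") auto
  qed (use int intT intf in auto)
  ultimately show ?thesis by simp
qed

text \<open>The maximal ergodic theorem for the function \<open>indicator B - \<epsilon>\<close>, whose sums are positive when the
  orbit visits \<open>B\<close> with frequency greater than \<open>\<epsilon>\<close>.\<close>

lemma maximal_inequality:
  assumes B: "B \<in> sets M" and \<epsilon>: "0 < \<epsilon>"
  shows "\<epsilon> * measure M {x \<in> space M. \<exists>t\<le>n. \<epsilon> * real t < birkhoff_sum (indicator B) t x} \<le> measure M B"
proof -
  define f where "f x = indicator B x - \<epsilon>" for x
  have f [measurable]: "f \<in> borel_measurable M" unfolding f_def using B by measurable
  let ?P = "{x \<in> space M. 0 < max_sum f n x}"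
  have P: "?P \<in> sets M" by measurable
  have sums: "birkhoff_sum f t x = birkhoff_sum (indicator B) t x - \<epsilon> * real t" for t x
    unfolding birkhoff_sum_def f_def by (simp add: sum_subtractf)
  have "{x \<in> space M. \<exists>t\<le>n. \<epsilon> * real t < birkhoff_sum (indicator B) t x} = ?P"
    using birkhoff_sum_le_max_sum[of _ n f] max_sum_attained[of n f]
    unfolding sums by (smt (verit) Collect_cong)
  moreover have "\<epsilon> * measure M ?P \<le> measure M B"
  proof -
    have "0 \<le> (\<integral>x. f x * indicator ?P x \<partial>M)"
      by (rule maximal_ergodic[OF f, of "1 + \<epsilon>"])
        (use \<epsilon> in \<open>auto simp: f_def indicator_def\<close>)
    also have "\<dots> = (\<integral>x. indicator (B \<inter> ?P) x - \<epsilon> * indicator ?P x \<partial>M)"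
      by (intro Bochner_Integration.integral_cong) (auto simp: f_def indicator_def)
    also have "\<dots> = measure M (B \<inter> ?P) - \<epsilon> * measure M ?P"
      using B P by (subst Bochner_Integration.integral_diff) (auto simp: emeasure_eq_measure)
    also have "\<dots> \<le> measure M B - \<epsilon> * measure M ?P"
      using B P by (simp add: finite_measure_mono)
    finally show ?thesis by simp
  qed
  ultimately show ?thesis by simp
qed

end

locale ergodic_system = measure_preserving M T for M :: "'a measure" and T +
  assumes ergodic: "ergodic_measure T M"
begin

text \<open>The set \<open>A\<close> where the maximal sums are unbounded is invariant, so it has measure 0 or 1. Measure 1 is
  impossible: the maximal sum of length \<open>n + 1\<close> minus the shifted maximal sum of length \<open>n\<close> has
  nonnegative integral, but on \<open>A\<close> it eventually equals \<open>f\<close>.\<close>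

lemma birkhoff_sums_bounded_above:
  assumes f [measurable]: "f \<in> borel_measurable M" and bound: "\<And>x. \<bar>f x\<bar> \<le> C"
    and neg: "(\<integral>x. f x \<partial>M) < 0"
  shows "AE x in M. \<exists>b. \<forall>n. birkhoff_sum f n x \<le> b"
proof -
  define A where "A = {x \<in> space M. \<forall>b::nat. \<exists>n. real b < max_sum f n x}"
  have A [measurable]: "A \<in> sets M" unfolding A_def by measurable
  have bounded_iff: "(\<forall>b::nat. \<exists>n. real b < max_sum f n (T x)) \<longleftrightarrow> (\<forall>b::nat. \<exists>n. real b < max_sum f n x)" for x
  proof (intro iffI allI)
    fix b :: nat assume *: "\<forall>b::nat. \<exists>n. real b < max_sum f n (T x)"
    obtain c :: nat where "real b + C \<le> real c" using real_arch_simple by blast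
    moreover obtain n where "real c < max_sum f n (T x)" using * by blast
    ultimately have "real b < max_sum f (Suc n) x" using bound[of x] by (auto simp: abs_le_iff)
    then show "\<exists>n. real b < max_sum f n x" by blast
  next
    fix b :: nat assume *: "\<forall>b::nat. \<exists>n. real b < max_sum f n x"
    obtain c :: nat where "real b + C \<le> real c" using real_arch_simple by blast
    moreover obtain n where n: "real c < max_sum f n x" using * by blast
    moreover obtain m where "n = Suc m" using n by (cases n) auto
    ultimately have "real b < max_sum f m (T x)" using bound[of x] by (auto simp: abs_le_iff)
    then show "\<exists>n. real b < max_sum f n (T x)" by blast
  qed
  have inv: "T -` A \<inter> space M = A"
    unfolding A_def using bounded_iff measurable_space[OF T_meas] by auto
  have "emeasure M A = 0"
  proof (rule ccontr)
    assume "emeasure M A \<noteq> 0"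
    with ergodic A inv have "emeasure M A = 1" unfolding ergodic_measure_def by blast
    then have AE_A: "AE x in M. x \<in> A"
      using A AE_in_set_eq_1 by (simp add: emeasure_eq_measure)
    \<comment> \<open>By the recursion for \<open>max_sum\<close>, \<open>g n x\<close> differs from \<open>f x\<close> only
      while the maximal sum along the shifted orbit is smaller than \<open>- f x\<close>.\<close>
    define g where "g n x = max_sum f (Suc n) x - max_sum f n (T x)" for n x
    have [measurable]: "g n \<in> borel_measurable M" for n unfolding g_def by measurable
    have g_eq: "g n x = max (- max_sum f n (T x)) (f x)" for n x
      unfolding g_def by (auto simp: max_def)
    have g_bound: "\<bar>g n x\<bar> \<le> C" for n x
      using bound[of x] max_sum_nonneg[of f n "T x"] unfolding g_eq by (auto simp: max_def abs_le_iff)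
    have "AE x in M. (\<lambda>n. g n x) \<longlonglongrightarrow> f x"
      using AE_A
    proof eventually_elim
      case (elim x)
      then have "\<forall>b::nat. \<exists>n. real b < max_sum f n (T x)" using bounded_iff unfolding A_def by blast
      moreover obtain b :: nat where "C \<le> real b" using real_arch_simple by blast
      ultimately obtain n where n: "C < max_sum f n (T x)" by (meson le_less_trans)
      have "g m x = f x" if "n \<le> m" for m
      proof -
        have "max_sum f n (T x) \<le> max_sum f m (T x)"
          using that by (induction rule: dec_induct) (auto intro: order_trans[OF _ max_sum_mono] simp del: max_sum.simps)
        with n bound[of x] show ?thesis unfolding g_eq by (auto simp: max_def abs_le_iff)
      qed
      then show ?case by (intro tendsto_eventually) (auto simp: eventually_sequentially)
    qed
    then have "(\<lambda>n. \<integral>x. g n x \<partial>M) \<longlonglongrightarrow> (\<integral>x. f x \<partial>M)"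
      using g_bound by (intro integral_dominated_convergence[where w = "\<lambda>_. C"]) auto
    moreover have "0 \<le> (\<integral>x. g n x \<partial>M)" for n
    proof -
      note int = max_sum_integrable[OF f bound]
      have intT: "integrable M (\<lambda>x. max_sum f n (T x))"
        using integrable_distr[OF T_meas, of "max_sum f n"] int by (simp add: T_inv)
      have "(\<integral>x. g n x \<partial>M) = (\<integral>x. max_sum f (Suc n) x \<partial>M) - (\<integral>x. max_sum f n x \<partial>M)"
        unfolding g_def using int[of "Suc n"] intT integral_T[of "max_sum f n"]
        by (subst Bochner_Integration.integral_diff) auto
      moreover have "(\<integral>x. max_sum f n x \<partial>M) \<le> (\<integral>x. max_sum f (Suc n) x \<partial>M)"
        using int[of n] int[of "Suc n"] max_sum_mono by (rule integral_mono)
      ultimately show ?thesis by simp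
    qed
    ultimately have "0 \<le> (\<integral>x. f x \<partial>M)" by (intro LIMSEQ_le_const) auto
    with neg show False by simp
  qed
  then have "AE x in M. x \<notin> A" using A by (intro AE_not_in) (auto simp: null_sets_def)
  with AE_space show ?thesis
  proof eventually_elim
    case (elim x)
    then obtain b :: nat where "\<And>n. max_sum f n x \<le> real b" unfolding A_def by (auto simp: not_less)
    then show ?case using birkhoff_sum_le_max_sum[of _ _ f x] by (meson order_refl order_trans)
  qed
qed

text \<open>For \<open>q < q' < measure M G\<close> the function \<open>q' - indicator G\<close> has a negative integral, and bounded
  sums of this function leave a frequency of visits to \<open>G\<close> of at least \<open>q' - b / p\<close> at time \<open>p\<close>.\<close>

lemma visit_frequency_in_measure:
  assumes G: "G \<in> sets M" and q: "0 \<le> q" "q < measure M G" and \<delta>: "\<delta> < 1"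
  shows "\<exists>p>0. \<delta> < measure M {x \<in> space M. q * real p < birkhoff_sum (indicator G) p x}"
proof -
  obtain q' where q': "q < q'" "q' < measure M G" using q dense by blast
  define f where "f x = q' - indicator G x" for x
  have f [measurable]: "f \<in> borel_measurable M" unfolding f_def using G by measurable
  have sums: "birkhoff_sum f t x = q' * real t - birkhoff_sum (indicator G) t x" for t x
    unfolding birkhoff_sum_def f_def by (simp add: sum_subtractf)
  have "AE x in M. \<exists>b. \<forall>n. birkhoff_sum f n x \<le> b"
  proof (rule birkhoff_sums_bounded_above[OF f])
    show "\<bar>f x\<bar> \<le> 1 + \<bar>q'\<bar>" for x by (auto simp: f_def indicator_def)
    have "(\<integral>x. f x \<partial>M) = q' - measure M G"
      unfolding f_def using G by (subst Bochner_Integration.integral_diff) (auto simp: emeasure_eq_measure prob_space)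
    then show "(\<integral>x. f x \<partial>M) < 0" using q'(2) by simp
  qed
  then have ev: "AE x in M. \<forall>\<^sub>F p in sequentially. q * real p < birkhoff_sum (indicator G) p x"
  proof eventually_elim
    case (elim x)
    then obtain b where b: "\<And>n. q' * real n - birkhoff_sum (indicator G) n x \<le> b" unfolding sums by blast
    obtain N :: nat where N: "b / (q' - q) < real N" using reals_Archimedean2 by blast
    have "q * real p < birkhoff_sum (indicator G) p x" if "N \<le> p" for p
    proof -
      have "b / (q' - q) < real p" using N that by linarith
      then have "b < real p * (q' - q)" using q'(1) by (simp add: pos_divide_less_eq)
      then show ?thesis using b[of p] by (simp add: algebra_simps)
    qed
    then show ?case by (auto simp: eventually_sequentially)
  qed
  define E where "E N = {x \<in> space M. \<forall>p\<ge>N. q * real p < birkhoff_sum (indicator G) p x}" for N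
  have E [measurable]: "E N \<in> sets M" for N unfolding E_def using G by measurable
  have "measure M (\<Union>N. E N) = 1"
  proof (subst prob_eq_1)
    show "AE x in M. x \<in> (\<Union>N. E N)"
      using ev AE_space by eventually_elim (auto simp: E_def eventually_sequentially)
  qed auto
  moreover have "(\<lambda>N. measure M (E N)) \<longlonglongrightarrow> measure M (\<Union>N. E N)"
  proof (rule finite_Lim_measure_incseq)
    have "E m \<subseteq> E n" if "m \<le> n" for m n
      unfolding E_def using order_trans[OF that] by blast
    then show "incseq E" unfolding incseq_def by blast
  qed (use E in blast)
  ultimately have "(\<lambda>N. measure M (E N)) \<longlonglongrightarrow> 1" by simp
  from order_tendstoD(1)[OF this \<delta>] obtain N where N: "\<And>n. N \<le> n \<Longrightarrow> \<delta> < measure M (E n)"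
    by (auto simp: eventually_sequentially)
  have "\<delta> < measure M (E (Suc N))" by (rule N) simp
  also have "\<dots> \<le> measure M {x \<in> space M. q * real (Suc N) < birkhoff_sum (indicator G) (Suc N) x}"
  proof (rule finite_measure_mono)
    show "{x \<in> space M. q * real (Suc N) < birkhoff_sum (indicator G) (Suc N) x} \<in> sets M"
      using G by measurable
  qed (auto simp: E_def)
  finally show ?thesis by blast
qed

end

section \<open>Computable points in sets of large measure\<close>

context computable_prob
begin

lemma sets_dball [simp]: "dball c \<in> sets borel"
  by (simp add: dball_def)

lemma dball_positive_measure:
  assumes E: "E \<in> sets borel" and pos: "0 < measure \<mu> E"
  shows "\<exists>i. 0 < measure \<mu> (E \<inter> dball (pair i l))"
proof (rule ccontr)
  assume "\<not> ?thesis"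
  then have "measure \<mu> (E \<inter> dball (pair i l)) = 0" for i by (metis measure_nonneg order_le_less)
  then have "E \<inter> dball (pair i l) \<in> null_sets \<mu>" for i
    using E by (intro null_setsI) (auto simp: emeasure_eq_measure)
  then have "(\<Union>i. E \<inter> dball (pair i l)) \<in> null_sets \<mu>" by (rule null_sets_UN)
  moreover have "(\<Union>i. E \<inter> dball (pair i l)) = E"
  proof -
    have "\<exists>i. y \<in> dball (pair i l)" for y
      using dball_exists[of l y] by (metis pair_pfst_psnd)
    then show ?thesis by blast
  qed
  ultimately have "measure \<mu> E = 0" by (simp add: measure_eq_0_null_sets)
  with pos show False by simp
qed

end

locale computable_prob_polish = computable_prob s \<mu>
  for s :: "nat \<Rightarrow> 'a::polish_space" and \<mu> :: "'a measure"
begin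

text \<open>The index shift by 2 turns the error \<open>4 / 2^k\<close> into the required \<open>1 / 2^n\<close>.\<close>

lemma computable_point_from_sequence:
  assumes f: "computable f" and d: "\<And>k. dist (s (f k)) (s (f (Suc k))) \<le> 2 / 2 ^ k"
  obtains x where "computable_point dist s x" "\<And>k. dist (s (f k)) x \<le> 4 / 2 ^ k"
proof -
  have tele: "dist (s (f k)) (s (f (k + j))) \<le> 4 / 2 ^ k - 4 / 2 ^ (k + j)" for k j
  proof (induction j)
    case (Suc j)
    have "dist (s (f k)) (s (f (k + Suc j))) \<le>
        dist (s (f k)) (s (f (k + j))) + dist (s (f (k + j))) (s (f (Suc (k + j))))"
      using dist_triangle[of "s (f k)" "s (f (k + Suc j))" "s (f (k + j))"] by simp
    also have "\<dots> \<le> 4 / 2 ^ k - 4 / 2 ^ (k + j) + 2 / 2 ^ (k + j)"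
      using Suc d[of "k + j"] by linarith
    also have "\<dots> = 4 / 2 ^ k - 4 / 2 ^ (k + Suc j)" by simp
    finally show ?case .
  qed simp
  have close: "dist (s (f k)) (s (f j)) \<le> 4 / 2 ^ k" if "k \<le> j" for k j
  proof -
    have "0 \<le> (4::real) / 2 ^ j" by simp
    moreover have "dist (s (f k)) (s (f j)) \<le> 4 / 2 ^ k - 4 / 2 ^ j"
      using tele[of k "j - k"] that by simp
    ultimately show ?thesis by linarith
  qed
  have "Cauchy (\<lambda>k. s (f k))"
  proof (rule metric_CauchyI)
    fix e :: real assume "0 < e"
    then obtain M where M: "8 / 2 ^ M < e" using half_power_small by blast
    have "dist (s (f m)) (s (f n)) < e" if "M \<le> m" "M \<le> n" for m n
      using close[OF that(1)] close[OF that(2)] M dist_triangle[of "s (f m)" "s (f n)" "s (f M)"]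
      by (simp add: dist_commute)
    then show "\<exists>M. \<forall>m\<ge>M. \<forall>n\<ge>M. dist (s (f m)) (s (f n)) < e" by blast
  qed
  then obtain x where x: "(\<lambda>k. s (f k)) \<longlonglongrightarrow> x"
    using Cauchy_convergent convergent_def by blast
  have lim: "dist (s (f k)) x \<le> 4 / 2 ^ k" for k
  proof (rule LIMSEQ_le_const2)
    show "(\<lambda>j. dist (s (f k)) (s (f j))) \<longlonglongrightarrow> dist (s (f k)) x" by (intro tendsto_intros x)
    show "\<exists>N. \<forall>n\<ge>N. dist (s (f k)) (s (f n)) \<le> 4 / 2 ^ k" using close by blast
  qed
  have "computable (\<lambda>n. f (n + 2))" by (intro computable_comp[OF f] comp_intros)
  then obtain A where A: "recursive 1 A" "\<And>n. A [n] = f (n + 2)"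
    unfolding computable_def rec_ext_def by (metis length_Cons list.size(3) nth_Cons_0 One_nat_def)
  have "dist (s (A [n])) x \<le> 1 / 2 ^ n" for n
    unfolding A(2) using lim[of "n + 2"] by simp
  then have "computable_point dist s x" unfolding computable_point_def using A(1) by blast
  then show thesis using that lim by blast
qed

text \<open>A state \<open>(c, N)\<close> with property \<open>Q\<close> below stands for the open set \<open>dball c \<inter> W' 0 \<inter> \<dots> \<inter> W' (N - 1)\<close> of
  measure greater than \<open>1 / 2^N\<close>. The remaining sets \<open>W' n\<close> remove at most \<open>1 / 2^(N + 1)\<close>,
  and hence some small ball meets what is left in positive measure; with a sufficiently large new \<open>N\<close>
  it is the next state. The limit point belongs to the closure of each \<open>W' n\<close>, and the margin
  between \<open>W' n\<close> and \<open>W n\<close> puts it into \<open>W n\<close>.\<close>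

theorem computable_point_in_Inter:
  assumes W: "eff_open W" and large: "\<And>n. 1 - 1 / 2 ^ (n + 2) < measure \<mu> (W n)"
  shows "\<exists>x. computable_point dist s x \<and> (\<forall>n. x \<in> W n)"
proof -
  obtain K where K: "eff_open (\<lambda>p. K (pfst p) (psnd p))"
    "\<And>e m. K e m \<subseteq> K e (Suc m)" "\<And>e. (\<Union>m. K e m) = W e"
    "\<And>e m y z. y \<in> K e m \<Longrightarrow> dist y z < 1 / 2 ^ m \<Longrightarrow> z \<in> W e"
    "\<And>e m y z. y \<in> K e m \<Longrightarrow> dist y z < 1 / 2 ^ Suc m \<Longrightarrow> z \<in> K e (Suc m)"
    using eff_open_shrink[OF W] by blast
  have K_sets: "K e m \<in> sets borel" for e m using sets_eff_open[OF K(1), of "pair e m"] by simp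
  have scale: "real (2 ^ (n + 2) - 1) < real (2 ^ (n + 2)) * r \<longleftrightarrow> 1 - 1 / 2 ^ (n + 2) < r" for n r
    by (simp add: of_nat_diff field_simps)
  have "\<exists>m. computable m \<and> (\<forall>n. real (2 ^ (n + 2) - 1) < real (2 ^ (n + 2)) * measure \<mu> (K n (m n)))"
  proof (rule semidecidable_choice)
    show "semidecidable (\<lambda>p. real (2 ^ (pfst p + 2) - 1) < real (2 ^ (pfst p + 2)) * measure \<mu> (K (pfst p) (psnd p)))"
      by (intro semidecidable_less_measure[OF K(1)] comp_intros)
    fix n
    have "(\<lambda>m. measure \<mu> (K n m)) \<longlonglongrightarrow> measure \<mu> (\<Union>m. K n m)"
      by (rule finite_Lim_measure_incseq) (auto simp: K_sets incseq_Suc_iff K(2))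
    then have "\<forall>\<^sub>F m in sequentially. 1 - 1 / 2 ^ (n + 2) < measure \<mu> (K n m)"
      unfolding K(3) using large by (rule order_tendstoD(1))
    then show "\<exists>m. real (2 ^ (n + 2) - 1) < real (2 ^ (n + 2)) * measure \<mu> (K n m)"
      unfolding scale by (auto simp: eventually_sequentially)
  qed
  then obtain m where m: "computable m" "\<And>n. 1 - 1 / 2 ^ (n + 2) < measure \<mu> (K n (m n))"
    unfolding scale by blast
  define W' where "W' n = K n (m n)" for n
  have W'_sets [simp]: "W' n \<in> sets borel" for n unfolding W'_def by (rule K_sets)
  have W': "eff_open W'"
    unfolding W'_def by (intro eff_open_comp2[OF K(1)] m comp_intros)
  \<comment> \<open>\<open>C A N\<close> takes the first \<open>N\<close> constraints into account, \<open>F A\<close> takes all of them\<close>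
  define C where "C A N = A \<inter> (\<Inter>n<N. W' n)" for A N
  have C_sets [simp]: "C A N \<in> sets borel" if "A \<in> sets borel" for A N
    unfolding C_def using that by (cases N) (auto intro!: sets.Int sets.finite_INT)
  have C_open: "eff_open (\<lambda>z. C (dball (pfst z)) (psnd z))"
    unfolding C_def
    by (intro eff_open_inter eff_open_INT_less eff_open_comp[OF eff_open_dball] eff_open_comp[OF W'] comp_intros)
  define F where "F A = A \<inter> (\<Inter>n. W' n)" for A
  have F_sets [simp]: "F A \<in> sets borel" if "A \<in> sets borel" for A
    unfolding F_def using that by (intro sets.Int sets.countable_INT) auto
  have tail: "measure \<mu> (C A N) - 1 / 2 ^ (N + 1) \<le> measure \<mu> (F A)" if A: "A \<in> sets borel" for A N
  proof -
    have step: "measure \<mu> (C A N) - 1 / 2 ^ (N + 1) + 1 / 2 ^ (N + k + 1) \<le> measure \<mu> (C A (N + k))" for k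
    proof (induction k)
      case (Suc k)
      have "C A (N + Suc k) = C A (N + k) \<inter> W' (N + k)"
        unfolding C_def by (auto simp: lessThan_Suc)
      then have "measure \<mu> (C A (N + Suc k)) = measure \<mu> (C A (N + k) \<inter> W' (N + k))" by simp
      moreover have "measure \<mu> (C A (N + k)) + measure \<mu> (W' (N + k)) - 1 \<le>
          measure \<mu> (C A (N + k) \<inter> W' (N + k))"
        using measure_Un3[of "C A (N + k)" \<mu> "W' (N + k)"] A prob_le_1[of "C A (N + k) \<union> W' (N + k)"]
        by (simp add: fmeasurable_eq_sets)
      moreover have "1 - 1 / 2 ^ (N + k + 2) < measure \<mu> (W' (N + k))"
        unfolding W'_def by (rule m(2))
      moreover have "(1::real) / 2 ^ (N + k + 1) = 1 / 2 ^ (N + k + 2) + 1 / 2 ^ (N + Suc k + 1)"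
        by simp
      ultimately show ?case using Suc by linarith
    qed simp
    have "(\<lambda>k. measure \<mu> (C A (N + k))) \<longlonglongrightarrow> measure \<mu> (\<Inter>k. C A (N + k))"
    proof (rule finite_Lim_measure_decseq)
      show "decseq (\<lambda>k. C A (N + k))" unfolding decseq_def C_def by auto
    qed (use A in auto)
    moreover have "(\<Inter>k. C A (N + k)) = F A"
    proof (intro equalityI subsetI)
      fix y assume y: "y \<in> (\<Inter>k. C A (N + k))"
      have "y \<in> W' n" for n using y[THEN INT_D, of "Suc n"] unfolding C_def by auto
      with y show "y \<in> F A" unfolding C_def F_def by auto
    qed (auto simp: C_def F_def)
    ultimately have "(\<lambda>k. measure \<mu> (C A (N + k))) \<longlonglongrightarrow> measure \<mu> (F A)" by simp
    moreover have "measure \<mu> (C A N) - 1 / 2 ^ (N + 1) \<le> measure \<mu> (C A (N + k))" for k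
      using step[of k] by (smt (verit) zero_le_divide_1_iff zero_le_power)
    ultimately show ?thesis by (intro LIMSEQ_le_const) auto
  qed
  define Q where "Q z \<longleftrightarrow> 1 / 2 ^ psnd z < measure \<mu> (C (dball (pfst z)) (psnd z))" for z
  define P where "P z z' \<longleftrightarrow> psnd (pfst z) < psnd (pfst z') \<and> psnd z < psnd z' \<and>
    dist (s (pfst (pfst z))) (s (pfst (pfst z'))) * real (2 ^ psnd (pfst z)) + real 0 < real 2" for z z'
  \<comment> \<open>A set that meets the intersection of all \<open>W' n\<close> in positive measure meets the balls of
    valid states with arbitrarily small radius and large \<open>N\<close>.\<close>
  have refine: "\<exists>z. Q z \<and> psnd (pfst z) = l \<and> N \<le> psnd z \<and> dball (pfst z) \<inter> A \<noteq> {}"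
    if A: "A \<in> sets borel" and pos: "0 < measure \<mu> (F A)" for A l N
  proof -
    obtain i where i: "0 < measure \<mu> (F A \<inter> dball (pair i l))"
      using dball_positive_measure[OF F_sets[OF A] pos] by blast
    then obtain N0 where N0: "\<And>n. N0 \<le> n \<Longrightarrow> 1 / 2 ^ n < measure \<mu> (F A \<inter> dball (pair i l))"
      using half_power_small by blast
    let ?z = "pair (pair i l) (max N N0)"
    have "F A \<inter> dball (pair i l) \<subseteq> C (dball (pair i l)) (max N N0)"
      unfolding F_def C_def by auto
    then have "measure \<mu> (F A \<inter> dball (pair i l)) \<le> measure \<mu> (C (dball (pair i l)) (max N N0))"
      by (intro finite_measure_mono) auto
    then have "Q ?z" using N0[of "max N N0"] unfolding Q_def by simp
    moreover have "F A \<inter> dball (pair i l) \<noteq> {}" using i by auto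
    then have "dball (pair i l) \<inter> A \<noteq> {}" unfolding F_def by auto
    ultimately show ?thesis by (intro exI[of _ ?z]) simp
  qed
  have "\<exists>f. computable f \<and> (\<forall>n. Q (f n) \<and> P (f n) (f (Suc n)))"
  proof -
    have "measure \<mu> (C UNIV 0) = 1" unfolding C_def using prob_space by simp
    then have "0 < measure \<mu> (F UNIV)" using tail[of UNIV 0] by simp
    then obtain z0 where z0: "Q z0" using refine[of UNIV] by auto
    show ?thesis
    proof (rule semidecidable_dependent_choice[where Q = Q and P = P])
      show "Q z0" by (rule z0)
      have "semidecidable (\<lambda>z. real 1 < real (2 ^ psnd z) * measure \<mu> (C (dball (pfst z)) (psnd z)))"
        by (intro semidecidable_less_measure[OF C_open] comp_intros)
      moreover have "real 1 < real (2 ^ psnd z) * r \<longleftrightarrow> 1 / 2 ^ psnd z < r" for z r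
        by (simp add: field_simps)
      ultimately show "semidecidable Q" unfolding Q_def by simp
      show "semidecidable (\<lambda>p. P (pfst p) (psnd p))"
        unfolding P_def by (intro semidecidable_conj semidecidable_less semidecidable_dist_less comp_intros)
      fix z assume z: "Q z"
      have "1 / 2 ^ (psnd z + 1) \<le> (1::real) / 2 ^ psnd z" by (simp add: field_simps)
      then have "0 < measure \<mu> (F (dball (pfst z)))"
        using tail[of "dball (pfst z)" "psnd z"] z unfolding Q_def by simp
      then obtain z' where z': "Q z'" "psnd (pfst z') = Suc (psnd (pfst z))" "Suc (psnd z) \<le> psnd z'"
          "dball (pfst z') \<inter> dball (pfst z) \<noteq> {}"
        using refine[of "dball (pfst z)"] by (metis sets_dball)
      obtain y where y: "y \<in> dball (pfst z')" "y \<in> dball (pfst z)" using z'(4) by blast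
      have "dist (s (pfst (pfst z))) (s (pfst (pfst z'))) <
          1 / 2 ^ psnd (pfst z) + 1 / 2 ^ psnd (pfst z')"
        using y dist_triangle[of "s (pfst (pfst z))" "s (pfst (pfst z'))" y]
        unfolding dball_def by (simp add: dist_commute)
      also have "\<dots> \<le> 2 / 2 ^ psnd (pfst z)" unfolding z'(2) by (simp add: field_simps)
      finally have "P z z'" unfolding P_def using z'(2,3) by (simp add: field_simps)
      with z'(1) show "\<exists>z'. Q z' \<and> P z z'" by blast
    qed
  qed
  then obtain f where f: "computable f" "\<And>n. Q (f n)" "\<And>n. P (f n) (f (Suc n))" by blast
  have rad: "k \<le> psnd (pfst (f k))" for k
  proof (induction k)
    case (Suc k)
    then show ?case using f(3)[of k] unfolding P_def by linarith
  qed simp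
  have lev: "k \<le> psnd (f k)" for k
  proof (induction k)
    case (Suc k)
    then show ?case using f(3)[of k] unfolding P_def by linarith
  qed simp
  have small: "1 / 2 ^ psnd (pfst (f k)) \<le> (1::real) / 2 ^ k" for k
    using rad[of k] by (simp add: frac_le power_increasing)
  obtain x where x: "computable_point dist s x" "\<And>k. dist (s (pfst (pfst (f k)))) x \<le> 4 / 2 ^ k"
  proof (rule computable_point_from_sequence)
    show "computable (\<lambda>k. pfst (pfst (f k)))" by (intro comp_intros f)
    show "dist (s (pfst (pfst (f k)))) (s (pfst (pfst (f (Suc k))))) \<le> 2 / 2 ^ k" for k
    proof -
      have "dist (s (pfst (pfst (f k)))) (s (pfst (pfst (f (Suc k))))) < 2 / 2 ^ psnd (pfst (f k))"
        using f(3)[of k] unfolding P_def by (simp add: field_simps)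
      also have "\<dots> = 2 * (1 / 2 ^ psnd (pfst (f k)))" by simp
      also have "\<dots> \<le> 2 * (1 / 2 ^ k)" using small[of k] by (rule mult_left_mono) simp
      finally show ?thesis by simp
    qed
  qed blast
  have "x \<in> W n" for n
  proof -
    obtain M where M: "\<And>k. M \<le> k \<Longrightarrow> 5 / 2 ^ k < (1::real) / 2 ^ m n"
      using half_power_small[of "1 / 2 ^ m n" 5] by auto
    define k where "k = max M (Suc n)"
    have "0 < measure \<mu> (C (dball (pfst (f k))) (psnd (f k)))"
      using f(2)[of k] unfolding Q_def by (smt (verit) zero_le_divide_1_iff zero_le_power)
    then have "C (dball (pfst (f k))) (psnd (f k)) \<noteq> {}" by auto
    moreover have "n < psnd (f k)" using lev[of k] by (simp add: k_def)
    ultimately obtain y where y: "y \<in> dball (pfst (f k))" "y \<in> W' n" unfolding C_def by auto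
    have "dist y x \<le> dist (s (pfst (pfst (f k)))) y + dist (s (pfst (pfst (f k)))) x"
      by (rule dist_triangle3)
    also have "\<dots> \<le> 1 / 2 ^ k + 4 / 2 ^ k"
      using y(1) small[of k] x(2)[of k] by (simp add: dball_def)
    also have "\<dots> < 1 / 2 ^ m n" using M[of k] by (simp add: k_def)
    finally show "x \<in> W n" using K(4) y(2) unfolding W'_def by blast
  qed
  with x(1) show ?thesis by blast
qed

end

section \<open>From visit frequencies to averages of continuous functions\<close>

definition average :: "(nat \<Rightarrow> real) \<Rightarrow> nat \<Rightarrow> real" where
  "average u n = (\<Sum>k<n. u k) / real n"

lemma average_mono: "(\<And>k. u k \<le> v k) \<Longrightarrow> average u n \<le> average v n"
  unfolding average_def by (intro divide_right_mono sum_mono) auto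

text \<open>The layer cake formula with \<open>m\<close> layers: \<open>f\<close> lies within \<open>1 / m\<close> above the mean of the indicators
  of the open sets \<open>{f > (j + 1) / m}\<close>, and lower bounds for their frequencies add up.\<close>

lemma average_lower_bound_continuous:
  fixes \<mu> :: "'a::metric_space measure" and y :: "nat \<Rightarrow> 'a" and f :: "'a \<Rightarrow> real"
  assumes "prob_space \<mu>" and sets: "sets \<mu> = sets borel"
    and freq: "\<And>U q. open U \<Longrightarrow> q < measure \<mu> U \<Longrightarrow> \<forall>\<^sub>F n in sequentially. q < average (\<lambda>k. indicator U (y k)) n"
    and f: "continuous_on UNIV f" and range: "\<And>x. 0 \<le> f x" "\<And>x. f x \<le> 1" and q: "q < (\<integral>x. f x \<partial>\<mu>)"
  shows "\<forall>\<^sub>F n in sequentially. q < average (\<lambda>k. f (y k)) n"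
proof -
  interpret prob_space \<mu> by fact
  obtain m0 :: nat where m0: "1 / ((\<integral>x. f x \<partial>\<mu>) - q) < real m0" using reals_Archimedean2 by blast
  define m where "m = Suc m0"
  have m: "0 < m" "1 / real m < (\<integral>x. f x \<partial>\<mu>) - q"
  proof -
    have "1 / ((\<integral>x. f x \<partial>\<mu>) - q) < real m" using m0 by (simp add: m_def)
    then show "1 / real m < (\<integral>x. f x \<partial>\<mu>) - q" using q by (simp add: m_def field_simps)
  qed (simp add: m_def)
  define U where "U j = {x. real (Suc j) / real m < f x}" for j
  have U_open: "open (U j)" for j
    unfolding U_def using f by (intro open_Collect_less continuous_on_const)
  then have U_sets [simp]: "U j \<in> sets borel" for j by auto
  define h where "h x = (\<Sum>j<m. indicator (U j) x) / real m" for x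
  have h: "h x \<le> f x" "f x \<le> h x + 1 / real m" for x
  proof -
    define c where "c = nat \<lceil>real m * f x\<rceil>"
    have c: "real c - 1 < real m * f x" "real m * f x \<le> real c" "c \<le> m"
      using range[of x] m(1) unfolding c_def by (simp_all add: ceiling_le_iff mult_le_cancel_left1 nat_le_iff; linarith)+
    have "indicator (U j) x = (of_bool (j < c - 1) :: real)" for j
    proof -
      have "real (Suc j) / real m < f x \<longleftrightarrow> real (Suc j) < real m * f x"
        using m(1) by (simp add: field_simps)
      also have "\<dots> \<longleftrightarrow> Suc j < c"
      proof
        assume "real (Suc j) < real m * f x"
        then show "Suc j < c" using c(2) by linarith
      next
        assume "Suc j < c"
        then show "real (Suc j) < real m * f x" using c(1) by linarith
      qed
      finally show ?thesis by (auto simp: U_def indicator_def)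
    qed
    then have "(\<Sum>j<m. indicator (U j) x) = (\<Sum>j<m. of_bool (j < c - 1) :: real)" by simp
    also have "\<dots> = real (card ({..<m} \<inter> {j. j < c - 1}))" by (simp add: sum_of_bool_eq)
    also have "{..<m} \<inter> {j. j < c - 1} = {..<c - 1}" using c(3) by auto
    finally have "(\<Sum>j<m. indicator (U j) x) = real (c - 1)" by simp
    then have hx: "h x * real m = real (c - 1)" unfolding h_def using m(1) by simp
    have "real (c - 1) \<le> real m * f x" using c(1) range(1)[of x] by (cases c) auto
    then have "h x * real m \<le> f x * real m" unfolding hx by (simp add: mult.commute)
    then show "h x \<le> f x" using m(1) by simp
    have "f x * real m \<le> h x * real m + 1" unfolding hx using c(2) by (simp add: mult.commute)
    then show "f x \<le> h x + 1 / real m" using m(1) by (simp add: field_simps)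
  qed
  have [measurable]: "f \<in> borel_measurable \<mu>"
    unfolding measurable_cong_sets[OF sets refl] by (rule borel_measurable_continuous_onI[OF f])
  have int_f: "integrable \<mu> f"
    by (rule integrable_const_bound[where B = 1]) (use range in auto)
  have int_U: "integrable \<mu> (indicator (U j) :: 'a \<Rightarrow> real)" for j
    by (simp add: sets emeasure_eq_measure)
  have "(\<integral>x. f x \<partial>\<mu>) \<le> (\<integral>x. h x + 1 / real m \<partial>\<mu>)"
    using int_f h(2) int_U unfolding h_def by (intro integral_mono) auto
  also have "\<dots> = (\<Sum>j<m. measure \<mu> (U j)) / real m + 1 / real m"
    unfolding h_def using int_U by (simp add: prob_space sets)
  finally have "q < (\<Sum>j<m. measure \<mu> (U j)) / real m" using m(2) by linarith
  then obtain \<delta> where \<delta>: "0 < \<delta>" "q + \<delta> < (\<Sum>j<m. measure \<mu> (U j)) / real m"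
    by (metis add.commute less_diff_eq dense diff_gt_0_iff_gt)
  have "\<forall>\<^sub>F n in sequentially. \<forall>j\<in>{..<m}. measure \<mu> (U j) - \<delta> < average (\<lambda>k. indicator (U j) (y k)) n"
    by (rule eventually_ball_finite) (use \<delta>(1) in \<open>auto intro!: freq U_open\<close>)
  then show ?thesis
  proof eventually_elim
    case (elim n)
    have "q < (\<Sum>j<m. measure \<mu> (U j) - \<delta>) / real m"
      using \<delta>(2) m(1) by (simp add: sum_subtractf diff_divide_distrib)
    also have "\<dots> \<le> (\<Sum>j<m. average (\<lambda>k. indicator (U j) (y k)) n) / real m"
      using elim by (intro divide_right_mono sum_mono) (auto intro: less_imp_le)
    also have "\<dots> = average (\<lambda>k. h (y k)) n"
    proof -
      have "(\<Sum>j<m. \<Sum>k<n. indicator (U j) (y k) :: real) = (\<Sum>k<n. \<Sum>j<m. indicator (U j) (y k))"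
        by (rule sum.swap)
      then show ?thesis unfolding average_def h_def
        by (simp add: sum_divide_distrib[symmetric] mult.commute)
    qed
    also have "\<dots> \<le> average (\<lambda>k. f (y k)) n" by (rule average_mono) (rule h(1))
    finally show ?case .
  qed
qed

text \<open>The upper bound is the lower bound for \<open>-f\<close>; an affine map brings both functions into the
  range between 0 and 1.\<close>

lemma average_tendsto_integral:
  fixes \<mu> :: "'a::metric_space measure" and y :: "nat \<Rightarrow> 'a" and f :: "'a \<Rightarrow> real"
  assumes "prob_space \<mu>" and sets: "sets \<mu> = sets borel"
    and freq: "\<And>U q. open U \<Longrightarrow> q < measure \<mu> U \<Longrightarrow> \<forall>\<^sub>F n in sequentially. q < average (\<lambda>k. indicator U (y k)) n"
    and f: "continuous_on UNIV f" and bound: "\<And>x. \<bar>f x\<bar> \<le> B"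
  shows "average (\<lambda>k. f (y k)) \<longlonglongrightarrow> (\<integral>x. f x \<partial>\<mu>)"
proof -
  interpret prob_space \<mu> by fact
  define b where "b = B + 1"
  have b: "0 < b" "\<And>x. \<bar>f x\<bar> \<le> b"
    using bound order_trans[OF abs_ge_zero bound] unfolding b_def by (auto intro: add_increasing2)
  have [measurable]: "f \<in> borel_measurable \<mu>"
    unfolding measurable_cong_sets[OF sets refl] by (rule borel_measurable_continuous_onI[OF f])
  have int_f: "integrable \<mu> f"
    by (rule integrable_const_bound[where B = b]) (use b in auto)
  have lower: "\<forall>\<^sub>F n in sequentially. (\<integral>x. \<sigma> * f x \<partial>\<mu>) - \<eta> < average (\<lambda>k. \<sigma> * f (y k)) n"
    if \<eta>: "0 < \<eta>" and \<sigma>: "\<bar>\<sigma>\<bar> = 1" for \<eta> \<sigma> :: real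
  proof -
    define g where "g x = (\<sigma> * f x + b) / (2 * b)" for x
    have sf: "\<bar>\<sigma> * f x\<bar> \<le> b" for x using b(2)[of x] \<sigma> by (simp add: abs_mult)
    have int_g: "(\<integral>x. g x \<partial>\<mu>) = ((\<integral>x. \<sigma> * f x \<partial>\<mu>) + b) / (2 * b)"
      unfolding g_def using int_f by (simp add: prob_space)
    have "\<forall>\<^sub>F n in sequentially. (\<integral>x. g x \<partial>\<mu>) - \<eta> / (2 * b) < average (\<lambda>k. g (y k)) n"
    proof (rule average_lower_bound_continuous[OF assms(1) sets freq])
      show "continuous_on UNIV g" unfolding g_def using b(1) by (intro continuous_intros f) auto
      show "0 \<le> g x" "g x \<le> 1" for x
        unfolding g_def using sf[of x] b(1) by (auto simp: abs_le_iff field_simps)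
      show "(\<integral>x. g x \<partial>\<mu>) - \<eta> / (2 * b) < (\<integral>x. g x \<partial>\<mu>)" using \<eta> b(1) by simp
    qed auto
    with eventually_gt_at_top[of 0] show ?thesis
    proof eventually_elim
      case (elim n)
      have "average (\<lambda>k. g (y k)) n = (average (\<lambda>k. \<sigma> * f (y k)) n + b) / (2 * b)"
        unfolding average_def g_def using elim(1) b(1)
        by (simp add: sum.distrib sum_divide_distrib[symmetric] field_simps)
      with elim(2) have "((\<integral>x. \<sigma> * f x \<partial>\<mu>) + b - \<eta>) / (2 * b) < (average (\<lambda>k. \<sigma> * f (y k)) n + b) / (2 * b)"
        unfolding int_g by (simp add: diff_divide_distrib)
      then show ?case using b(1) by (simp add: divide_less_cancel)
    qed
  qed
  show ?thesis
  proof (rule tendstoI)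
    fix e :: real assume e: "0 < e"
    have "\<forall>\<^sub>F n in sequentially. (\<integral>x. f x \<partial>\<mu>) - e < average (\<lambda>k. f (y k)) n"
      and "\<forall>\<^sub>F n in sequentially. - (\<integral>x. f x \<partial>\<mu>) - e < average (\<lambda>k. - f (y k)) n"
      using lower[OF e, of 1] lower[OF e, of "-1"] by simp_all
    then show "\<forall>\<^sub>F n in sequentially. dist (average (\<lambda>k. f (y k)) n) (\<integral>x. f x \<partial>\<mu>) < e"
      by eventually_elim (auto simp: dist_real_def average_def sum_negf abs_less_iff)
  qed
qed

context computable_metric
begin

definition finite_union :: "nat \<Rightarrow> 'a set" where
  "finite_union w = (\<Union>b\<in>{b. bit_of w b}. dball b)"

lemma eff_open_finite_union: "eff_open finite_union"
  unfolding finite_union_def by (intro eff_open_union eff_open_dball semidecidable_decidable comp_intros)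

end

context computable_prob
begin

lemma finite_union_approximates_open:
  assumes U: "open U" and q: "q < measure \<mu> U"
  shows "\<exists>w. finite_union w \<subseteq> U \<and> q < measure \<mu> (finite_union w)"
proof -
  define V where "V N = (\<Union>c\<in>{c. c < N \<and> dball c \<subseteq> U}. dball c)" for N
  have V_sets: "V N \<in> sets borel" for N unfolding V_def by (intro borel_open open_UN) (simp add: dball_def)
  have "(\<Union>N. V N) = U"
  proof (intro equalityI subsetI)
    fix x assume x: "x \<in> U"
    then obtain r where r: "0 < r" "ball x r \<subseteq> U" using U open_contains_ball by blast
    obtain l where l: "2 / 2 ^ l < r" using half_power_small[OF r(1)] by blast
    obtain c where c: "psnd c = l" "x \<in> dball c" using dball_exists by blast
    have "dball c \<subseteq> ball x r"
    proof
      fix z assume "z \<in> dball c"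
      then show "z \<in> ball x r"
        using c l dist_triangle[of x z "s (pfst c)"] by (simp add: dball_def dist_commute)
    qed
    with r(2) c(2) have "x \<in> V (Suc c)" unfolding V_def by blast
    then show "x \<in> (\<Union>N. V N)" by blast
  qed (auto simp: V_def)
  moreover have "(\<lambda>N. measure \<mu> (V N)) \<longlonglongrightarrow> measure \<mu> (\<Union>N. V N)"
  proof (rule finite_Lim_measure_incseq)
    show "incseq V" unfolding incseq_def V_def by force
  qed (use V_sets in auto)
  ultimately have "\<forall>\<^sub>F N in sequentially. q < measure \<mu> (V N)"
    using q by (metis order_tendstoD(1))
  then obtain N where N: "q < measure \<mu> (V N)" by (auto simp: eventually_sequentially)
  obtain w where "\<And>k. bit_of w k \<longleftrightarrow> k \<in> {c. c < N \<and> dball c \<subseteq> U}"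
    using bit_of_finite[of "{c. c < N \<and> dball c \<subseteq> U}"] by auto
  then have "{b. bit_of w b} = {c. c < N \<and> dball c \<subseteq> U}" by blast
  then have "finite_union w = V N" unfolding finite_union_def V_def by simp
  with N show ?thesis by (intro exI[of _ w]) (auto simp: V_def)
qed

end

section \<open>Frequent visits\<close>

text \<open>Count the pairs \<open>(k, i)\<close> with \<open>k < t\<close>, \<open>i < p\<close> and a visit at time \<open>k + i\<close>. Each time \<open>k\<close> with \<open>v k\<close>
  contributes at least \<open>q p\<close> pairs, whereas each visit belongs to at most \<open>p\<close> pairs; the visits from
  time \<open>t\<close> on account for the summand \<open>p\<close>.\<close>

lemma visit_count_lower_bound:
  fixes u :: "nat \<Rightarrow> real"
  assumes u: "\<And>k. 0 \<le> u k" "\<And>k. u k \<le> 1"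
    and v: "\<And>k. v k \<Longrightarrow> q * real p \<le> (\<Sum>i<p. u (k + i))"
    and p: "0 < p" and q: "0 \<le> q" and many: "c \<le> (\<Sum>k<t. of_bool (v k))"
  shows "q * c \<le> (\<Sum>k<t. u k) + real p"
proof -
  have shift: "(\<Sum>k<t. u (k + i)) \<le> (\<Sum>k<t. u k) + real p" if "i < p" for i
  proof -
    have "(\<Sum>k<t. u (k + i)) = sum u {i..<t + i}"
      using sum.shift_bounds_nat_ivl[of u 0 i t] by (simp add: atLeast0LessThan)
    also have "\<dots> \<le> sum u {..<t + i}" by (rule sum_mono2) (use u in auto)
    also have "{..<t + i} = {..<t} \<union> {t..<t + i}" by auto
    also have "sum u ({..<t} \<union> {t..<t + i}) = sum u {..<t} + sum u {t..<t + i}"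
      by (rule sum.union_disjoint) auto
    also have "sum u {t..<t + i} \<le> (\<Sum>k\<in>{t..<t + i}. 1)" by (rule sum_mono) (rule u)
    finally show ?thesis using that by simp
  qed
  have "q * real p * c \<le> q * real p * (\<Sum>k<t. of_bool (v k))"
    using many q by (intro mult_left_mono) auto
  also have "\<dots> = (\<Sum>k<t. q * real p * of_bool (v k))" by (rule sum_distrib_left)
  also have "\<dots> \<le> (\<Sum>k<t. \<Sum>i<p. u (k + i))"
    using v by (intro sum_mono) (auto intro: sum_nonneg u simp: of_bool_def)
  also have "\<dots> = (\<Sum>i<p. \<Sum>k<t. u (k + i))" by (rule sum.swap)
  also have "\<dots> \<le> (\<Sum>i<p. (\<Sum>k<t. u k) + real p)" by (intro sum_mono shift) auto
  finally have "real p * (q * c) \<le> real p * ((\<Sum>k<t. u k) + real p)" by (simp add: mult_ac)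
  then show ?thesis using p by (simp only: mult_le_cancel_left_pos of_nat_0_less_iff)
qed

context measure_preserving
begin

text \<open>The maximal inequality for the complement of \<open>Q\<close>, of measure less than \<open>1 / 4^m\<close>, and the frequency
  \<open>1 / 2^m\<close>. The bound does not depend on the time \<open>L\<close> up to which the visits are counted.\<close>

lemma frequent_visits_uniformly:
  assumes Q: "Q \<in> sets M" and large: "1 - 1 / 4 ^ m < measure M Q"
  shows "1 - 1 / 2 ^ m < measure M {x \<in> space M. \<forall>t\<le>L. (1 - 1 / 2 ^ m) * real t \<le> birkhoff_sum (indicator Q) t x}"
proof -
  let ?B = "space M - Q"
  let ?bad = "{x \<in> space M. \<exists>t\<le>L. 1 / 2 ^ m * real t < birkhoff_sum (indicator ?B) t x}"
  let ?good = "{x \<in> space M. \<forall>t\<le>L. (1 - 1 / 2 ^ m) * real t \<le> birkhoff_sum (indicator Q) t x}"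
  have B: "?B \<in> sets M" using Q by auto
  then have bad: "?bad \<in> sets M" by measurable
  have "(1 / 2 ^ m) * measure M ?bad \<le> measure M ?B" by (rule maximal_inequality[OF B]) simp
  also have "\<dots> < 1 / 4 ^ m" using large prob_compl[OF Q] by simp
  finally have "2 ^ m * ((1 / 2 ^ m) * measure M ?bad) < 2 ^ m * (1 / 4 ^ m)"
    by (rule mult_strict_left_mono) simp
  moreover have "(4::real) ^ m = 2 ^ m * 2 ^ m" by (simp flip: power_mult_distrib)
  ultimately have "measure M ?bad < 1 / 2 ^ m" by simp
  moreover have "?good = space M - ?bad"
  proof -
    have "birkhoff_sum (indicator ?B) t x = real t - birkhoff_sum (indicator Q) t x"
      if "x \<in> space M" for x t
    proof -
      have "indicator ?B ((T ^^ k) x) = (1 - indicator Q ((T ^^ k) x) :: real)" for k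
        using measurable_space[OF funpow_measurable that] by (simp add: indicator_def)
      then show ?thesis unfolding birkhoff_sum_def by (simp add: sum_subtractf)
    qed
    then have "(1 - 1 / 2 ^ m) * real t \<le> birkhoff_sum (indicator Q) t x \<longleftrightarrow>
        \<not> 1 / 2 ^ m * real t < birkhoff_sum (indicator ?B) t x" if "x \<in> space M" for x t
      using that unfolding left_diff_distrib by fastforce
    then show ?thesis by auto
  qed
  ultimately show ?thesis using prob_compl[OF bad] by simp
qed

end

section \<open>Orbits of an almost everywhere computable map\<close>

locale computable_ergodic = computable_prob_polish s \<mu> + ergodic_system \<mu> T
  for s :: "nat \<Rightarrow> 'a::polish_space" and \<mu> :: "'a measure" and T :: "'a \<Rightarrow> 'a" +
  assumes ae: "ae_computable s \<mu> s T"
begin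

text \<open>Replacing every certified ball \<open>b\<close> of \<open>U e\<close> by the effective open set \<open>V b\<close> describes the preimage
  of \<open>U e\<close> under \<open>T\<close> on \<open>D\<close>, and this can be repeated as long as the orbit stays in \<open>D\<close>.\<close>

lemma eff_open_iterated_preimage:
  assumes V: "eff_open V" "\<And>c. T -` dball c \<inter> D = V c \<inter> D" and U: "eff_open U"
  shows "\<exists>Z. eff_open (\<lambda>p. Z (pfst p) (psnd p)) \<and>
    (\<forall>k e x. (\<forall>j<k. (T ^^ j) x \<in> D) \<longrightarrow> (x \<in> Z k e \<longleftrightarrow> (T ^^ k) x \<in> U e))"
proof -
  obtain R where R: "semidecidable (\<lambda>p. R (pfst p) (psnd p))"
    "\<And>b c y. R b c \<Longrightarrow> y \<in> dball c \<Longrightarrow> y \<in> V b"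
    "\<And>b y. y \<in> V b \<Longrightarrow> \<exists>M. \<forall>c. y \<in> dball c \<and> M \<le> psnd c \<longrightarrow> R b c"
    "\<And>b y. y \<in> V b \<longleftrightarrow> (\<exists>c. R b c \<and> y \<in> dball c)"
    using V(1) by (rule eff_openE) blast
  obtain S where S: "semidecidable (\<lambda>p. S (pfst p) (psnd p))"
    "\<And>e y. y \<in> U e \<Longrightarrow> \<exists>M. \<forall>c. y \<in> dball c \<and> M \<le> psnd c \<longrightarrow> S e c"
    "\<And>e y. y \<in> U e \<longleftrightarrow> (\<exists>c. S e c \<and> y \<in> dball c)"
    using U by (rule eff_openE) blast
  define Z where "Z k e = {y. \<exists>c. iter_image R k (S e) c \<and> y \<in> dball c}" for k e
  have Z_Suc: "y \<in> Z (Suc k) e \<longleftrightarrow> (\<exists>b. iter_image R k (S e) b \<and> y \<in> V b)" for y k e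
    unfolding Z_def R(4) by auto
  have "eff_open (\<lambda>p. Z (pfst p) (psnd p))"
  proof (rule eff_openI)
    show "semidecidable (\<lambda>q. iter_image R (pfst (pfst q)) (S (psnd (pfst q))) (psnd q))"
      by (intro semidecidable_iter_image S R comp_intros)
    show "y \<in> Z (pfst p) (psnd p)" if "iter_image R (pfst p) (S (psnd p)) c" "y \<in> dball c" for p c y
      using that unfolding Z_def by blast
    fix p y assume y: "y \<in> Z (pfst p) (psnd p)"
    show "\<exists>M. \<forall>c. y \<in> dball c \<and> M \<le> psnd c \<longrightarrow> iter_image R (pfst p) (S (psnd p)) c"
    proof (cases "pfst p")
      case 0
      then have "y \<in> U (psnd p)" using y unfolding Z_def S(3) by simp
      from S(2)[OF this] show ?thesis unfolding 0 by simp
    next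
      case (Suc k)
      then obtain b where b: "iter_image R k (S (psnd p)) b" "y \<in> V b" using y Z_Suc by auto
      from R(3)[OF b(2)] b(1) show ?thesis unfolding Suc by auto
    qed
  qed
  moreover have "x \<in> Z k e \<longleftrightarrow> (T ^^ k) x \<in> U e" if "\<forall>j<k. (T ^^ j) x \<in> D" for k e x
    using that
  proof (induction k arbitrary: x)
    case 0
    show ?case unfolding Z_def S(3) by simp
  next
    case (Suc k)
    have "x \<in> D" using Suc.prems by force
    then have "x \<in> V b \<longleftrightarrow> T x \<in> dball b" for b using V(2)[of b] by blast
    then have "x \<in> Z (Suc k) e \<longleftrightarrow> T x \<in> Z k e" unfolding Z_Suc unfolding Z_def by simp
    also have "\<dots> \<longleftrightarrow> (T ^^ k) (T x) \<in> U e"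
      using Suc.prems by (intro Suc.IH) (auto simp: funpow_swap1 dest: spec[of _ "Suc _"])
    finally show ?case by (simp add: funpow_swap1)
  qed
  ultimately show ?thesis by blast
qed

text \<open>By invariance of the measure, almost every orbit stays in the set \<open>D\<close> of measure 1 on which \<open>T\<close> is
  computable.\<close>

lemma domain_of_computability:
  obtains UD D where "eff_open UD" "D = (\<Inter>i. UD i)" "AE x in \<mu>. \<forall>k. (T ^^ k) x \<in> D"
    "\<And>U. eff_open U \<Longrightarrow> \<exists>Z. eff_open (\<lambda>p. Z (pfst p) (psnd p)) \<and>
      (\<forall>k e x. (\<forall>j<k. (T ^^ j) x \<in> D) \<longrightarrow> (x \<in> Z k e \<longleftrightarrow> (T ^^ k) x \<in> U e))"
proof -
  obtain D where D: "effective_G_delta s D" "emeasure \<mu> D = 1" "computable_fun_on s s D T"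
    using ae unfolding ae_computable_def by blast
  obtain UD where UD: "uniformly_effective_open s UD" "D = (\<Inter>i. UD i)"
    using D(1) unfolding effective_G_delta_def by blast
  obtain V where V: "uniformly_effective_open s V" "\<And>i. T -` ideal_ball s i \<inter> D = V i \<inter> D"
    using D(3) unfolding computable_fun_on_def by blast
  have UD_eff: "eff_open UD" by (rule eff_open_uniformly_effective[OF UD(1)])
  have V_eff: "eff_open (\<lambda>c. V (ideal_code c))"
    by (intro eff_open_comp[OF eff_open_uniformly_effective[OF V(1)]] computable_ideal_code comp_intros)
  have V_pre: "T -` dball c \<inter> D = V (ideal_code c) \<inter> D" for c
    using V(2)[of "ideal_code c"] unfolding ideal_ball_ideal_code .
  have D_sets: "D \<in> sets \<mu>" unfolding UD(2) using open_eff_open[OF UD_eff] by (auto intro!: sets.countable_INT)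
  have "AE x in \<mu>. (T ^^ k) x \<in> D" for k
  proof -
    have "measure \<mu> ((T ^^ k) -` D \<inter> space \<mu>) = 1"
      using measure_funpow_vimage[OF D_sets] D(2) by (simp add: emeasure_eq_measure)
    then have "AE x in \<mu>. x \<in> (T ^^ k) -` D \<inter> space \<mu>"
      using measurable_sets[OF funpow_measurable D_sets] by (subst (asm) prob_eq_1) auto
    then show ?thesis by eventually_elim auto
  qed
  then have "AE x in \<mu>. \<forall>k. (T ^^ k) x \<in> D" by (simp add: AE_all_countable)
  with that UD_eff UD(2) eff_open_iterated_preimage[OF V_eff V_pre] show thesis by blast
qed

section \<open>A computable typical point\<close>

text \<open>An index \<open>n = pair i j\<close> stands for the stage \<open>j\<close> of the \<open>i\<close>-th triple \<open>e = (w, a, b)\<close> with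
  \<open>a / (b + 1) < \<mu> (finite_union w)\<close>. Its open set \<open>V n\<close> controls the times from \<open>N n\<close> up to \<open>L n\<close>, which
  is the start of the stage \<open>j + 1\<close> of the same triple; in addition, \<open>W n\<close> imposes the \<open>n\<close>-th
  of the conditions \<open>(T ^^ k) x \<in> UD i\<close>, which together keep the orbit in \<open>D\<close>.\<close>

theorem computable_point_visit_frequencies:
  "\<exists>x. computable_point dist s x \<and> (\<forall>w q. q < measure \<mu> (finite_union w) \<longrightarrow>
    (\<forall>\<^sub>F t in sequentially. q < average (\<lambda>k. indicator (finite_union w) ((T ^^ k) x)) t))"
proof -
  obtain UD D where UD: "eff_open UD" "D = (\<Inter>i. UD i)" and orbit: "AE x in \<mu>. \<forall>k. (T ^^ k) x \<in> D"
    and pre: "\<And>U. eff_open U \<Longrightarrow> \<exists>Z. eff_open (\<lambda>p. Z (pfst p) (psnd p)) \<and>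
      (\<forall>k e x. (\<forall>j<k. (T ^^ j) x \<in> D) \<longrightarrow> (x \<in> Z k e \<longleftrightarrow> (T ^^ k) x \<in> U e))"
    by (rule domain_of_computability, rule that)
  obtain ZG where ZG: "eff_open (\<lambda>p. ZG (pfst p) (psnd p))"
    "\<And>k w x. (\<forall>j<k. (T ^^ j) x \<in> D) \<Longrightarrow> x \<in> ZG k w \<longleftrightarrow> (T ^^ k) x \<in> finite_union w"
    using pre[OF eff_open_finite_union] by blast
  obtain ZD where ZD: "eff_open (\<lambda>p. ZD (pfst p) (psnd p))"
    "\<And>k i x. (\<forall>j<k. (T ^^ j) x \<in> D) \<Longrightarrow> x \<in> ZD k i \<longleftrightarrow> (T ^^ k) x \<in> UD i"
    using pre[OF UD(1)] by blast
  have G_sets: "finite_union w \<in> sets \<mu>" for w using sets_eff_open[OF eff_open_finite_union] by simp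

  define num where "num e = pfst (psnd e)" for e
  define den where "den e = Suc (psnd (psnd e))" for e
  define rate where "rate e = real (num e) / real (den e)" for e
  have num_comp: "computable f \<Longrightarrow> computable (\<lambda>x. num (f x))" for f
    unfolding num_def by (intro comp_intros)
  have den_comp: "computable f \<Longrightarrow> computable (\<lambda>x. den (f x))" for f
    unfolding den_def by (intro comp_intros)
  have den_pos: "0 < real (den e)" for e by (simp add: den_def)
  have rate_nonneg: "0 \<le> rate e" for e by (simp add: rate_def)
  define valid where "valid e \<longleftrightarrow> rate e < measure \<mu> (finite_union (pfst e))" for e
  have valid_iff: "valid e \<longleftrightarrow> real (num e) < real (den e) * measure \<mu> (finite_union (pfst e))" for e
    unfolding valid_def rate_def using den_pos by (simp add: pos_divide_less_eq mult.commute)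
  obtain g where g: "computable g" "range g = {e. valid e}"
  proof -
    have "semidecidable valid"
      unfolding valid_iff by (intro semidecidable_less_measure[OF eff_open_finite_union] num_comp den_comp comp_intros)
    moreover have "\<exists>w. 0 < measure \<mu> (finite_union w)"
      using finite_union_approximates_open[OF open_UNIV, of 0] prob_space by auto
    then obtain w where "valid (pair w (pair 0 0))" unfolding valid_def rate_def num_def by auto
    ultimately show thesis using that semidecidable_enumeration by blast
  qed

  \<comment> \<open>\<open>Q e p\<close> is an effective open set which agrees with \<open>visits e p\<close> on the points whose orbit stays in \<open>D\<close>.\<close>
  define visits where "visits e p = {x. rate e * real p < birkhoff_sum (indicator (finite_union (pfst e))) p x}" for e p
  define Q where "Q e p = {y. num e * p < den e * (\<Sum>k<p. of_bool (y \<in> ZG k (pfst e)))}" for e p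
  have visits_sets: "visits e p \<in> sets \<mu>" for e p
  proof -
    have "{x \<in> space \<mu>. rate e * real p < birkhoff_sum (indicator (finite_union (pfst e))) p x} \<in> sets \<mu>"
      using G_sets by measurable
    then show ?thesis unfolding visits_def by simp
  qed
  have Q_iff: "x \<in> Q e p \<longleftrightarrow> x \<in> visits e p" if "\<forall>k. (T ^^ k) x \<in> D" for x e p
  proof -
    define c where "c = (\<Sum>k<p. of_bool (x \<in> ZG k (pfst e)) :: nat)"
    have c: "real c = birkhoff_sum (indicator (finite_union (pfst e))) p x"
      unfolding c_def birkhoff_sum_def of_nat_sum
      using ZG(2) that by (intro sum.cong) (auto simp: indicator_def)
    have "x \<in> Q e p \<longleftrightarrow> real (num e * p) < real (den e * c)"
      unfolding Q_def c_def by (simp only: mem_Collect_eq of_nat_less_iff)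
    also have "\<dots> \<longleftrightarrow> rate e * real p < real c"
      unfolding rate_def using den_pos[of e] by (simp add: field_simps)
    finally show ?thesis unfolding visits_def c by simp
  qed
  have Q_eff: "eff_open (\<lambda>z. Q (pfst z) (psnd z))"
    unfolding Q_def
  proof (rule eff_open_threshold)
    show "eff_open (\<lambda>p. ZG (psnd p) (pfst (pfst (pfst p))))"
      by (intro eff_open_comp2[OF ZG(1)] comp_intros)
    show "semidecidable (\<lambda>p. num (pfst (pfst p)) * psnd (pfst p) < den (pfst (pfst p)) * psnd p)"
      by (intro comp_intros num_comp den_comp)
    show "num (pfst x) * psnd x < den (pfst x) * n" if "num (pfst x) * psnd x < den (pfst x) * m" "m \<le> n" for x m n
      using that by (meson mult_le_mono2 order_less_le_trans)
  qed (intro comp_intros)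
  have Q_sets: "Q e p \<in> sets \<mu>" for e p using sets_eff_open[OF Q_eff, of "pair e p"] by simp
  have Q_measure: "measure \<mu> (Q e p) = measure \<mu> (visits e p)" for e p
  proof (rule measure_eq_AE[OF _ Q_sets visits_sets])
    show "AE x in \<mu>. x \<in> Q e p \<longleftrightarrow> x \<in> visits e p"
      using orbit by eventually_elim (rule Q_iff)
  qed

  have "\<exists>p. computable p \<and> (\<forall>n. 0 < p n \<and>
      real (4 ^ (n + 2) - 1) < real (4 ^ (n + 2)) * measure \<mu> (Q (g (pfst n)) (p n)))"
  proof (rule semidecidable_choice)
    have "semidecidable (\<lambda>z. real (4 ^ (pfst z + 2) - 1) < real (4 ^ (pfst z + 2)) *
        measure \<mu> ((\<lambda>y. Q (pfst y) (psnd y)) (pair (g (pfst (pfst z))) (psnd z))))"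
      by (intro semidecidable_less_measure[OF Q_eff] comp_intros computable_comp[OF g(1)])
    then show "semidecidable (\<lambda>z. 0 < psnd z \<and> real (4 ^ (pfst z + 2) - 1) <
        real (4 ^ (pfst z + 2)) * measure \<mu> (Q (g (pfst (pfst z))) (psnd z)))"
      by (intro semidecidable_conj semidecidable_less comp_intros) simp
    fix n
    let ?e = "g (pfst n)"
    have "valid ?e" using g(2) by blast
    then obtain p where p: "0 < p" "1 - 1 / 4 ^ (n + 2) <
        measure \<mu> {x \<in> space \<mu>. rate ?e * real p < birkhoff_sum (indicator (finite_union (pfst ?e))) p x}"
      using visit_frequency_in_measure[OF G_sets rate_nonneg, of ?e "pfst ?e" "1 - 1 / 4 ^ (n + 2)"]
      unfolding valid_def by auto
    then have "1 - 1 / 4 ^ (n + 2) < measure \<mu> (Q ?e p)" unfolding Q_measure visits_def by simp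
    then have "real (4 ^ (n + 2) - 1) < real (4 ^ (n + 2)) * measure \<mu> (Q ?e p)"
      by (simp add: of_nat_diff field_simps)
    with p(1) show "\<exists>p>0. real (4 ^ (n + 2) - 1) < real (4 ^ (n + 2)) * measure \<mu> (Q ?e p)" by blast
  qed
  then obtain p where p: "computable p" "\<And>n. 0 < p n"
      "\<And>n. real (4 ^ (n + 2) - 1) < real (4 ^ (n + 2)) * measure \<mu> (Q (g (pfst n)) (p n))"
    by blast
  define A where "A n = visits (g (pfst n)) (p n)" for n
  have A_large: "1 - 1 / 4 ^ (n + 2) < measure \<mu> (A n)" for n
    using p(3)[of n] unfolding A_def Q_measure by (simp add: of_nat_diff field_simps)
  have "eff_open (\<lambda>n. Q (g (pfst n)) (p n))"
    by (intro eff_open_comp2[OF Q_eff] computable_comp[OF g(1)] p(1) comp_intros)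
  from pre[OF this] obtain ZQ where ZQ: "eff_open (\<lambda>z. ZQ (pfst z) (psnd z))"
    "\<And>k n x. (\<forall>j<k. (T ^^ j) x \<in> D) \<Longrightarrow> x \<in> ZQ k n \<longleftrightarrow> (T ^^ k) x \<in> Q (g (pfst n)) (p n)"
    by blast
  have ZQ_iff: "x \<in> ZQ k n \<longleftrightarrow> (T ^^ k) x \<in> A n" if "\<forall>k. (T ^^ k) x \<in> D" for x k n
  proof -
    have "(T ^^ j) ((T ^^ k) x) \<in> D" for j
      using that by (metis comp_apply funpow_add)
    then show ?thesis using ZQ(2)[of k x n] that Q_iff unfolding A_def by auto
  qed

  \<comment> \<open>From the time \<open>2^n p n\<close> on, the error term \<open>p n / t\<close> of the block count is at most \<open>1 / 2^n\<close>.\<close>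
  define N where "N n = 2 ^ n * p n" for n
  define L where "L n = N (pair (pfst n) (Suc (psnd n)))" for n
  have L_comp: "computable L"
    unfolding L_def N_def by (intro comp_intros computable_comp[OF p(1)])
  define V where "V n = (\<Inter>t<Suc (L n). {y. (2 ^ (n + 2) - 1) * t \<le> 2 ^ (n + 2) * (\<Sum>k<t. of_bool (y \<in> ZQ k n))})" for n
  define W where "W n = V n \<inter> ZD (pfst n) (psnd n)" for n
  have V_eff: "eff_open V"
    unfolding V_def
  proof (rule eff_open_INT_less)
    show "computable (\<lambda>n. Suc (L n))" by (intro comp_intros L_comp)
    show "eff_open (\<lambda>z. {y. (2 ^ (pfst z + 2) - 1) * psnd z \<le> 2 ^ (pfst z + 2) * (\<Sum>k<psnd z. of_bool (y \<in> ZQ k (pfst z)))})"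
    proof (rule eff_open_threshold)
      show "eff_open (\<lambda>q. ZQ (psnd q) (pfst (pfst q)))"
        by (intro eff_open_comp2[OF ZQ(1)] comp_intros)
      show "semidecidable (\<lambda>q. (2 ^ (pfst (pfst q) + 2) - 1) * psnd (pfst q) \<le> 2 ^ (pfst (pfst q) + 2) * psnd q)"
        by (intro comp_intros)
      show "(2 ^ (pfst x + 2) - 1) * psnd x \<le> 2 ^ (pfst x + 2) * n"
        if "(2 ^ (pfst x + 2) - 1) * psnd x \<le> 2 ^ (pfst x + 2) * m" "m \<le> n" for x m n :: nat
        using that by (meson mult_le_mono2 order_trans)
    qed (intro comp_intros)
  qed
  have W_eff: "eff_open W" unfolding W_def by (intro eff_open_inter V_eff ZD)
  have V_iff: "x \<in> V n \<longleftrightarrow> (\<forall>t\<le>L n. (1 - 1 / 2 ^ (n + 2)) * real t \<le> birkhoff_sum (indicator (A n)) t x)"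
    if x: "\<forall>k. (T ^^ k) x \<in> D" for x n
  proof -
    have "(2 ^ (n + 2) - 1) * t \<le> 2 ^ (n + 2) * (\<Sum>k<t. of_bool (x \<in> ZQ k n)) \<longleftrightarrow>
        (1 - 1 / 2 ^ (n + 2)) * real t \<le> birkhoff_sum (indicator (A n)) t x" for t
    proof -
      define c where "c = (\<Sum>k<t. of_bool (x \<in> ZQ k n) :: nat)"
      have c: "real c = birkhoff_sum (indicator (A n)) t x"
        unfolding c_def birkhoff_sum_def of_nat_sum
        by (intro sum.cong) (auto simp: ZQ_iff[OF x] indicator_def)
      have "(2 ^ (n + 2) - 1) * t \<le> 2 ^ (n + 2) * c \<longleftrightarrow>
          real ((2 ^ (n + 2) - 1) * t) \<le> real (2 ^ (n + 2) * c)" by (simp only: of_nat_le_iff)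
      also have "\<dots> \<longleftrightarrow> (2 ^ (n + 2) - 1) * real t \<le> 2 ^ (n + 2) * real c"
        by (simp add: of_nat_diff)
      also have "\<dots> \<longleftrightarrow> (1 - 1 / 2 ^ (n + 2)) * real t \<le> real c" by (simp add: field_simps)
      finally show ?thesis unfolding c unfolding c_def .
    qed
    then show ?thesis unfolding V_def by (auto simp: less_Suc_eq_le)
  qed
  have "1 - 1 / 2 ^ (n + 2) < measure \<mu> (W n)" for n
  proof -
    let ?good = "{x \<in> space \<mu>. \<forall>t\<le>L n. (1 - 1 / 2 ^ (n + 2)) * real t \<le> birkhoff_sum (indicator (A n)) t x}"
    have A_sets: "A n \<in> sets \<mu>" unfolding A_def by (rule visits_sets)
    have "measure \<mu> (W n) = measure \<mu> ?good"
    proof (rule measure_eq_AE)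
      show "AE x in \<mu>. x \<in> W n \<longleftrightarrow> x \<in> ?good"
        using orbit
      proof eventually_elim
        case (elim x)
        then have "x \<in> ZD (pfst n) (psnd n)" using ZD(2)[of "pfst n" x "psnd n"] UD(2) by auto
        then show ?case unfolding W_def using V_iff[OF elim] by simp
      qed
      show "W n \<in> sets \<mu>" using sets_eff_open[OF W_eff] by simp
      show "?good \<in> sets \<mu>" using A_sets by measurable
    qed
    with frequent_visits_uniformly[OF A_sets A_large] show ?thesis by simp
  qed
  from computable_point_in_Inter[OF W_eff this] obtain x where x: "computable_point dist s x" "\<And>n. x \<in> W n"
    by blast
  have x_orbit: "(T ^^ k) x \<in> D" for k
  proof (induction k rule: less_induct)
    case (less k)
    have "x \<in> ZD k i" for i using x(2)[of "pair k i"] unfolding W_def by simp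
    then show ?case using ZD(2) less UD(2) by auto
  qed
  have "\<forall>\<^sub>F t in sequentially. q < average (\<lambda>k. indicator (finite_union w) ((T ^^ k) x)) t"
    if q: "q < measure \<mu> (finite_union w)" for w q
  proof (cases "q < 0")
    case True
    have "0 \<le> average (\<lambda>k. indicator (finite_union w) ((T ^^ k) x)) t" for t
      unfolding average_def by (intro divide_nonneg_nonneg sum_nonneg) auto
    with True show ?thesis by (intro always_eventually) (auto intro: less_le_trans)
  next
    case False
    obtain r where r: "r \<in> \<rat>" "q < r" "r < measure \<mu> (finite_union w)"
      using Rats_dense_in_real[OF q] by blast
    obtain a b :: nat where ab: "b \<noteq> 0" "\<bar>r\<bar> = real a / real b"
      using r(1) by (rule Rats_abs_nat_div_natE)
    define e where "e = pair w (pair a (b - 1))"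
    have rate_e: "rate e = r" unfolding e_def rate_def num_def den_def using ab False r(2) by simp
    then have "e \<in> range g" unfolding g(2) valid_def e_def using r(3) by simp
    then obtain i where i: "g i = e" by blast
    \<comment> \<open>The times spent outside \<open>A n\<close> lower the bound \<open>r\<close> by at most \<open>r / 2^n\<close>, the summand \<open>p n\<close>
      lowers it by at most \<open>1 / 2^n\<close>; here \<open>n = pair i j \<ge> j\<close>.\<close>
    have block: "r - (r + 1) / 2 ^ j \<le> average (\<lambda>k. indicator (finite_union w) ((T ^^ k) x)) t"
      if t: "N (pair i j) \<le> t" "t \<le> N (pair i (Suc j))" for j t
    proof -
      define n where "n = pair i j"
      have "j \<le> n" unfolding n_def pair_def by (rule le_prod_encode_2)
      have "2 ^ n * p n \<le> t" using t(1) unfolding n_def N_def .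
      then have tp: "2 ^ n * real (p n) \<le> real t" by (simp flip: of_nat_le_iff[where 'a = real])
      have t_pos: "0 < real t" using tp p(2)[of n] by (smt (verit) mult_pos_pos of_nat_0_less_iff zero_less_power)
      have r0: "0 \<le> r" using False r(2) by simp
      define u where "u k = (indicator (finite_union w) ((T ^^ k) x) :: real)" for k
      have "r * ((1 - 1 / 2 ^ (n + 2)) * real t) \<le> (\<Sum>k<t. u k) + real (p n)"
      proof (rule visit_count_lower_bound[where v = "\<lambda>k. (T ^^ k) x \<in> A n"])
        show "r * real (p n) \<le> (\<Sum>i<p n. u (k + i))" if "(T ^^ k) x \<in> A n" for k
        proof -
          have "r * real (p n) < birkhoff_sum (indicator (finite_union w)) (p n) ((T ^^ k) x)"
            using that unfolding A_def visits_def n_def pfst_pair i rate_e by (simp add: e_def)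
          also have "\<dots> = (\<Sum>i<p n. u (k + i))"
            unfolding birkhoff_sum_def u_def by (simp add: funpow_add add.commute[of k])
          finally show ?thesis by simp
        qed
        have "t \<le> L n" using t(2) unfolding L_def n_def by simp
        then have "(1 - 1 / 2 ^ (n + 2)) * real t \<le> birkhoff_sum (indicator (A n)) t x"
          using x(2)[of n] V_iff x_orbit unfolding W_def by blast
        also have "\<dots> = (\<Sum>k<t. of_bool ((T ^^ k) x \<in> A n))"
          unfolding birkhoff_sum_def by (simp add: indicator_def of_bool_def)
        finally show "(1 - 1 / 2 ^ (n + 2)) * real t \<le> (\<Sum>k<t. of_bool ((T ^^ k) x \<in> A n))" .
      qed (use r0 p(2) in \<open>auto simp: u_def indicator_def\<close>)
      then have "(r * (1 - 1 / 2 ^ (n + 2)) * real t - real (p n)) / real t \<le> (\<Sum>k<t. u k) / real t"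
        using t_pos by (intro divide_right_mono) (auto simp: mult.assoc)
      moreover have "(r * (1 - 1 / 2 ^ (n + 2)) * real t - real (p n)) / real t =
          r - r * (1 / 2 ^ (n + 2)) - real (p n) / real t"
        using t_pos by (simp add: diff_divide_distrib right_diff_distrib)
      moreover have "real (p n) / real t \<le> 1 / 2 ^ n"
        using tp t_pos by (simp add: field_simps)
      moreover have "r * (1 / 2 ^ (n + 2)) \<le> r * (1 / 2 ^ n)"
        using r0 by (intro mult_left_mono) (auto simp: field_simps)
      moreover have "r * (1 / 2 ^ n) + 1 / 2 ^ n = (r + 1) / 2 ^ n" by (simp add: add_divide_distrib)
      moreover have "(r + 1) / 2 ^ n \<le> (r + 1) / 2 ^ j"
        using r0 \<open>j \<le> n\<close> by (intro divide_left_mono) (auto intro: power_increasing)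
      ultimately have "r - (r + 1) / 2 ^ j \<le> (\<Sum>k<t. u k) / real t" by linarith
      then show ?thesis unfolding average_def u_def .
    qed
    obtain j0 where j0: "\<And>j. j0 \<le> j \<Longrightarrow> (r + 1) / 2 ^ j < r - q"
      using half_power_small[of "r - q" "r + 1"] r(2) by auto
    have "q < average (\<lambda>k. indicator (finite_union w) ((T ^^ k) x)) t" if t: "N (pair i j0) \<le> t" for t
    proof -
      have large: "j < N (pair i j)" for j
      proof -
        have "j \<le> pair i j" unfolding pair_def by (rule le_prod_encode_2)
        also have "\<dots> < 2 ^ pair i j" by (rule less_exp)
        also have "\<dots> \<le> N (pair i j)" unfolding N_def using p(2)[of "pair i j"] by simp
        finally show ?thesis .
      qed
      \<comment> \<open>The time \<open>t\<close> belongs to the stage before the first one that starts after \<open>t\<close>.\<close>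
      let ?P = "\<lambda>j. j0 \<le> j \<and> t < N (pair i j)"
      define J where "J = (LEAST j. ?P j)"
      have "?P (max j0 t)" using large[of "max j0 t"] by auto
      then have J: "?P J" unfolding J_def by (rule LeastI)
      then have "J \<noteq> j0" using t by auto
      with J obtain j where j: "J = Suc j" "j0 \<le> j" by (cases J) auto
      have "\<not> ?P j" using not_less_Least[of j ?P] j(1) unfolding J_def by auto
      then have "N (pair i j) \<le> t" using j(2) by auto
      from block[OF this] J j j0[OF j(2)] show ?thesis by auto
    qed
    then show ?thesis by (auto simp: eventually_sequentially)
  qed
  with x(1) show ?thesis by blast
qed

end

theorem theoremB:
  fixes s :: "nat \<Rightarrow> 'a::polish_space" and T :: "'a \<Rightarrow> 'a" and \<mu> :: "'a measure"
  assumes "computable_metric_space s"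
    and "bounded (UNIV :: 'a set)"
    and "prob_space \<mu>" and "sets \<mu> = sets borel"
    and "computable_measure s \<mu>"
    and "invariant_measure T \<mu>"
    and "ergodic_measure T \<mu>"
    and "ae_computable s \<mu> s T"
  shows "\<exists>x. computable_point dist s x \<and>
    (\<forall>f :: 'a \<Rightarrow> real. continuous_on UNIV f \<longrightarrow> compact (closure {y. f y \<noteq> 0}) \<longrightarrow>
      (\<lambda>n. (\<Sum>k<n. f ((T ^^ k) x)) / real n) \<longlonglongrightarrow> (\<integral>y. f y \<partial>\<mu>))"
proof -
  interpret prob_space \<mu> by fact
  interpret computable_ergodic s \<mu> T
    by unfold_locales (use assms in \<open>auto simp: invariant_measure_def\<close>)
  obtain x where x: "computable_point dist s x"
    "\<And>w q. q < measure \<mu> (finite_union w) \<Longrightarrow>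
      \<forall>\<^sub>F n in sequentially. q < average (\<lambda>k. indicator (finite_union w) ((T ^^ k) x)) n"
    using computable_point_visit_frequencies by blast
  have freq: "\<forall>\<^sub>F n in sequentially. q < average (\<lambda>k. indicator U ((T ^^ k) x)) n"
    if U: "open U" "q < measure \<mu> U" for U q
  proof -
    obtain w where w: "finite_union w \<subseteq> U" "q < measure \<mu> (finite_union w)"
      using finite_union_approximates_open[OF U] by blast
    have "average (\<lambda>k. indicator (finite_union w) ((T ^^ k) x)) n \<le>
        average (\<lambda>k. indicator U ((T ^^ k) x)) n" for n
      using w(1) by (intro average_mono) (auto simp: indicator_def)
    then show ?thesis
      using x(2)[OF w(2)] by (auto elim!: eventually_mono intro: less_le_trans)
  qed
  have "(\<lambda>n. (\<Sum>k<n. f ((T ^^ k) x)) / real n) \<longlonglongrightarrow> (\<integral>y. f y \<partial>\<mu>)"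
    if f: "continuous_on UNIV f" and supp: "compact (closure {y. f y \<noteq> 0})" for f :: "'a \<Rightarrow> real"
  proof -
    let ?K = "closure {y. f y \<noteq> 0}"
    have "bounded (f ` ?K)"
      by (intro compact_imp_bounded compact_continuous_image supp continuous_on_subset[OF f]) auto
    then obtain B where B: "\<And>y. y \<in> ?K \<Longrightarrow> \<bar>f y\<bar> \<le> B" unfolding bounded_iff by auto
    have "\<bar>f y\<bar> \<le> \<bar>B\<bar>" for y
    proof (cases "f y = 0")
      case False
      then have "y \<in> ?K" using subsetD[OF closure_subset, of y "{y. f y \<noteq> 0}"] by simp
      then show ?thesis using B[of y] by linarith
    qed simp
    from average_tendsto_integral[OF assms(3,4) freq f this] show ?thesis
      unfolding average_def .
  qed
  with x(1) show ?thesis by blast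
qed

end
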